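(* Let $M$ be an $n$-dimensional Hadamard manifold and let $p\in M$. For every fixed $x\in M$, the mappings $Y_p(x,\cdot):T_xM\to M$ and $V_p(x,\cdot):M\to T_xM$ are inverse to each other; that is, $$V_p(x,Y_p(x,v))=v\quad\text{for all }v\in T_xM,\qquad Y_p(x,V_p(x,y))=y\quad\text{for all }y\in M.$$ Furthermore, for each fixed $y\in M$, the function $H_y:M\to\mathbb{R}$, $H_y(z):=H_p(z,y)$, satisfies $$V_p(x,y)\in\partial B^p H_y(x),\qquad x\in M,$$ and in fact the support inequality defining the $B^p$-subdifferential holds as an equality at every point of $M$, i.e. $H_y(z)=H_y(x)+H_p(z,Y_p(x,V_p(x,y)))-H_p(x,Y_p(x,V_p(x,y)))$ for all $x,z\in M$.
   Context: A Hadamard manifold is a complete, simply connected Riemannian manifold of nonpositive sectional curvature; $d$ is its Riemannian distance and $\exp$ its exponential map (each $\exp_p$ is a diffeomorphism). For $q\in M$ and a unit vector $u\in T_qM$, $\gamma_{(q,u)}(t)=\exp_q(tu)$, $t\ge 0$, is the unit-speed geodesic ray from $q$ in direction $u$, and $B_u^q(x)=\lim_{t\to+\infty}\bigl(d(x,\gamma_{(q,u)}(t))-t\bigr)$ is the Busemann function. For a nonzero $u\in T_qM$, $B_u^q:=B_{u/\|u\|}^q$. Two unit-speed rays $\gamma,\sigma$ are asymptotic if $t\mapsto d(\gamma(t),\sigma(t))$ is bounded on $[0,\infty)$; for each ray and each point $q$ there is exactly one ray from $q$ asymptotic to it. Busemann coupling with base point $p$: $H_p:M\times M\to\mathbb{R}$,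 $H_p(z,y)=d(p,z)\,B^p_{-\exp_p^{-1}z}(y)$ if $z\ne p$, and $H_p(p,y)=0$. For $x\in M$ and $v\in T_xM\setminus\{0\}$, $\eta_{p,x}(v)\in T_pM$ is the unique unit vector such that $\gamma_{(p,\eta_{p,x}(v))}$ and $\gamma_{(x,-v/\|v\|)}$ are asymptotic; $Y_p(x,v):=\exp_p(-\|v\|\,\eta_{p,x}(v))$ for $v\neq 0$ and $Y_p(x,0):=p$. For $y\ne p$, let $\eta_p(y):=-\exp_p^{-1}y/d(p,y)$ and let $u_{x,y}\in T_xM$ be the unique unit vector such that $\gamma_{(p,\eta_p(y))}$ and $\gamma_{(x,-u_{x,y})}$ are asymptotic; $V_p(x,y):=d(p,y)\,u_{x,y}\in T_xM$ for $y\ne p$ and $V_p(x,p):=0$. $B^p$-subdifferential of $f:M\to\mathbb{R}$: $\partial B^p f(x)$ is the set of all $v\in T_xM$ such that $f(z)\ge f(x)+H_p(z,Y_p(x,v))-H_p(x,Y_p(x,v))$ for all $z\in M$. *)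

theory Defs
  imports "HOL-Analysis.Analysis"
begin

section \<open>Smooth maps on open subsets of Euclidean space\<close>

text \<open>Both notions are intended for open sets \<open>S\<close> only.\<close>

primrec Ck_on :: "nat \<Rightarrow> 'a::euclidean_space set \<Rightarrow> ('a \<Rightarrow> 'b::real_normed_vector) \<Rightarrow> bool" where
  "Ck_on 0 S f \<longleftrightarrow> continuous_on S f"
| "Ck_on (Suc k) S f \<longleftrightarrow>
     (\<forall>a\<in>S. f differentiable (at a)) \<and> (\<forall>u. Ck_on k S (\<lambda>a. frechet_derivative f (at a) u))"

definition smooth_on :: "'a::euclidean_space set \<Rightarrow> ('a \<Rightarrow> 'b::real_normed_vector) \<Rightarrow> bool" where
  "smooth_on S f \<longleftrightarrow> (\<forall>k. Ck_on k S f)"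


section \<open>Riemannian manifolds\<close>

text \<open>
  The manifold is the whole type \<open>'m\<close>, modelled on \<open>'e\<close>; its dimension is \<open>DIM('e)\<close>.
  A chart is a pair of its domain and its coordinate map (whose values off the domain are
  irrelevant).

  One chart of the atlas, \<open>chart_at M x\<close>, is selected around every point \<open>x\<close>, and a tangent vector
  at \<open>x\<close> is given by its components in that chart. So every \<open>T\<^sub>xM\<close> is a copy of \<open>'e\<close>, but
  there is no identification of tangent spaces at different points: \<open>metric M x\<close> is the inner
  product of \<open>T\<^sub>xM\<close>, and \<open>lift_vec\<close> below is the change of components.
\<close>

type_synonym ('m, 'e) chart = "'m set \<times> ('m \<Rightarrow> 'e)"

record ('m, 'e) riemannian =
  atlas :: "('m, 'e) chart set"
  metric :: "'m \<Rightarrow> 'e \<Rightarrow> 'e \<Rightarrow> real"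

definition chart_inv :: "('m, 'e) chart \<Rightarrow> 'e \<Rightarrow> 'm" where
  "chart_inv c = inv_into (fst c) (snd c)"

definition chart_image :: "('m, 'e) chart \<Rightarrow> 'e set" where
  "chart_image c = snd c ` fst c"

definition smooth_atlas ::
  "('m::topological_space, 'e::euclidean_space) chart set \<Rightarrow> bool" where
  "smooth_atlas A \<longleftrightarrow>
     (\<forall>c\<in>A. open (fst c) \<and> open (chart_image c) \<and>
        homeomorphism (fst c) (chart_image c) (snd c) (chart_inv c)) \<and>
     (\<Union>c\<in>A. fst c) = UNIV \<and>
     (\<forall>c\<in>A. \<forall>d\<in>A. smooth_on (snd c ` (fst c \<inter> fst d)) (snd d \<circ> chart_inv c))"

definition chart_at :: "('m, 'e) riemannian \<Rightarrow> 'm \<Rightarrow> ('m, 'e) chart" where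
  "chart_at M x = (SOME c. c \<in> atlas M \<and> x \<in> fst c)"

text \<open>\<open>lift_vec M c a u\<close> is the tangent vector at the point with \<open>c\<close>-coordinates \<open>a\<close> whose components
  in the chart \<open>c\<close> are \<open>u\<close>; \<open>chart_metric M c a\<close> is the metric in the chart \<open>c\<close>.\<close>

definition lift_vec ::
  "('m, 'e::euclidean_space) riemannian \<Rightarrow> ('m, 'e) chart \<Rightarrow> 'e \<Rightarrow> 'e \<Rightarrow> 'e" where
  "lift_vec M c a u =
     frechet_derivative (snd (chart_at M (chart_inv c a)) \<circ> chart_inv c) (at a) u"

definition chart_metric ::
  "('m, 'e::euclidean_space) riemannian \<Rightarrow> ('m, 'e) chart \<Rightarrow> 'e \<Rightarrow> 'e \<Rightarrow> 'e \<Rightarrow> real" where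
  "chart_metric M c a u w = metric M (chart_inv c a) (lift_vec M c a u) (lift_vec M c a w)"

definition riemannian_manifold ::
  "('m::{t2_space,second_countable_topology}, 'e::euclidean_space) riemannian \<Rightarrow> bool" where
  "riemannian_manifold M \<longleftrightarrow>
     smooth_atlas (atlas M) \<and>
     (\<forall>x. bilinear (metric M x) \<and>
        (\<forall>u w. metric M x u w = metric M x w u) \<and>
        (\<forall>u. u \<noteq> 0 \<longrightarrow> metric M x u u > 0)) \<and>
     (\<forall>c\<in>atlas M. \<forall>u w. smooth_on (chart_image c) (\<lambda>a. chart_metric M c a u w))"

definition tnorm :: "('m, 'e) riemannian \<Rightarrow> 'm \<Rightarrow> 'e \<Rightarrow> real" where
  "tnorm M x u = sqrt (metric M x u u)"


section \<open>Levi-Civita connection and sectional curvature\<close>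

text \<open>\<open>christoffel M c a u w\<close> is the covariant derivative, at the point with \<open>c\<close>-coordinates \<open>a\<close>, of
  the field with constant components \<open>w\<close> in direction \<open>u\<close>, by the Koszul formula in the chart \<open>c\<close>.\<close>

definition christoffel ::
  "('m, 'e::euclidean_space) riemannian \<Rightarrow> ('m, 'e) chart \<Rightarrow> 'e \<Rightarrow> 'e \<Rightarrow> 'e \<Rightarrow> 'e" where
  "christoffel M c a u w = (THE z. \<forall>y. 2 * chart_metric M c a z y =
       frechet_derivative (\<lambda>b. chart_metric M c b w y) (at a) u
     + frechet_derivative (\<lambda>b. chart_metric M c b u y) (at a) w
     - frechet_derivative (\<lambda>b. chart_metric M c b u w) (at a) y)"

text \<open>Curvature tensor \<open>R(u, v) w = \<nabla>\<^sub>u \<nabla>\<^sub>v w - \<nabla>\<^sub>v \<nabla>\<^sub>u w\<close> for fields with constant (hence commuting)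
  components in the chart \<open>c\<close>.\<close>

definition curvature ::
  "('m, 'e::euclidean_space) riemannian \<Rightarrow> ('m, 'e) chart \<Rightarrow> 'e \<Rightarrow> 'e \<Rightarrow> 'e \<Rightarrow> 'e \<Rightarrow> 'e" where
  "curvature M c a u v w =
       frechet_derivative (\<lambda>b. christoffel M c b v w) (at a) u
     - frechet_derivative (\<lambda>b. christoffel M c b u w) (at a) v
     + christoffel M c a u (christoffel M c a v w)
     - christoffel M c a v (christoffel M c a u w)"

text \<open>In the chart \<open>chart_at M x\<close> the components of \<open>u \<in> T\<^sub>xM\<close> are \<open>u\<close> itself.\<close>

definition sectional_curvature ::
  "('m, 'e::euclidean_space) riemannian \<Rightarrow> 'm \<Rightarrow> 'e \<Rightarrow> 'e \<Rightarrow> real" where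
  "sectional_curvature M x u v =
     metric M x (curvature M (chart_at M x) (snd (chart_at M x) x) u v v) u /
     (metric M x u u * metric M x v v - (metric M x u v)\<^sup>2)"

definition nonpositive_curvature :: "('m, 'e::euclidean_space) riemannian \<Rightarrow> bool" where
  "nonpositive_curvature M \<longleftrightarrow>
     (\<forall>x u v. u \<noteq> v \<and> independent {u, v} \<longrightarrow> sectional_curvature M x u v \<le> 0)"


section \<open>Curves, geodesics, exponential map and distance\<close>

definition velocity ::
  "('m, 'e::euclidean_space) riemannian \<Rightarrow> (real \<Rightarrow> 'm) \<Rightarrow> real \<Rightarrow> 'e" where
  "velocity M \<gamma> t = vector_derivative (snd (chart_at M (\<gamma> t)) \<circ> \<gamma>) (at t)"

text \<open>In the next two definitions \<open>\<gamma>'\<close> is the derivative of the coordinate expression of \<open>\<gamma>\<close> on the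
  (relatively open) set of times at which \<open>\<gamma>\<close> is in the domain of the chart \<open>c\<close>.\<close>

definition geodesic_line ::
  "('m::topological_space, 'e::euclidean_space) riemannian \<Rightarrow> (real \<Rightarrow> 'm) \<Rightarrow> bool" where
  "geodesic_line M \<gamma> \<longleftrightarrow> continuous_on UNIV \<gamma> \<and>
     (\<forall>c\<in>atlas M. \<exists>\<gamma>'. \<forall>t. \<gamma> t \<in> fst c \<longrightarrow>
        (snd c \<circ> \<gamma> has_vector_derivative \<gamma>' t) (at t) \<and>
        (\<gamma>' has_vector_derivative - christoffel M c (snd c (\<gamma> t)) (\<gamma>' t) (\<gamma>' t)) (at t))"

definition C1_curve_on ::
  "('m::topological_space, 'e::euclidean_space) riemannian \<Rightarrow> real \<Rightarrow> real \<Rightarrow> (real \<Rightarrow> 'm) \<Rightarrow> bool" where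
  "C1_curve_on M a b \<gamma> \<longleftrightarrow> continuous_on {a..b} \<gamma> \<and>
     (\<forall>c\<in>atlas M. \<exists>\<gamma>'. continuous_on {t\<in>{a..b}. \<gamma> t \<in> fst c} \<gamma>' \<and>
        (\<forall>t\<in>{a..b}. \<gamma> t \<in> fst c \<longrightarrow>
           (snd c \<circ> \<gamma> has_vector_derivative \<gamma>' t) (at t within {a..b})))"

definition piecewise_C1_curve ::
  "('m::topological_space, 'e::euclidean_space) riemannian \<Rightarrow> (real \<Rightarrow> 'm) \<Rightarrow> bool" where
  "piecewise_C1_curve M \<gamma> \<longleftrightarrow> continuous_on {0..1} \<gamma> \<and>
     (\<exists>S. finite S \<and>
        (\<forall>a b. 0 \<le> a \<and> a < b \<and> b \<le> 1 \<and> {a<..<b} \<inter> S = {} \<longrightarrow> C1_curve_on M a b \<gamma>))"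

definition curve_length ::
  "('m, 'e::euclidean_space) riemannian \<Rightarrow> (real \<Rightarrow> 'm) \<Rightarrow> real" where
  "curve_length M \<gamma> = integral {0..1} (\<lambda>t. tnorm M (\<gamma> t) (velocity M \<gamma> t))"

definition rdist ::
  "('m::topological_space, 'e::euclidean_space) riemannian \<Rightarrow> 'm \<Rightarrow> 'm \<Rightarrow> real" where
  "rdist M x y = Inf {curve_length M \<gamma> | \<gamma>. piecewise_C1_curve M \<gamma> \<and> \<gamma> 0 = x \<and> \<gamma> 1 = y}"

text \<open>Completeness is geodesic completeness: every geodesic extends to the real line.\<close>

definition complete_manifold ::
  "('m::topological_space, 'e::euclidean_space) riemannian \<Rightarrow> bool" where
  "complete_manifold M \<longleftrightarrow>
     (\<forall>p v. \<exists>\<gamma>. geodesic_line M \<gamma> \<and> \<gamma> 0 = p \<and> velocity M \<gamma> 0 = v)"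

definition rexp ::
  "('m::topological_space, 'e::euclidean_space) riemannian \<Rightarrow> 'm \<Rightarrow> 'e \<Rightarrow> 'm" where
  "rexp M p v = (THE \<gamma>. geodesic_line M \<gamma> \<and> \<gamma> 0 = p \<and> velocity M \<gamma> 0 = v) 1"

definition rexp_inv ::
  "('m::topological_space, 'e::euclidean_space) riemannian \<Rightarrow> 'm \<Rightarrow> 'm \<Rightarrow> 'e" where
  "rexp_inv M p = inv (rexp M p)"

text \<open>\<open>simply_connected\<close> includes path-connectedness.\<close>

definition hadamard_manifold ::
  "('m::{t2_space,second_countable_topology}, 'e::euclidean_space) riemannian \<Rightarrow> bool" where
  "hadamard_manifold M \<longleftrightarrow>
     riemannian_manifold M \<and> complete_manifold M \<and>
     simply_connected (UNIV :: 'm set) \<and> nonpositive_curvature M"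


section \<open>Busemann functions and the Busemann coupling\<close>

definition ray ::
  "('m::topological_space, 'e::euclidean_space) riemannian \<Rightarrow> 'm \<Rightarrow> 'e \<Rightarrow> real \<Rightarrow> 'm" where
  "ray M q u t = rexp M q (t *\<^sub>R u)"

definition busemann ::
  "('m::topological_space, 'e::euclidean_space) riemannian \<Rightarrow> 'm \<Rightarrow> 'e \<Rightarrow> 'm \<Rightarrow> real" where
  "busemann M q u x = Lim at_top (\<lambda>t. rdist M x (ray M q (u /\<^sub>R tnorm M q u) t) - t)"

definition asymptotic ::
  "('m::topological_space, 'e::euclidean_space) riemannian \<Rightarrow> (real \<Rightarrow> 'm) \<Rightarrow> (real \<Rightarrow> 'm) \<Rightarrow> bool" where
  "asymptotic M \<gamma> \<sigma> \<longleftrightarrow> bounded ((\<lambda>t. rdist M (\<gamma> t) (\<sigma> t)) ` {0..})"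

definition busemann_coupling ::
  "('m::topological_space, 'e::euclidean_space) riemannian \<Rightarrow> 'm \<Rightarrow> 'm \<Rightarrow> 'm \<Rightarrow> real" where
  "busemann_coupling M p z y =
     (if z = p then 0 else rdist M p z * busemann M p (- rexp_inv M p z) y)"

definition eta_dir ::
  "('m::topological_space, 'e::euclidean_space) riemannian \<Rightarrow> 'm \<Rightarrow> 'm \<Rightarrow> 'e \<Rightarrow> 'e" where
  "eta_dir M p x v =
     (THE e. tnorm M p e = 1 \<and> asymptotic M (ray M p e) (ray M x (- (v /\<^sub>R tnorm M x v))))"

definition Y_map ::
  "('m::topological_space, 'e::euclidean_space) riemannian \<Rightarrow> 'm \<Rightarrow> 'm \<Rightarrow> 'e \<Rightarrow> 'm" where
  "Y_map M p x v = (if v = 0 then p else rexp M p (- tnorm M x v *\<^sub>R eta_dir M p x v))"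

definition eta_pt ::
  "('m::topological_space, 'e::euclidean_space) riemannian \<Rightarrow> 'm \<Rightarrow> 'm \<Rightarrow> 'e" where
  "eta_pt M p y = - (rexp_inv M p y /\<^sub>R rdist M p y)"

definition u_dir ::
  "('m::topological_space, 'e::euclidean_space) riemannian \<Rightarrow> 'm \<Rightarrow> 'm \<Rightarrow> 'm \<Rightarrow> 'e" where
  "u_dir M p x y =
     (THE u. tnorm M x u = 1 \<and> asymptotic M (ray M p (eta_pt M p y)) (ray M x (- u)))"

definition V_map ::
  "('m::topological_space, 'e::euclidean_space) riemannian \<Rightarrow> 'm \<Rightarrow> 'm \<Rightarrow> 'm \<Rightarrow> 'e" where
  "V_map M p x y = (if y = p then 0 else rdist M p y *\<^sub>R u_dir M p x y)"

definition B_subdifferential ::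
  "('m::topological_space, 'e::euclidean_space) riemannian \<Rightarrow> 'm \<Rightarrow> ('m \<Rightarrow> real) \<Rightarrow> 'm \<Rightarrow> 'e set" where
  "B_subdifferential M p f x =
     {v. \<forall>z. f z \<ge> f x + busemann_coupling M p z (Y_map M p x v)
                       - busemann_coupling M p x (Y_map M p x v)}"

end

theory Submission
  imports Defs
begin

text \<open>
  By the Cartan-Hadamard theorem \<open>exp\<^sub>q\<close> is a diffeomorphism for every \<open>q\<close>. Nonpositive curvature
  makes \<open>|J|\<close> convex for every Jacobi field \<open>J\<close>; hence \<open>exp\<^sub>q\<close> expands distances, and
  \<open>d(exp\<^sub>q(sa), exp\<^sub>q(sb)) \<le> s d(exp\<^sub>q a, exp\<^sub>q b)\<close> for \<open>0 < s \<le> 1\<close>. The first inequality shows that distinct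
  rays from one point diverge linearly, so asymptotic rays from a point are unique; the second shows
  that the geodesics from \<open>x\<close> to far points of a ray stay close to it, so that a limit of them is an
  asymptotic ray from \<open>x\<close>. The defining condition of the directions in \<open>Y\<^sub>p(x,\<cdot>)\<close> and in \<open>V\<^sub>p(x,\<cdot>)\<close> is one and
  the same relation between unit vectors at \<open>p\<close> and at \<open>x\<close>, read in the two directions, and being
  asymptotic to a given ray determines each from the other. The subdifferential statements follow
  from \<open>Y\<^sub>p(x,V\<^sub>p(x,y)) = y\<close> alone.
\<close>

section \<open>Continuously differentiable maps\<close>

text \<open>Both inequalities come from one function. The field J along \<open>geo q a\<close> with
  J(0) = 0 and J'(0) = w has length |J(t)| convex in t and tending to 0 at 0, so |J(t)|/t is
  nondecreasing. Its limit at 0 is |w|: comparing the limit with t = 1 gives the expansion,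
  comparing t = s with t = 1 the contraction by s. These bounds on differentials become bounds on
  distances by pulling curves back through the inverse of \<open>rexp M q\<close>. That inverse
  exists because of the expansion: lifts of coordinate segments have bounded speed, so they cannot
  break off, and the resulting local sections make \<open>rexp M q\<close> a covering.

  The obstacle is that tangent vectors are given in a chart selected separately at each point, so
  \<open>velocity\<close> need not be continuous. The analysis is therefore done in one fixed chart,
  on pairs of position and velocity, and transferred by transition maps. Completeness supplies
  geodesics for all times; what has to be built up is their C1 dependence on the initial velocity,
  box by box along the geodesic.\<close>

abbreviation dd :: "('a::real_normed_vector \<Rightarrow> 'b::real_normed_vector) \<Rightarrow> 'a \<Rightarrow> 'a \<Rightarrow> 'b" where
  "dd f x \<equiv> frechet_derivative f (at x)"

text \<open>Continuity of the derivative is asked direction by direction. In finite dimensions this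
  is continuity in the operator norm (\<open>continuous_on_Blinfun\<close>), and it is easy to check
  for sums, products and compositions.\<close>

definition C1_on :: "'a::euclidean_space set \<Rightarrow> ('a \<Rightarrow> 'b::euclidean_space) \<Rightarrow> bool" where
  "C1_on S f \<longleftrightarrow> open S \<and> (\<forall>x\<in>S. f differentiable (at x)) \<and> (\<forall>u. continuous_on S (\<lambda>x. dd f x u))"

lemma dd_eq: "(f has_derivative f') (at x) \<Longrightarrow> dd f x = f'"
  by (metis frechet_derivative_at)

lemma C1_onI:
  assumes "open S" "\<And>x. x \<in> S \<Longrightarrow> (f has_derivative f' x) (at x)"
    and "\<And>u. continuous_on S (\<lambda>x. f' x u)"
  shows "C1_on S f"
proof -
  have "dd f x = f' x" if "x \<in> S" for x
    using assms(2)[OF that] by (rule dd_eq)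
  with assms show ?thesis
    by (auto simp: C1_on_def differentiable_def cong: continuous_on_cong)
qed

lemma C1_on_open: "C1_on S f \<Longrightarrow> open S"
  by (simp add: C1_on_def)

lemma C1_on_deriv: "C1_on S f \<Longrightarrow> x \<in> S \<Longrightarrow> (f has_derivative dd f x) (at x)"
  by (simp add: C1_on_def frechet_derivative_works)

lemma C1_on_cont_dd: "C1_on S f \<Longrightarrow> continuous_on S (\<lambda>x. dd f x u)"
  by (simp add: C1_on_def)

lemma C1_on_cont: "C1_on S f \<Longrightarrow> continuous_on S f"
  by (meson C1_on_deriv continuous_at_imp_continuous_on has_derivative_continuous)

lemma C1_on_bl: "C1_on S f \<Longrightarrow> x \<in> S \<Longrightarrow> bounded_linear (dd f x)"
  using C1_on_deriv has_derivative_bounded_linear by blast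

lemma C1_on_Blinfun: "C1_on S f \<Longrightarrow> x \<in> S \<Longrightarrow> blinfun_apply (Blinfun (dd f x)) = dd f x"
  by (simp add: C1_on_bl bounded_linear_Blinfun_apply)

lemma continuous_on_Blinfun:
  fixes f :: "'a::t2_space \<Rightarrow> 'b::euclidean_space \<Rightarrow> 'c::euclidean_space"
  assumes "\<And>x. x \<in> S \<Longrightarrow> bounded_linear (f x)" "\<And>u. continuous_on S (\<lambda>x. f x u)"
  shows "continuous_on S (\<lambda>x. Blinfun (f x))"
proof (rule continuous_on_blinfun_componentwise)
  fix i :: 'b assume "i \<in> Basis"
  have "continuous_on S (\<lambda>x. blinfun_apply (Blinfun (f x)) i) \<longleftrightarrow> continuous_on S (\<lambda>x. f x i)"
    by (rule continuous_on_cong) (auto simp: assms(1) bounded_linear_Blinfun_apply)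
  with assms(2) show "continuous_on S (\<lambda>x. blinfun_apply (Blinfun (f x)) i)"
    by simp
qed

lemma continuous_on_blinear_apply:
  fixes f :: "'a::t2_space \<Rightarrow> 'b::euclidean_space \<Rightarrow> 'c::euclidean_space"
  assumes "\<And>x. x \<in> S \<Longrightarrow> bounded_linear (f x)" "\<And>u. continuous_on S (\<lambda>x. f x u)"
    and "continuous_on S g"
  shows "continuous_on S (\<lambda>x. f x (g x))"
proof -
  have "continuous_on S (\<lambda>x. blinfun_apply (Blinfun (f x)) (g x))"
    by (intro continuous_intros continuous_on_Blinfun assms)
  then show ?thesis
    by (rule continuous_on_eq) (auto simp: assms(1) bounded_linear_Blinfun_apply)
qed

lemma C1_on_dd_Blinfun: "C1_on S f \<Longrightarrow> continuous_on S (\<lambda>x. Blinfun (dd f x))"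
  by (intro continuous_on_Blinfun C1_on_bl C1_on_cont_dd)

lemma continuous_on_dd_comp:
  fixes g :: "'a::t2_space \<Rightarrow> 'b::euclidean_space" and f :: "'b \<Rightarrow> 'c::euclidean_space"
  assumes "C1_on T f" "continuous_on S g" "g ` S \<subseteq> T" "continuous_on S h"
  shows "continuous_on S (\<lambda>x. dd f (g x) (h x))"
proof (rule continuous_on_blinear_apply[where f = "\<lambda>x. dd f (g x)"])
  show "bounded_linear (dd f (g x))" if "x \<in> S" for x
    using that assms by (auto intro: C1_on_bl)
  show "continuous_on S (\<lambda>x. dd f (g x) u)" for u
    using continuous_on_compose2[OF C1_on_cont_dd[OF assms(1)] assms(2,3)] .
qed fact

lemma C1_on_subset: "C1_on S f \<Longrightarrow> T \<subseteq> S \<Longrightarrow> open T \<Longrightarrow> C1_on T f"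
  unfolding C1_on_def by (meson continuous_on_subset subsetD)

lemma C1_on_Un_local: "open S \<Longrightarrow> (\<And>x. x \<in> S \<Longrightarrow> \<exists>T. x \<in> T \<and> C1_on T f) \<Longrightarrow> C1_on S f"
proof -
  assume S: "open S" and *: "\<And>x. x \<in> S \<Longrightarrow> \<exists>T. x \<in> T \<and> C1_on T f"
  show ?thesis
  proof (rule C1_onI[OF S])
    show "(f has_derivative dd f x) (at x)" if "x \<in> S" for x
      using *[OF that] C1_on_deriv by blast
    show "continuous_on S (\<lambda>x. dd f x u)" for u
    proof (rule continuous_at_imp_continuous_on, rule ballI)
      fix x assume "x \<in> S"
      then obtain T where "x \<in> T" "C1_on T f"
        using * by blast
      then show "isCont (\<lambda>x. dd f x u) x"
        using C1_on_cont_dd C1_on_open continuous_on_eq_continuous_at by blast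
    qed
  qed
qed

text \<open>f and g have exactly the same derivatives at x, possibly none, so the choice behind
  \<open>frechet_derivative\<close> picks the same map for both.\<close>

lemma dd_cong:
  assumes "open S" "x \<in> S" "\<And>y. y \<in> S \<Longrightarrow> f y = g y"
  shows "dd f x = dd g x"
proof -
  have "(f has_derivative f') (at x) = (g has_derivative f') (at x)" for f'
    using assms by (metis has_derivative_transform_within_open)
  then show ?thesis
    by (simp add: frechet_derivative_def)
qed

lemma C1_on_cong:
  assumes "\<And>y. y \<in> S \<Longrightarrow> f y = g y" and "C1_on S f"
  shows "C1_on S g"
proof (rule C1_onI)
  show S: "open S" by (rule C1_on_open) fact
  show "(g has_derivative dd f x) (at x)" if "x \<in> S" for x
    using C1_on_deriv[OF assms(2) that] assms(1) S that
    by (metis has_derivative_transform_within_open)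
qed (rule C1_on_cont_dd[OF assms(2)])

lemma C1_on_compose:
  assumes g: "C1_on T g" and f: "C1_on S f" and "f ` S \<subseteq> T"
  shows "C1_on S (\<lambda>x. g (f x))"
    and "x \<in> S \<Longrightarrow> dd (\<lambda>x. g (f x)) x u = dd g (f x) (dd f x u)"
proof -
  have *: "((\<lambda>x. g (f x)) has_derivative (\<lambda>u. dd g (f x) (dd f x u))) (at x)" if "x \<in> S" for x
    using that assms(3) by (intro has_derivative_compose[OF C1_on_deriv[OF f] C1_on_deriv[OF g]]) auto
  show "C1_on S (\<lambda>x. g (f x))"
    by (rule C1_onI[OF C1_on_open[OF f] *])
       (auto intro!: continuous_on_dd_comp[OF g] C1_on_cont[OF f] assms(3) C1_on_cont_dd[OF f])
  show "dd (\<lambda>x. g (f x)) x u = dd g (f x) (dd f x u)" if "x \<in> S"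
    using dd_eq[OF *[OF that]] by simp
qed

lemma C1_on_bounded_linear: "bounded_linear f \<Longrightarrow> open S \<Longrightarrow> C1_on S f"
  by (rule C1_onI[where f' = "\<lambda>_. f"]) (auto intro: bounded_linear_imp_has_derivative)

lemma C1_on_linear: "linear f \<Longrightarrow> open S \<Longrightarrow> C1_on S f"
  by (simp add: C1_on_bounded_linear linear_conv_bounded_linear)

lemma C1_on_const: "open S \<Longrightarrow> C1_on S (\<lambda>x. c)"
  by (rule C1_onI[where f' = "\<lambda>_ _. 0"]) auto

lemma C1_on_add:
  "C1_on S f \<Longrightarrow> C1_on S g \<Longrightarrow> C1_on S (\<lambda>x. f x + g x)"
  by (rule C1_onI[where f' = "\<lambda>x u. dd f x u + dd g x u"])
     (auto intro!: derivative_eq_intros C1_on_deriv continuous_intros C1_on_cont_dd dest: C1_on_open)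

lemma C1_on_diff:
  "C1_on S f \<Longrightarrow> C1_on S g \<Longrightarrow> C1_on S (\<lambda>x. f x - g x)"
  by (rule C1_onI[where f' = "\<lambda>x u. dd f x u - dd g x u"])
     (auto intro!: derivative_eq_intros C1_on_deriv continuous_intros C1_on_cont_dd dest: C1_on_open)

lemma C1_on_Pair:
  "C1_on S f \<Longrightarrow> C1_on S g \<Longrightarrow> C1_on S (\<lambda>x. (f x, g x))"
  by (rule C1_onI[where f' = "\<lambda>x u. (dd f x u, dd g x u)"])
     (auto intro!: derivative_eq_intros C1_on_deriv continuous_intros C1_on_cont_dd dest: C1_on_open)

lemma C1_on_sum:
  assumes "finite I" "open S" "\<And>i. i \<in> I \<Longrightarrow> C1_on S (f i)"
  shows "C1_on S (\<lambda>x. \<Sum>i\<in>I. f i x)"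
  using assms by (induction I rule: finite_induct) (auto intro!: C1_on_const C1_on_add)

lemma C1_on_bilinear:
  assumes "bounded_bilinear pr" "C1_on S f" "C1_on S g"
  shows "C1_on S (\<lambda>x. pr (f x) (g x))"
proof -
  interpret bounded_bilinear pr by fact
  show ?thesis
  proof (rule C1_onI[OF C1_on_open[OF assms(2)]])
    show "((\<lambda>x. pr (f x) (g x)) has_derivative (\<lambda>u. pr (f x) (dd g x u) + pr (dd f x u) (g x))) (at x)"
      if "x \<in> S" for x
      using that by (intro FDERIV C1_on_deriv[OF assms(2)] C1_on_deriv[OF assms(3)])
    show "continuous_on S (\<lambda>x. pr (f x) (dd g x u) + pr (dd f x u) (g x))" for u
      by (intro continuous_on_add continuous_on C1_on_cont_dd C1_on_cont assms)
  qed
qed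

lemmas C1_on_scaleR = C1_on_bilinear[OF bounded_bilinear_scaleR]
lemmas C1_on_mult = C1_on_bilinear[OF bounded_bilinear_mult]

lemma C1_on_linear_comp: "linear l \<Longrightarrow> C1_on S f \<Longrightarrow> C1_on S (\<lambda>x. l (f x))"
  by (rule C1_on_compose(1)[of UNIV]) (auto intro: C1_on_linear)

lemma C1_on_inner_left: "C1_on S f \<Longrightarrow> C1_on S (\<lambda>x. f x \<bullet> i)"
  by (rule C1_on_linear_comp[of "\<lambda>y. y \<bullet> i"])
     (auto intro: bounded_linear.linear bounded_linear_inner_left)

text \<open>Expanding the argument in the basis turns f x (g x) into a finite sum of products of C1
  functions.\<close>

lemma C1_on_blinear_apply:
  fixes f :: "'a::euclidean_space \<Rightarrow> 'b::euclidean_space \<Rightarrow> 'c::euclidean_space"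
  assumes lin: "\<And>x. x \<in> S \<Longrightarrow> linear (f x)" and f: "\<And>u. C1_on S (\<lambda>x. f x u)" and g: "C1_on S g"
  shows "C1_on S (\<lambda>x. f x (g x))"
proof (rule C1_on_cong)
  show "C1_on S (\<lambda>x. \<Sum>i\<in>Basis. (g x \<bullet> i) *\<^sub>R f x i)"
    by (intro C1_on_sum C1_on_scaleR C1_on_inner_left f g C1_on_open[OF g] finite_Basis)
  show "(\<Sum>i\<in>Basis. (g x \<bullet> i) *\<^sub>R f x i) = f x (g x)" if "x \<in> S" for x
  proof -
    have "f x (g x) = f x (\<Sum>i\<in>Basis. (g x \<bullet> i) *\<^sub>R i)"
      by (simp add: euclidean_representation)
    also have "\<dots> = (\<Sum>i\<in>Basis. (g x \<bullet> i) *\<^sub>R f x i)"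
      using lin[OF that] by (simp add: linear_sum linear_scale)
    finally show ?thesis ..
  qed
qed

section \<open>Dependence of flows on initial values\<close>

lemma onorm_scaleR_vec_le: "onorm (\<lambda>h. h *\<^sub>R v) \<le> norm (v::'a::real_normed_vector)"
  by (rule onorm_le) (simp add: mult.commute)

text \<open>On an interval with L (hi - lo) at most 1/2 the estimate closes on itself: at the
  maximum of the norm the mean value inequality gives max <= |x t0| + max/2 + (hi - lo) r, and half
  of the maximum is absorbed. The base point t0 may lie anywhere in the interval, so both time
  directions are covered.\<close>

lemma short_gronwall:
  fixes x :: "real \<Rightarrow> 'a::real_normed_vector"
  assumes d: "\<And>t. t \<in> {lo..hi} \<Longrightarrow> (x has_vector_derivative x' t) (at t within {lo..hi})"
    and b: "\<And>t. t \<in> {lo..hi} \<Longrightarrow> norm (x' t) \<le> L * norm (x t) + r"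
    and L: "0 \<le> L" "0 \<le> r" "L * (hi - lo) \<le> 1/2"
    and t: "t0 \<in> {lo..hi}" "t \<in> {lo..hi}"
  shows "norm (x t) \<le> 2 * (norm (x t0) + (hi - lo) * r)"
proof -
  have "continuous_on {lo..hi} x"
    by (meson continuous_on_vector_derivative d)
  then have "continuous_on {lo..hi} (\<lambda>t. norm (x t))"
    by (intro continuous_intros)
  then obtain s where s: "s \<in> {lo..hi}" "\<And>u. u \<in> {lo..hi} \<Longrightarrow> norm (x u) \<le> norm (x s)"
    using continuous_attains_sup[of "{lo..hi}" "\<lambda>t. norm (x t)"] t by (metis compact_Icc empty_iff)
  have "norm (x s - x t0) \<le> (L * norm (x s) + r) * norm (s - t0)"
  proof (rule differentiable_bound[of "{lo..hi}" x "\<lambda>t h. h *\<^sub>R x' t"])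
    show "onorm (\<lambda>h. h *\<^sub>R x' u) \<le> L * norm (x s) + r" if "u \<in> {lo..hi}" for u
      using onorm_scaleR_vec_le[of "x' u"] b[OF that] mult_left_mono[OF s(2)[OF that] L(1)] by linarith
  qed (use d s t in \<open>auto simp: has_vector_derivative_def\<close>)
  also have "\<dots> \<le> (L * norm (x s) + r) * (hi - lo)"
    using s t L by (intro mult_left_mono) auto
  also have "\<dots> = (L * (hi - lo)) * norm (x s) + (hi - lo) * r"
    by (simp add: algebra_simps)
  also have "\<dots> \<le> (1/2) * norm (x s) + (hi - lo) * r"
    using L by (intro add_right_mono mult_right_mono) auto
  finally have "norm (x s) \<le> norm (x t0) + (1/2) * norm (x s) + (hi - lo) * r"
    using norm_triangle_sub[of "x s" "x t0"] by linarith
  with s(2)[OF t(2)] show ?thesis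
    by simp
qed

text \<open>Picard iteration: the bound on the length of the interval makes the integral operator a
  contraction with factor 1/2. The unknown is operator-valued, so that one solution gives the
  variations in all directions of the parameter at once.\<close>

lemma linear_ode_exists:
  fixes A :: "real \<Rightarrow> ('z::euclidean_space \<Rightarrow>\<^sub>L 'z)" and Y0 :: "'p::euclidean_space \<Rightarrow>\<^sub>L 'z"
  assumes le: "lo \<le> hi" and A: "continuous_on {lo..hi} A"
    and L: "\<And>t. t \<in> {lo..hi} \<Longrightarrow> norm (A t) \<le> L" "L * (hi - lo) \<le> 1/2"
  obtains Y where "Y lo = Y0"
    "\<And>t. t \<in> {lo..hi} \<Longrightarrow> (Y has_vector_derivative A t o\<^sub>L Y t) (at t within {lo..hi})"
proof -
  have L0: "0 \<le> L"
    using order_trans[OF norm_ge_zero L(1)[of lo]] le by simp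
  define I where "I y t = Y0 + integral {lo..t} (\<lambda>s. A s o\<^sub>L apply_bcontfun y s)"
    for y :: "real \<Rightarrow>\<^sub>C ('p \<Rightarrow>\<^sub>L 'z)" and t
  \<comment> \<open>\<open>clamp\<close> extends a function on the interval by its end values, so
    that the iteration acts on the complete space of bounded continuous functions on the whole
    line.\<close>
  define T where "T y = Bcontfun (\<lambda>t. I y (clamp lo hi t))" for y
  have cont: "continuous_on {lo..t} (\<lambda>s. A s o\<^sub>L apply_bcontfun y s)" if "t \<in> {lo..hi}" for y t
    using that by (intro bounded_bilinear.continuous_on[OF bounded_bilinear_blinfun_compose]
        continuous_on_subset[OF A]) auto
  have der: "(I y has_vector_derivative A t o\<^sub>L apply_bcontfun y t) (at t within {lo..hi})"
    if "t \<in> {lo..hi}" for y t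
  proof -
    have "(I y has_vector_derivative 0 + (A t o\<^sub>L apply_bcontfun y t)) (at t within {lo..hi})"
      unfolding I_def using that le
      by (intro has_vector_derivative_add has_vector_derivative_const integral_has_vector_derivative[OF cont]) auto
    then show ?thesis by simp
  qed
  have contI: "continuous_on {lo..hi} (I y)" for y
    by (rule continuous_on_vector_derivative) (rule der)
  have "(\<lambda>t. I y (clamp lo hi t)) \<in> bcontfun" for y
  proof -
    have "continuous_on UNIV (\<lambda>t. I y (clamp lo hi t))"
      using contI by (intro clamp_continuous_on) auto
    moreover have "bounded (range (\<lambda>t. I y (clamp lo hi t)))"
      using contI compact_continuous_image[of "{lo..hi}" "I y"] compact_imp_bounded
      by (intro clamp_bounded) auto
    ultimately show ?thesis
      by (simp add: bcontfun_def)
  qed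
  then have T: "apply_bcontfun (T y) t = I y (clamp lo hi t)" for y t
    by (simp add: T_def Bcontfun_inverse)
  have cl: "clamp lo hi t \<in> {lo..hi}" for t
    using clamp_in_interval[of lo hi t] le by simp
  have "dist (T y) (T z) \<le> 1/2 * dist y z" for y z
  proof (rule dist_bound)
    fix t
    let ?t = "clamp lo hi t"
    have "dist (T y t) (T z t) = norm (integral {lo..?t} (\<lambda>s. (A s o\<^sub>L apply_bcontfun y s) - (A s o\<^sub>L apply_bcontfun z s)))"
      by (subst integral_diff) (auto simp: T I_def dist_norm intro!: cont[OF cl, THEN integrable_continuous_real])
    also have "\<dots> \<le> (L * dist y z) * (?t - lo)"
    proof (rule integral_bound)
      fix s assume s: "s \<in> {lo..?t}"
      have "norm ((A s o\<^sub>L apply_bcontfun y s) - (A s o\<^sub>L apply_bcontfun z s)) = norm (A s o\<^sub>L (apply_bcontfun y s - apply_bcontfun z s))"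
        by (simp add: bounded_bilinear.diff_right[OF bounded_bilinear_blinfun_compose])
      also have "\<dots> \<le> norm (A s) * norm (apply_bcontfun y s - apply_bcontfun z s)"
        by (rule norm_blinfun_compose)
      also have "\<dots> \<le> L * dist y z"
        using s cl[of t] L0 dist_bounded[of y s z] by (intro mult_mono L(1)) (auto simp: dist_norm)
      finally show "norm ((A s o\<^sub>L apply_bcontfun y s) - (A s o\<^sub>L apply_bcontfun z s)) \<le> L * dist y z" .
    qed (use cl[of t] in \<open>auto intro!: continuous_on_diff cont\<close>)
    also have "\<dots> \<le> (L * dist y z) * (hi - lo)"
      using cl[of t] L0 by (intro mult_left_mono) auto
    also have "\<dots> \<le> 1/2 * dist y z"
      using mult_right_mono[OF L(2), of "dist y z"] by (simp add: algebra_simps)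
    finally show "dist (T y t) (T z t) \<le> 1/2 * dist y z" .
  qed
  then obtain y where y: "T y = y"
    using banach_fix_type[of "1/2" T] by auto
  have eq: "apply_bcontfun y t = I y t" if "t \<in> {lo..hi}" for t
    using T[of y t] that by (simp add: y)
  show thesis
  proof
    show "I y lo = Y0"
      by (simp add: I_def)
    show "(I y has_vector_derivative A t o\<^sub>L I y t) (at t within {lo..hi})" if "t \<in> {lo..hi}" for t
      unfolding eq[OF that, symmetric] by (rule der[OF that])
  qed
qed

section \<open>C1 dependence of a short-time flow on a parameter\<close>

context
  fixes F :: "'z::euclidean_space \<Rightarrow> 'z" and z :: "'p::euclidean_space \<Rightarrow> real \<Rightarrow> 'z"
    and \<Omega> K L lo hi U
  assumes F: "C1_on \<Omega> F" and K: "K \<subseteq> \<Omega>" "compact K" "convex K"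
    and L: "\<And>x. x \<in> K \<Longrightarrow> norm (Blinfun (dd F x)) \<le> L" "0 \<le> L" "L * (hi - lo) \<le> 1/2"
    and le: "lo \<le> hi"
    and zK: "\<And>b t. b \<in> U \<Longrightarrow> t \<in> {lo..hi} \<Longrightarrow> z b t \<in> K"
    and zd: "\<And>b t. b \<in> U \<Longrightarrow> t \<in> {lo..hi} \<Longrightarrow> (z b has_vector_derivative F (z b t)) (at t within {lo..hi})"
    and init: "C1_on U (\<lambda>b. z b lo)"
begin

private abbreviation "DF x \<equiv> Blinfun (dd F x)"

private lemma DF: "x \<in> K \<Longrightarrow> blinfun_apply (DF x) = dd F x"
  using C1_on_Blinfun[OF F] K by auto

private lemma DF_unif: "0 < e \<Longrightarrow> \<exists>d>0. \<forall>x\<in>K. \<forall>y\<in>K. norm (y - x) < d \<longrightarrow> norm (DF y - DF x) \<le> e"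
proof -
  assume e: "0 < e"
  have "uniformly_continuous_on K DF"
    by (intro compact_uniformly_continuous continuous_on_subset[OF C1_on_dd_Blinfun[OF F]] K)
  with e show ?thesis
    unfolding uniformly_continuous_on_def dist_norm by (meson less_imp_le)
qed

private lemma F_lip: "x \<in> K \<Longrightarrow> y \<in> K \<Longrightarrow> norm (F x - F y) \<le> L * norm (x - y)"
proof (rule differentiable_bound[OF K(3)])
  show "(F has_derivative dd F u) (at u within K)" if "u \<in> K" for u
    using C1_on_deriv[OF F] that K by (auto intro: has_derivative_at_withinI)
  show "onorm (dd F u) \<le> L" if "u \<in> K" for u
    using L(1)[OF that] DF[OF that] by (simp add: norm_blinfun.rep_eq)
qed

text \<open>Uniform continuity of the derivative on the compact set K makes the first-order error
  small uniformly in the base point; convexity keeps the segment from x to y inside K.\<close>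

private lemma F_lin:
  assumes "0 < e"
  shows "\<exists>d>0. \<forall>x\<in>K. \<forall>y\<in>K. norm (y - x) < d \<longrightarrow> norm (F y - F x - DF x (y - x)) \<le> e * norm (y - x)"
proof -
  obtain d where d: "d > 0" "\<And>x y. x\<in>K \<Longrightarrow> y\<in>K \<Longrightarrow> norm (y - x) < d \<Longrightarrow> norm (DF y - DF x) \<le> e"
    using DF_unif[OF assms] by blast
  have "norm (F y - F x - DF x (y - x)) \<le> e * norm (y - x)"
    if xy: "x \<in> K" "y \<in> K" "norm (y - x) < d" for x y
  proof -
    have "norm (F y - F x - DF x (y - x)) \<le> norm (y - x) * e"
    proof (rule differentiable_bound_linearization[of x y "K \<inter> ball x d" F "\<lambda>u. blinfun_apply (DF u)" x])
      have "convex (K \<inter> ball x d)"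
        using K(3) by (intro convex_Int convex_ball)
      moreover have "x \<in> K \<inter> ball x d" "y \<in> K \<inter> ball x d"
        using xy d by (auto simp: dist_norm norm_minus_commute)
      ultimately have "closed_segment x y \<subseteq> K \<inter> ball x d"
        by (intro closed_segment_subset)
      then show "x + t *\<^sub>R (y - x) \<in> K \<inter> ball x d" if "t \<in> {0..1}" for t
      proof -
        have "x + t *\<^sub>R (y - x) = (1 - t) *\<^sub>R x + t *\<^sub>R y"
          by (simp add: algebra_simps)
        then have "x + t *\<^sub>R (y - x) \<in> closed_segment x y"
          using that by (auto simp: closed_segment_def)
        with \<open>closed_segment x y \<subseteq> K \<inter> ball x d\<close> show ?thesis ..
      qed
      show "(F has_derivative blinfun_apply (DF u)) (at u within K \<inter> ball x d)" if "u \<in> K \<inter> ball x d" for u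
        using that K DF[of u] C1_on_deriv[OF F, of u] has_derivative_at_withinI by fastforce
      show "onorm (blinfun_apply (DF u) - blinfun_apply (DF x)) \<le> e" if "u \<in> K \<inter> ball x d" for u
        using d(2)[of x u] that xy(1)
        by (simp add: norm_blinfun.rep_eq minus_blinfun.rep_eq dist_norm norm_minus_commute fun_diff_def)
    qed (use xy d in auto)
    then show ?thesis
      by (simp add: mult.commute)
  qed
  with d(1) show ?thesis
    by blast
qed

private lemma z_lip:
  assumes "b \<in> U" "c \<in> U" "t \<in> {lo..hi}"
  shows "norm (z c t - z b t) \<le> 2 * norm (z c lo - z b lo)"
proof -
  have "norm (z c t - z b t) \<le> 2 * (norm (z c lo - z b lo) + (hi - lo) * 0)"
    by (rule short_gronwall[where L = L and x' = "\<lambda>t. F (z c t) - F (z b t)"])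
       (use assms L le in \<open>auto intro!: F_lip zK zd has_vector_derivative_diff\<close>)
  then show ?thesis by simp
qed

private lemma variation_exists:
  assumes b: "b \<in> U"
  shows "\<exists>Y. Y lo = Blinfun (dd (\<lambda>b. z b lo) b) \<and>
    (\<forall>t\<in>{lo..hi}. (Y has_vector_derivative DF (z b t) o\<^sub>L Y t) (at t within {lo..hi}))"
proof -
  have "continuous_on {lo..hi} (z b)"
    by (meson b continuous_on_vector_derivative zd)
  then have "continuous_on {lo..hi} (\<lambda>t. DF (z b t))"
    by (rule continuous_on_compose2[OF C1_on_dd_Blinfun[OF F]]) (use zK[OF b] K in auto)
  then obtain Y where "Y lo = Blinfun (dd (\<lambda>b. z b lo) b)"
    "\<And>t. t \<in> {lo..hi} \<Longrightarrow> (Y has_vector_derivative DF (z b t) o\<^sub>L Y t) (at t within {lo..hi})"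
    using linear_ode_exists[OF le, of "\<lambda>t. DF (z b t)" L "Blinfun (dd (\<lambda>b. z b lo) b)"] L(1)[OF zK[OF b]] L(3)
    by blast
  then show ?thesis by blast
qed

text \<open>The solution of the equation linearised along z b, started at the derivative of the
  initial values: the candidate for the derivative of the flow with respect to b, confirmed in
  \<open>z_deriv\<close>.\<close>

private definition "Y b = (SOME Y. Y lo = Blinfun (dd (\<lambda>b. z b lo) b) \<and>
    (\<forall>t\<in>{lo..hi}. (Y has_vector_derivative DF (z b t) o\<^sub>L Y t) (at t within {lo..hi})))"

private lemma Y:
  assumes "b \<in> U"
  shows "blinfun_apply (Y b lo) = dd (\<lambda>b. z b lo) b"
    and "t \<in> {lo..hi} \<Longrightarrow> ((\<lambda>t. Y b t w) has_vector_derivative DF (z b t) (Y b t w)) (at t within {lo..hi})"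
proof -
  have "Y b lo = Blinfun (dd (\<lambda>b. z b lo) b) \<and>
    (\<forall>t\<in>{lo..hi}. (Y b has_vector_derivative DF (z b t) o\<^sub>L Y b t) (at t within {lo..hi}))"
    unfolding Y_def by (rule someI_ex[OF variation_exists[OF assms]])
  then have *: "Y b lo = Blinfun (dd (\<lambda>b. z b lo) b)"
    "t \<in> {lo..hi} \<Longrightarrow> (Y b has_vector_derivative DF (z b t) o\<^sub>L Y b t) (at t within {lo..hi})" for t
    by blast+
  show "blinfun_apply (Y b lo) = dd (\<lambda>b. z b lo) b"
    using *(1) C1_on_Blinfun[OF init assms] by simp
  show "t \<in> {lo..hi} \<Longrightarrow> ((\<lambda>t. Y b t w) has_vector_derivative DF (z b t) (Y b t w)) (at t within {lo..hi})"
    using bounded_linear.has_vector_derivative[OF blinfun.bounded_linear_left *(2)[of t], of w]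
    by simp
qed

text \<open>The error z c - z b - Y b (c - b) satisfies the linearised equation up to the
  first-order error of F along the two solutions. By \<open>z_lip\<close> and \<open>F_lin\<close>
  this forcing is small compared with |c - b|, and \<open>short_gronwall\<close> carries the bound
  through the interval.\<close>

private lemma z_deriv:
  assumes b: "b \<in> U" and t: "t \<in> {lo..hi}"
  shows "((\<lambda>c. z c t) has_derivative Y b t) (at b)"
  unfolding has_derivative_at_alt
proof (intro conjI allI impI)
  show "bounded_linear (blinfun_apply (Y b t))"
    by (rule blinfun.bounded_linear_right)
  fix e :: real assume e: "0 < e"
  have init': "\<exists>d>0. \<forall>c. norm (c - b) < d \<longrightarrow> norm (z c lo - z b lo - Y b lo (c - b)) \<le> e * norm (c - b)"
    if "e > 0" for e
    using C1_on_deriv[OF init b] that unfolding has_derivative_at_alt Y(1)[OF b] by blast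
  \<comment> \<open>C bounds the growth of the initial values, |z c lo - z b lo| <= C |c - b| near
    b; the summand 1 absorbs the first-order error.\<close>
  define C where "C = 1 + norm (Y b lo)"
  have C: "C > 0"
    by (simp add: C_def add_pos_nonneg)
  \<comment> \<open>With this constant the forcing contributes at most e/4 |c - b|, as do the
    initial values; the factor 2 of \<open>short_gronwall\<close> then makes e. The + 1 covers hi =
    lo.\<close>
  define e2 where "e2 = e / (8 * C * (hi - lo + 1))"
  have e2: "e2 > 0"
    using e C le by (simp add: e2_def)
  have e2': "(hi - lo) * (e2 * (2 * C)) \<le> e / 4"
    using e C le by (simp add: e2_def divide_simps)
  obtain d1 where d1: "d1 > 0" "\<And>c. norm (c - b) < d1 \<Longrightarrow> norm (z c lo - z b lo - Y b lo (c - b)) \<le> 1 * norm (c - b)"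
    using init'[of 1] by auto
  obtain d2 where d2: "d2 > 0" "\<And>c. norm (c - b) < d2 \<Longrightarrow> norm (z c lo - z b lo - Y b lo (c - b)) \<le> e / 4 * norm (c - b)"
    using init'[of "e / 4"] e by auto
  obtain d3 where d3: "d3 > 0" "\<And>x y. x \<in> K \<Longrightarrow> y \<in> K \<Longrightarrow> norm (y - x) < d3 \<Longrightarrow> norm (F y - F x - DF x (y - x)) \<le> e2 * norm (y - x)"
    using F_lin[OF e2] by blast
  obtain d4 where d4: "d4 > 0" "ball b d4 \<subseteq> U"
    using C1_on_open[OF init] b open_contains_ball by blast
  define d where "d = Min {d1, d2, d3 / (2 * C), d4}"
  have d: "d > 0" "d \<le> d1" "d \<le> d2" "d \<le> d3 / (2 * C)" "d \<le> d4"
    using d1 d2 d3 d4 C by (auto simp: d_def)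
  have "norm (z c t - z b t - Y b t (c - b)) \<le> e * norm (c - b)" if c: "norm (c - b) < d" for c
  proof -
    have cU: "c \<in> U"
      using c d d4 by (auto simp: dist_norm norm_minus_commute)
    have "norm (z c lo - z b lo) \<le> norm (c - b) + norm (Y b lo (c - b))"
      using d1(2)[of c] c d norm_triangle_sub[of "z c lo - z b lo" "Y b lo (c - b)"] by auto
    also have "\<dots> \<le> C * norm (c - b)"
      using norm_blinfun[of "Y b lo" "c - b"] by (simp add: C_def algebra_simps)
    finally have z2: "norm (z c s - z b s) \<le> 2 * C * norm (c - b)" if "s \<in> {lo..hi}" for s
      using z_lip[OF b cU that] by simp
    have "2 * C * norm (c - b) < d3"
    proof -
      have "norm (c - b) < d3 / (2 * C)"
        using c d by linarith
      then show ?thesis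
        using C by (simp add: pos_less_divide_eq mult.commute mult.left_commute)
    qed
    with z2 have z3: "norm (z c s - z b s) < d3" if "s \<in> {lo..hi}" for s
      using that by fastforce
    have "norm (z c t - z b t - Y b t (c - b))
        \<le> 2 * (norm (z c lo - z b lo - Y b lo (c - b)) + (hi - lo) * (e2 * (2 * C * norm (c - b))))"
    proof (rule short_gronwall[where L = L])
      show "((\<lambda>t. z c t - z b t - Y b t (c - b)) has_vector_derivative
          F (z c s) - F (z b s) - DF (z b s) (Y b s (c - b))) (at s within {lo..hi})" if "s \<in> {lo..hi}" for s
        using that by (intro has_vector_derivative_diff zd cU b Y(2))
      show "norm (F (z c s) - F (z b s) - DF (z b s) (Y b s (c - b)))
         \<le> L * norm (z c s - z b s - Y b s (c - b)) + e2 * (2 * C * norm (c - b))" if s: "s \<in> {lo..hi}" for s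
      proof -
        have "norm (F (z c s) - F (z b s) - DF (z b s) (Y b s (c - b)))
          = norm ((F (z c s) - F (z b s) - DF (z b s) (z c s - z b s)) + DF (z b s) (z c s - z b s - Y b s (c - b)))"
          by (simp add: blinfun.diff_right blinfun.add_right algebra_simps)
        also have "\<dots> \<le> e2 * norm (z c s - z b s) + L * norm (z c s - z b s - Y b s (c - b))"
        proof (rule order_trans[OF norm_triangle_ineq add_mono])
          show "norm (F (z c s) - F (z b s) - DF (z b s) (z c s - z b s)) \<le> e2 * norm (z c s - z b s)"
            using s by (intro d3(2) zK b cU z3)
          show "norm (DF (z b s) (z c s - z b s - Y b s (c - b))) \<le> L * norm (z c s - z b s - Y b s (c - b))"
            by (rule order_trans[OF norm_blinfun mult_right_mono[OF L(1)]]) (use s zK b in auto)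
        qed
        also have "e2 * norm (z c s - z b s) \<le> e2 * (2 * C * norm (c - b))"
          using z2[OF s] e2 by (intro mult_left_mono) auto
        finally show ?thesis by simp
      qed
    qed (use L e2 C le t in auto)
    also have "\<dots> \<le> 2 * (e / 4 * norm (c - b) + e / 4 * norm (c - b))"
      using d2(2)[of c] c d mult_right_mono[OF e2', of "norm (c - b)"] by (simp add: algebra_simps)
    finally show ?thesis by simp
  qed
  with d(1) show "\<exists>d>0. \<forall>c. norm (c - b) < d \<longrightarrow> norm (z c t - z b t - Y b t (c - b)) \<le> e * norm (c - b)"
    by blast
qed

text \<open>The difference of two variational solutions satisfies the linearised equation along z c
  with forcing (DF (z c s) - DF (z b s)) (Y b s w), which is small because z c is uniformly close to
  z b.\<close>

private lemma Y_cont: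
  assumes t: "t \<in> {lo..hi}"
  shows "continuous_on U (\<lambda>b. Y b t w)"
  unfolding continuous_on_iff
proof (intro ballI allI impI)
  fix b and e :: real assume b: "b \<in> U" and e: "0 < e"
  have Yb: "norm (Y b s w) \<le> 2 * norm (Y b lo w)" if "s \<in> {lo..hi}" for s
  proof -
    have "norm (DF (z b s) (Y b s w)) \<le> L * norm (Y b s w)" if "s \<in> {lo..hi}" for s
      by (rule order_trans[OF norm_blinfun mult_right_mono[OF L(1)]]) (use that zK b in auto)
    then show ?thesis
      using short_gronwall[of lo hi "\<lambda>t. Y b t w" "\<lambda>s. DF (z b s) (Y b s w)" L 0 lo s] that L le
      by (auto simp: Y(2)[OF b])
  qed
  define m where "m = 2 * norm (Y b lo w) + 1"
  have m: "m > 0"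
    by (simp add: m_def add_nonneg_pos)
  define e2 where "e2 = e / (8 * m * (hi - lo + 1))"
  have e2: "e2 > 0"
    using e m le by (simp add: e2_def)
  have e2': "(hi - lo) * (e2 * m) \<le> e / 8"
    using e m le by (simp add: e2_def divide_simps)
  obtain d1 where d1: "d1 > 0" "\<And>x y. x \<in> K \<Longrightarrow> y \<in> K \<Longrightarrow> norm (y - x) < d1 \<Longrightarrow> norm (DF y - DF x) \<le> e2"
    using DF_unif[OF e2] by blast
  obtain d2 where d2: "d2 > 0" "\<And>c. c \<in> U \<Longrightarrow> dist c b < d2 \<Longrightarrow> norm (z c lo - z b lo) < d1 / 2"
    using C1_on_cont[OF init] b d1 unfolding continuous_on_iff dist_norm by (meson half_gt_zero)
  obtain d3 where d3: "d3 > 0" "\<And>c. c \<in> U \<Longrightarrow> dist c b < d3 \<Longrightarrow> norm (Y c lo w - Y b lo w) < e / 8"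
  proof -
    have "continuous_on U (\<lambda>c. Y c lo w)"
      using C1_on_cont_dd[OF init, of w] by (simp add: Y(1) cong: continuous_on_cong)
    moreover have "e / 8 > 0"
      using e by simp
    ultimately show thesis
      using that b unfolding continuous_on_iff dist_norm by blast
  qed
  have "norm (Y c t w - Y b t w) < e" if c: "c \<in> U" "dist c b < min d2 d3" for c
  proof -
    have zz: "norm (z c s - z b s) < d1" if "s \<in> {lo..hi}" for s
      using z_lip[OF b c(1) that] d2(2)[of c] c by simp
    have "norm (Y c t w - Y b t w) \<le> 2 * (norm (Y c lo w - Y b lo w) + (hi - lo) * (e2 * m))"
    proof (rule short_gronwall[where L = L])
      show "((\<lambda>t. Y c t w - Y b t w) has_vector_derivative DF (z c s) (Y c s w) - DF (z b s) (Y b s w))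
         (at s within {lo..hi})" if "s \<in> {lo..hi}" for s
        using that by (intro has_vector_derivative_diff Y(2) c b)
      show "norm (DF (z c s) (Y c s w) - DF (z b s) (Y b s w)) \<le> L * norm (Y c s w - Y b s w) + e2 * m"
        if s: "s \<in> {lo..hi}" for s
      proof -
        have "norm (DF (z c s) (Y c s w) - DF (z b s) (Y b s w))
          = norm (DF (z c s) (Y c s w - Y b s w) + (DF (z c s) - DF (z b s)) (Y b s w))"
          by (simp add: blinfun.diff_right blinfun.diff_left)
        also have "\<dots> \<le> L * norm (Y c s w - Y b s w) + e2 * m"
        proof (rule order_trans[OF norm_triangle_ineq add_mono])
          show "norm (DF (z c s) (Y c s w - Y b s w)) \<le> L * norm (Y c s w - Y b s w)"
            by (rule order_trans[OF norm_blinfun mult_right_mono[OF L(1)]]) (use s zK c in auto)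
          show "norm ((DF (z c s) - DF (z b s)) (Y b s w)) \<le> e2 * m"
            by (rule order_trans[OF norm_blinfun], intro mult_mono d1(2) zK zz c b)
               (use s Yb[OF s] e2 m in \<open>auto simp: m_def\<close>)
        qed
        finally show ?thesis .
      qed
    qed (use L e2 m le t in auto)
    also have "\<dots> < e"
      using d3(2)[of c] c e2' e by simp
    finally show ?thesis .
  qed
  with d2(1) d3(1) show "\<exists>d>0. \<forall>c\<in>U. dist c b < d \<longrightarrow> dist (Y c t w) (Y b t w) < e"
    by (intro exI[of _ "min d2 d3"]) (auto simp: dist_norm)
qed

lemma local_flow_C1:
  assumes "t \<in> {lo..hi}"
  shows "C1_on U (\<lambda>b. z b t)"
  by (rule C1_onI[OF C1_on_open[OF init] z_deriv Y_cont]) (use assms in auto)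

text \<open>The derivative of the flow with respect to its parameter evolves by the linearised
  equation. This is the source of the Jacobi equation, stated with \<open>frechet_derivative\<close>
  in place of the auxiliary \<open>Y\<close>.\<close>

lemma local_flow_variation:
  assumes "b \<in> U" "t \<in> {lo..hi}"
  shows "((\<lambda>t. dd (\<lambda>b. z b t) b w) has_vector_derivative dd F (z b t) (dd (\<lambda>b. z b t) b w)) (at t within {lo..hi})"
proof (rule has_vector_derivative_transform[OF assms(2)])
  have eq: "dd (\<lambda>b. z b s) b w = Y b s w" if "s \<in> {lo..hi}" for s
    using dd_eq[OF z_deriv[OF assms(1) that]] by simp
  show "dd (\<lambda>b. z b s) b w = Y b s w" if "s \<in> {lo..hi}" for s
    by (rule eq[OF that])
  show "((\<lambda>t. Y b t w) has_vector_derivative dd F (z b t) (dd (\<lambda>b. z b t) b w)) (at t within {lo..hi})"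
    using Y(2)[OF assms] DF[OF zK[OF assms]] eq[OF assms(2)] by simp
qed

end

section \<open>Solutions of parametrised linear equations\<close>

text \<open>The injective G a is bounded below by some m > 0, and G x for x near a still by m/2.
  Subtracting the two equations then bounds |z x - z a| by the change of the data.\<close>

lemma continuous_on_solve:
  fixes G :: "'a::euclidean_space \<Rightarrow> 'e::euclidean_space \<Rightarrow> 'e"
  assumes G: "\<And>e. continuous_on S (\<lambda>x. G x e)" "\<And>x. x \<in> S \<Longrightarrow> linear (G x)" "\<And>x. x \<in> S \<Longrightarrow> inj (G x)"
    and r: "continuous_on S r" and z: "\<And>x. x \<in> S \<Longrightarrow> G x (z x) = r x"
  shows "continuous_on S z"
proof -
  let ?G = "\<lambda>x. Blinfun (G x)"
  have bl: "bounded_linear (G x)" if "x \<in> S" for x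
    using G(2)[OF that] by (simp add: linear_conv_bounded_linear)
  have G': "blinfun_apply (?G x) = G x" if "x \<in> S" for x
    using bl[OF that] by (rule bounded_linear_Blinfun_apply)
  have cG: "continuous_on S ?G"
    by (rule continuous_on_Blinfun[OF bl G(1)])
  have "continuous (at a within S) z" if a: "a \<in> S" for a
  proof -
    obtain m where m: "m > 0" "\<And>v. m * norm v \<le> norm (G a v)"
      using linear_inj_bounded_below_pos[OF G(2)[OF a] G(3)[OF a]] by blast
    define q where "q x = norm (?G x - ?G a)" for x
    have q0: "(q \<longlongrightarrow> 0) (at a within S)"
    proof -
      have "(?G \<longlongrightarrow> ?G a) (at a within S)"
        using cG a by (simp add: continuous_on_def)
      then show ?thesis
        unfolding q_def by (intro tendsto_norm_zero LIM_zero)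
    qed
    have ev: "\<forall>\<^sub>F x in at a within S. norm (z x - z a) \<le> 2 / m * (norm (r x - r a) + q x * norm (z a))"
    proof -
      have "\<forall>\<^sub>F x in at a within S. q x < m / 2"
        using order_tendstoD(2)[OF q0, of "m / 2"] m by simp
      moreover have "\<forall>\<^sub>F x in at a within S. x \<in> S"
        by (simp add: eventually_at_filter)
      ultimately show ?thesis
      proof eventually_elim
        case (elim x)
        have "m * norm (z x - z a) \<le> norm (G a (z x - z a))"
          by (rule m(2))
        also have "G a (z x - z a) = (r x - r a) - (?G x - ?G a) (z x)"
          using z[OF a] z[OF elim(2)] G'[OF a] G'[OF elim(2)] G(2)[OF a]
          by (simp add: linear_diff blinfun.diff_left)
        also have "norm \<dots> \<le> norm (r x - r a) + q x * norm (z x)"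
          by (rule order_trans[OF norm_triangle_ineq4])
             (auto simp: q_def intro!: norm_blinfun)
        also have "\<dots> \<le> norm (r x - r a) + (q x * norm (z a) + m / 2 * norm (z x - z a))"
        proof -
          have "q x * norm (z x) \<le> q x * (norm (z a) + norm (z x - z a))"
            using norm_triangle_sub[of "z x" "z a"] by (intro mult_left_mono) (auto simp: q_def)
          also have "\<dots> \<le> q x * norm (z a) + m / 2 * norm (z x - z a)"
            using mult_right_mono[of "q x" "m / 2" "norm (z x - z a)"] elim(1) by (simp add: distrib_left)
          finally show ?thesis by simp
        qed
        finally have "m / 2 * norm (z x - z a) \<le> norm (r x - r a) + q x * norm (z a)"
          by linarith
        then show ?case
          using m(1) by (simp add: field_simps)
      qed
    qed
    have "((\<lambda>x. r x - r a) \<longlongrightarrow> 0) (at a within S)"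
      by (rule LIM_zero) (use r a in \<open>simp add: continuous_on_def\<close>)
    then have "((\<lambda>x. 2 / m * (norm (r x - r a) + q x * norm (z a))) \<longlongrightarrow> 2 / m * (0 + 0 * norm (z a))) (at a within S)"
      by (intro tendsto_intros q0 tendsto_norm_zero)
    then have "((\<lambda>x. z x - z a) \<longlongrightarrow> 0) (at a within S)"
      by (intro Lim_null_comparison[OF ev]) simp
    then show ?thesis
      unfolding continuous_within by (rule LIM_zero_cancel)
  qed
  then show ?thesis
    by (simp add: continuous_on_eq_continuous_within)
qed

text \<open>Where f vanishes, the increment of g enters only multiplied by a term of first order, so
  continuity of g suffices.\<close>

lemma has_derivative_scaleR_vanishing:
  fixes f :: "'a::real_normed_vector \<Rightarrow> 'b::real_normed_vector" and g :: "'a \<Rightarrow> real"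
  assumes f: "(f has_derivative f') (at a)" "f a = 0" and g: "isCont g a"
  shows "((\<lambda>x. g x *\<^sub>R f x) has_derivative (\<lambda>h. g a *\<^sub>R f' h)) (at a)"
proof -
  have lim: "((\<lambda>x. (1 / norm (x - a)) *\<^sub>R (f x - (f a + f' (x - a)))) \<longlongrightarrow> 0) (at a)"
    and bl: "bounded_linear f'"
    using f(1) unfolding has_derivative_within by blast+
  obtain C where C: "\<And>h. norm (f' h) \<le> norm h * C"
    using bounded_linear.bounded[OF bl] by blast
  have g0: "((\<lambda>x. g x - g a) \<longlongrightarrow> 0) (at a)"
    by (rule LIM_zero[OF g[unfolded isCont_def]])
  have "((\<lambda>x. (g x - g a) *\<^sub>R ((1 / norm (x - a)) *\<^sub>R f' (x - a))) \<longlongrightarrow> 0) (at a)"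
  proof (rule Lim_null_comparison)
    show "\<forall>\<^sub>F x in at a. norm ((g x - g a) *\<^sub>R ((1 / norm (x - a)) *\<^sub>R f' (x - a))) \<le> \<bar>g x - g a\<bar> * C"
      unfolding eventually_at_filter
    proof (intro always_eventually allI impI)
      fix x assume "x \<noteq> a"
      then have "norm (f' (x - a)) / norm (x - a) \<le> C"
        using C[of "x - a"] by (simp add: pos_divide_le_eq mult.commute)
      then have "\<bar>g x - g a\<bar> * (norm (f' (x - a)) / norm (x - a)) \<le> \<bar>g x - g a\<bar> * C"
        by (intro mult_left_mono) auto
      then show "norm ((g x - g a) *\<^sub>R ((1 / norm (x - a)) *\<^sub>R f' (x - a))) \<le> \<bar>g x - g a\<bar> * C"
        by simp
    qed
    show "((\<lambda>x. \<bar>g x - g a\<bar> * C) \<longlongrightarrow> 0) (at a)"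
      using tendsto_mult_left_zero[OF tendsto_rabs_zero[OF g0]] .
  qed
  moreover have "((\<lambda>x. g x *\<^sub>R ((1 / norm (x - a)) *\<^sub>R (f x - (f a + f' (x - a))))) \<longlongrightarrow> g a *\<^sub>R 0) (at a)"
    by (intro tendsto_intros lim g[unfolded isCont_def])
  ultimately have "((\<lambda>x. g x *\<^sub>R ((1 / norm (x - a)) *\<^sub>R (f x - (f a + f' (x - a))))
      + (g x - g a) *\<^sub>R ((1 / norm (x - a)) *\<^sub>R f' (x - a))) \<longlongrightarrow> g a *\<^sub>R 0 + 0) (at a)"
    by (intro tendsto_add)
  moreover have "g x *\<^sub>R ((1 / norm (x - a)) *\<^sub>R (f x - (f a + f' (x - a)))) + (g x - g a) *\<^sub>R ((1 / norm (x - a)) *\<^sub>R f' (x - a))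
      = (1 / norm (x - a)) *\<^sub>R (g x *\<^sub>R f x - (g a *\<^sub>R f a + g a *\<^sub>R f' (x - a)))" for x
    using f(2) by (simp add: algebra_simps diff_divide_distrib)
  ultimately have "((\<lambda>x. (1 / norm (x - a)) *\<^sub>R (g x *\<^sub>R f x - (g a *\<^sub>R f a + g a *\<^sub>R f' (x - a)))) \<longlongrightarrow> 0) (at a)"
    by simp
  moreover have "bounded_linear (\<lambda>h. g a *\<^sub>R f' h)"
    using bl by (rule bounded_linear_scaleR_right[THEN bounded_linear_compose])
  ultimately show ?thesis
    unfolding has_derivative_within by blast
qed

text \<open>Near a the solution satisfies z x = inv (G a) (r x - (G x - G a) (z x)). The last term
  is a sum of continuous coefficients times functions vanishing at a, hence differentiable at a
  although z is only known to be continuous. The derivative solves a system with the same matrix and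
  is therefore continuous.\<close>

lemma C1_on_solve:
  fixes G :: "'a::euclidean_space \<Rightarrow> 'e::euclidean_space \<Rightarrow> 'e"
  assumes G: "\<And>e. C1_on S (\<lambda>x. G x e)" "\<And>x. x \<in> S \<Longrightarrow> linear (G x)" "\<And>x. x \<in> S \<Longrightarrow> inj (G x)"
    and r: "C1_on S r" and z: "\<And>x. x \<in> S \<Longrightarrow> G x (z x) = r x"
  shows "C1_on S z"
proof -
  have cz: "continuous_on S z"
    by (rule continuous_on_solve[OF C1_on_cont[OF G(1)] G(2,3) C1_on_cont[OF r] z])
  have S: "open S"
    using r by (rule C1_on_open)
  define D where "D a u = dd r a u - (\<Sum>i\<in>Basis. (z a \<bullet> i) *\<^sub>R dd (\<lambda>x. G x i) a u)" for a u
  define z' where "z' a u = inv (G a) (D a u)" for a u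
  have surj: "surj (G a)" if "a \<in> S" for a
    using G(2,3)[OF that] by (simp add: linear_injective_imp_surjective)
  have z': "G a (z' a u) = D a u" if "a \<in> S" for a u
    unfolding z'_def using surj[OF that] by (rule surj_f_inv_f)
  show ?thesis
  proof (rule C1_onI[OF S])
    fix a assume a: "a \<in> S"
    have inv: "bounded_linear (inv (G a))"
      using G(2,3)[OF a] by (metis inj_linear_imp_inv_linear surj linear_conv_bounded_linear a)
    have "((\<lambda>x. \<Sum>i\<in>Basis. (z x \<bullet> i) *\<^sub>R (G x i - G a i)) has_derivative
       (\<lambda>h. \<Sum>i\<in>Basis. (z a \<bullet> i) *\<^sub>R dd (\<lambda>x. G x i) a h)) (at a)"
    proof (rule has_derivative_sum, rule has_derivative_scaleR_vanishing)
      show "((\<lambda>x. G x i - G a i) has_derivative dd (\<lambda>x. G x i) a) (at a)" for i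
        using has_derivative_diff[OF C1_on_deriv[OF G(1) a] has_derivative_const] by simp
      show "isCont (\<lambda>x. z x \<bullet> i) a" for i
        using cz S a by (intro continuous_intros) (simp add: continuous_on_eq_continuous_at)
    qed auto
    then have "((\<lambda>x. r x - (\<Sum>i\<in>Basis. (z x \<bullet> i) *\<^sub>R (G x i - G a i))) has_derivative D a) (at a)"
      unfolding D_def by (intro has_derivative_diff C1_on_deriv[OF r a])
    then have "((\<lambda>x. inv (G a) (r x - (\<Sum>i\<in>Basis. (z x \<bullet> i) *\<^sub>R (G x i - G a i)))) has_derivative z' a) (at a)"
      unfolding z'_def by (rule bounded_linear.has_derivative[OF inv])
    then show "(z has_derivative z' a) (at a)"
    proof (rule has_derivative_transform_within_open[OF _ S a])
      fix x assume x: "x \<in> S"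
      have *: "G y v = (\<Sum>i\<in>Basis. (v \<bullet> i) *\<^sub>R G y i)" if "y \<in> S" for y v
      proof -
        have "G y v = G y (\<Sum>i\<in>Basis. (v \<bullet> i) *\<^sub>R i)"
          by (simp add: euclidean_representation)
        also have "\<dots> = (\<Sum>i\<in>Basis. (v \<bullet> i) *\<^sub>R G y i)"
          using G(2)[OF that] by (simp add: linear_sum linear_scale)
        finally show ?thesis .
      qed
      have "r x - (\<Sum>i\<in>Basis. (z x \<bullet> i) *\<^sub>R (G x i - G a i)) = r x - (G x (z x) - G a (z x))"
        by (simp only: *[OF x, of "z x"] *[OF a, of "z x"] scaleR_diff_right sum_subtractf)
      also have "\<dots> = G a (z x)"
        using z[OF x] by simp
      finally show "inv (G a) (r x - (\<Sum>i\<in>Basis. (z x \<bullet> i) *\<^sub>R (G x i - G a i))) = z x"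
        using G(3)[OF a] by simp
    qed
  next
    fix u
    show "continuous_on S (\<lambda>a. z' a u)"
    proof (rule continuous_on_solve[OF C1_on_cont[OF G(1)] G(2,3) _ z'])
      show "continuous_on S (\<lambda>a. D a u)"
        unfolding D_def by (intro continuous_intros C1_on_cont_dd[OF r] C1_on_cont_dd[OF G(1)] cz)
    qed
  qed
qed

section \<open>Functions whose square root is convex\<close>

text \<open>The square root itself need not be differentiable; it is the limit of the convex
  functions \<^term>\<open>\<lambda>t. sqrt (n t + \<delta>)\<close>.\<close>

lemma sqrt_convex:
  fixes n :: "real \<Rightarrow> real"
  assumes n: "\<And>t. t > 0 \<Longrightarrow> n t \<ge> 0" "\<And>t. t > 0 \<Longrightarrow> (n has_real_derivative n1 t) (at t)"
    "\<And>t. t > 0 \<Longrightarrow> (n1 has_real_derivative n2 t) (at t)"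
    "\<And>t. t > 0 \<Longrightarrow> n2 t \<ge> 0" "\<And>t. t > 0 \<Longrightarrow> (n1 t)\<^sup>2 \<le> 2 * n t * n2 t"
  shows "convex_on {0<..} (\<lambda>t. sqrt (n t))"
proof -
  have cv: "convex_on {0<..} (\<lambda>t. sqrt (n t + \<delta>))" if \<delta>: "\<delta> > 0" for \<delta>
  proof (rule f''_ge0_imp_convex)
    fix t :: real assume "t \<in> {0<..}"
    then have t: "t > 0" by simp
    have p: "n t + \<delta> > 0"
      using n(1)[OF t] \<delta> by linarith
    let ?s = "\<lambda>t. sqrt (n t + \<delta>)"
    have s: "?s t > 0"
      using p by simp
    show d1: "(?s has_real_derivative n1 t / (2 * ?s t)) (at t)"
      using p n(2)[OF t] by (auto intro!: derivative_eq_intros simp: divide_simps)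
    show "((\<lambda>t. n1 t / (2 * ?s t)) has_real_derivative
        (n2 t * (2 * ?s t) - n1 t * (2 * (n1 t / (2 * ?s t)))) / ((2 * ?s t) * (2 * ?s t))) (at t)"
      using s by (intro DERIV_divide n(3)[OF t] DERIV_cmult d1) auto
    \<comment> \<open>This decides the sign of the second derivative of
      \<open>sqrt (n t + \<delta>)\<close>; adding \<delta> only enlarges the right-hand side
      because n2 is nonnegative.\<close>
    have "(n1 t)\<^sup>2 \<le> n2 t * 2 * (n t + \<delta>)"
      using n(5)[OF t] mult_nonneg_nonneg[OF n(4)[OF t], of "2 * \<delta>"] \<delta> by (simp add: algebra_simps)
    define \<sigma> where "\<sigma> = ?s t"
    have \<sigma>: "n t + \<delta> = \<sigma> * \<sigma>" "\<sigma> > 0"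
      using p by (auto simp: \<sigma>_def)
    have "n1 t * n1 t \<le> n2 t * (2 * \<sigma>) * \<sigma>"
      using \<open>(n1 t)\<^sup>2 \<le> n2 t * 2 * (n t + \<delta>)\<close> unfolding \<sigma>(1) by (simp add: power2_eq_square mult_ac)
    then have "n1 t * n1 t / \<sigma> \<le> n2 t * (2 * \<sigma>)"
      using \<sigma>(2) by (simp only: pos_divide_le_eq)
    then have "0 \<le> n2 t * (2 * \<sigma>) - n1 t * (2 * (n1 t / (2 * \<sigma>)))"
      by simp
    then show "0 \<le> (n2 t * (2 * ?s t) - n1 t * (2 * (n1 t / (2 * ?s t)))) / ((2 * ?s t) * (2 * ?s t))"
      unfolding \<sigma>_def[symmetric] using \<sigma>(2) by (intro divide_nonneg_nonneg) auto
  qed simp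
  show ?thesis
  proof (rule convex_onI)
    fix u x y :: real assume u: "0 < u" "u < 1" and xy: "x \<in> {0<..}" "y \<in> {0<..}"
    have lim: "((\<lambda>\<delta>. sqrt (n t + \<delta>)) \<longlongrightarrow> sqrt (n t + 0)) (at_right 0)" for t
      by (intro tendsto_intros)
    have "sqrt (n ((1 - u) *\<^sub>R x + u *\<^sub>R y) + 0) \<le> (1 - u) * sqrt (n x + 0) + u * sqrt (n y + 0)"
    proof (rule tendsto_le[OF _ _ lim])
      show "((\<lambda>\<delta>. (1 - u) * sqrt (n x + \<delta>) + u * sqrt (n y + \<delta>)) \<longlongrightarrow> (1 - u) * sqrt (n x + 0) + u * sqrt (n y + 0)) (at_right 0)"
        by (intro tendsto_intros)
      show "\<forall>\<^sub>F \<delta> in at_right 0. sqrt (n ((1 - u) *\<^sub>R x + u *\<^sub>R y) + \<delta>) \<le> (1 - u) * sqrt (n x + \<delta>) + u * sqrt (n y + \<delta>)"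
        using eventually_at_right_less[of 0]
      proof eventually_elim
        case (elim \<delta>)
        show ?case
          using u xy by (intro convex_onD[OF cv[OF elim]]) auto
      qed
    qed simp
    then show "sqrt (n ((1 - u) *\<^sub>R x + u *\<^sub>R y)) \<le> (1 - u) * sqrt (n x) + u * sqrt (n y)"
      by simp
  qed simp
qed

text \<open>A convex function that tends to 0 at 0 lies below its chords from the origin, so
  \<open>sqrt (n t) / t\<close> is nondecreasing, with limit \<open>sqrt N\<close> at 0. Convexity
  is given for t > 0, so the chords start at some e > 0 and e tends to 0.\<close>

lemma sqrt_convex_growth:
  fixes n :: "real \<Rightarrow> real"
  assumes cv: "convex_on {0<..} (\<lambda>t. sqrt (n t))"
    and lim: "((\<lambda>t. n t / t\<^sup>2) \<longlongrightarrow> N) (at_right 0)"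
  shows "0 < s \<Longrightarrow> s \<le> t \<Longrightarrow> sqrt (n s) \<le> s / t * sqrt (n t)"
    and "0 < t \<Longrightarrow> sqrt N \<le> sqrt (n t) / t"
proof -
  have l: "((\<lambda>t. sqrt (n t) / t) \<longlongrightarrow> sqrt N) (at_right 0)"
  proof (rule Lim_transform_eventually[OF tendsto_real_sqrt[OF lim]])
    show "\<forall>\<^sub>F t in at_right 0. sqrt (n t / t\<^sup>2) = sqrt (n t) / t"
      using eventually_at_right_less[of 0] by eventually_elim (simp add: real_sqrt_divide)
  qed
  have l0: "((\<lambda>t. sqrt (n t)) \<longlongrightarrow> 0) (at_right 0)"
  proof -
    have "((\<lambda>t. t * (sqrt (n t) / t)) \<longlongrightarrow> 0 * sqrt N) (at_right 0)"
      by (intro tendsto_mult l tendsto_ident_at)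
    moreover have "\<forall>\<^sub>F t in at_right 0. t * (sqrt (n t) / t) = sqrt (n t)"
      using eventually_at_right_less[of 0] by eventually_elim simp
    ultimately show ?thesis
      using Lim_transform_eventually[of "\<lambda>t. t * (sqrt (n t) / t)" 0] by simp
  qed
  have *: "sqrt (n s) \<le> s / t * sqrt (n t)" if st: "0 < s" "s \<le> t" for s t
  proof (cases "s = t")
    case False
    with st have st: "0 < s" "s < t" "0 < t" by auto
    have "sqrt (n s) \<le> (t - s) / (t - 0) * 0 + (s - 0) / (t - 0) * sqrt (n t)"
    proof (rule tendsto_le)
      show "((\<lambda>e. sqrt (n s)) \<longlongrightarrow> sqrt (n s)) (at_right 0)"
        by simp
      show "((\<lambda>e. (t - s) / (t - e) * sqrt (n e) + (s - e) / (t - e) * sqrt (n t)) \<longlongrightarrow>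
          (t - s) / (t - 0) * 0 + (s - 0) / (t - 0) * sqrt (n t)) (at_right 0)"
        using st by (intro tendsto_intros l0) auto
      have "\<forall>\<^sub>F e in at_right 0. e < s"
        using st by (intro order_tendstoD(2)[OF tendsto_ident_at]) auto
      with eventually_at_right_less[of 0]
      show "\<forall>\<^sub>F e in at_right 0. sqrt (n s) \<le> (t - s) / (t - e) * sqrt (n e) + (s - e) / (t - e) * sqrt (n t)"
      proof eventually_elim
        case (elim e)
        define u where "u = (s - e) / (t - e)"
        have te: "0 < t - e"
          using st elim by linarith
        have u: "0 \<le> u" "u \<le> 1" "1 - u = (t - s) / (t - e)"
          using st elim te by (simp_all add: u_def diff_divide_eq_iff)
        have "(1 - u) * e + u * t = ((t - s) * e + (s - e) * t) / (t - e)"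
          unfolding u(3) unfolding u_def by (simp add: add_divide_distrib)
        also have "\<dots> = s"
          using te by (simp add: divide_eq_eq algebra_simps)
        finally have "(1 - u) *\<^sub>R e + u *\<^sub>R t = s"
          by simp
        moreover have "sqrt (n ((1 - u) *\<^sub>R e + u *\<^sub>R t)) \<le> (1 - u) * sqrt (n e) + u * sqrt (n t)"
          using u(1,2) elim st by (intro convex_onD[OF cv]) auto
        ultimately show ?case
          by (simp add: u(3)) (simp add: u_def)
      qed
    qed simp
    then show ?thesis by simp
  qed (use st in simp)
  show "0 < s \<Longrightarrow> s \<le> t \<Longrightarrow> sqrt (n s) \<le> s / t * sqrt (n t)"
    by (rule *)
  show "sqrt N \<le> sqrt (n t) / t" if t: "0 < t"
  proof (rule tendsto_upperbound[OF l])
    have "\<forall>\<^sub>F s in at_right 0. s < t"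
      using t by (intro order_tendstoD(2)[OF tendsto_ident_at]) auto
    with eventually_at_right_less[of 0] show "\<forall>\<^sub>F s in at_right 0. sqrt (n s) / s \<le> sqrt (n t) / t"
    proof eventually_elim
      case (elim s)
      then show ?case
        using *[of s t] by (simp add: divide_simps mult.commute split: if_splits)
    qed
  qed simp
qed

section \<open>Charts\<close>

text \<open>Applied to the metric, the second conclusion makes the Christoffel symbols C1; applied
  to transition maps, it makes the change of velocity components C1.\<close>

lemma smooth_on_C1:
  assumes "smooth_on S f" "open S"
  shows "C1_on S f" "C1_on S (\<lambda>a. dd f a u)"
proof -
  have "Ck_on (Suc (Suc 0)) S f"
    using assms(1) by (simp only: smooth_on_def)
  then show "C1_on S f" "C1_on S (\<lambda>a. dd f a u)"
    using assms(2) by (auto simp: C1_on_def)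
       (metis differentiable_imp_continuous_within continuous_at_imp_continuous_on)
qed

locale riemannian_mfd =
  fixes M :: "('m::{t2_space,second_countable_topology}, 'e::euclidean_space) riemannian"
  assumes riem: "riemannian_manifold M"
begin

lemma smooth_atlas: "smooth_atlas (atlas M)"
  using riem by (simp add: riemannian_manifold_def)

lemma chart_homeo:
  assumes "c \<in> atlas M"
  shows "homeomorphism (fst c) (chart_image c) (snd c) (chart_inv c)"
    "open (fst c)" "open (chart_image c)"
  using smooth_atlas assms by (auto simp: smooth_atlas_def)

lemma chart_inv_snd [simp]: "c \<in> atlas M \<Longrightarrow> x \<in> fst c \<Longrightarrow> chart_inv c (snd c x) = x"
  using chart_homeo(1) by (metis homeomorphism_apply1)

lemma snd_chart_inv [simp]: "c \<in> atlas M \<Longrightarrow> a \<in> chart_image c \<Longrightarrow> snd c (chart_inv c a) = a"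
  using chart_homeo(1) by (metis homeomorphism_apply2)

lemma snd_in [simp]: "x \<in> fst c \<Longrightarrow> snd c x \<in> chart_image c"
  by (simp add: chart_image_def)

lemma chart_inv_in [simp]: "c \<in> atlas M \<Longrightarrow> a \<in> chart_image c \<Longrightarrow> chart_inv c a \<in> fst c"
  by (auto simp: chart_image_def)

lemma chart_cont: "c \<in> atlas M \<Longrightarrow> continuous_on (fst c) (snd c)"
  using chart_homeo(1) homeomorphism_cont1 by blast

lemma chart_inv_cont: "c \<in> atlas M \<Longrightarrow> continuous_on (chart_image c) (chart_inv c)"
  using chart_homeo(1) homeomorphism_cont2 by blast

lemma chart_at: "chart_at M x \<in> atlas M" "x \<in> fst (chart_at M x)"
proof -
  have "x \<in> (\<Union>c\<in>atlas M. fst c)"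
    using smooth_atlas by (simp add: smooth_atlas_def)
  then have "\<exists>c. c \<in> atlas M \<and> x \<in> fst c"
    by blast
  then have "chart_at M x \<in> atlas M \<and> x \<in> fst (chart_at M x)"
    unfolding chart_at_def by (rule someI_ex)
  then show "chart_at M x \<in> atlas M" "x \<in> fst (chart_at M x)"
    by auto
qed

section \<open>Transition maps and their differentials\<close>

definition tr :: "('m, 'e) chart \<Rightarrow> ('m, 'e) chart \<Rightarrow> 'e \<Rightarrow> 'e" where
  "tr c d = snd d \<circ> chart_inv c"

definition tr_dom :: "('m, 'e) chart \<Rightarrow> ('m, 'e) chart \<Rightarrow> 'e set" where
  "tr_dom c d = snd c ` (fst c \<inter> fst d)"

lemma in_tr_dom: "x \<in> fst c \<Longrightarrow> x \<in> fst d \<Longrightarrow> snd c x \<in> tr_dom c d"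
  by (auto simp: tr_dom_def)

lemma tr_dom_iff: "c \<in> atlas M \<Longrightarrow> a \<in> tr_dom c d \<longleftrightarrow> a \<in> chart_image c \<and> chart_inv c a \<in> fst d"
  by (auto simp: tr_dom_def chart_image_def)

lemma open_tr_dom: "c \<in> atlas M \<Longrightarrow> d \<in> atlas M \<Longrightarrow> open (tr_dom c d)"
proof -
  assume c: "c \<in> atlas M" "d \<in> atlas M"
  have "tr_dom c d = chart_image c \<inter> chart_inv c -` fst d"
    by (rule set_eqI) (simp add: tr_dom_iff[OF c(1)])
  then show ?thesis
    using continuous_open_preimage[OF chart_inv_cont[OF c(1)] chart_homeo(3)[OF c(1)] chart_homeo(2)[OF c(2)]]
    by simp
qed

lemma tr_snd [simp]: "c \<in> atlas M \<Longrightarrow> x \<in> fst c \<Longrightarrow> tr c d (snd c x) = snd d x"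
  by (simp add: tr_def)

lemma tr_C1:
  assumes "c \<in> atlas M" "d \<in> atlas M"
  shows "C1_on (tr_dom c d) (tr c d)" "C1_on (tr_dom c d) (\<lambda>a. dd (tr c d) a u)"
  using smooth_on_C1[of "tr_dom c d" "tr c d"] smooth_atlas assms open_tr_dom[OF assms]
  by (auto simp: smooth_atlas_def tr_def tr_dom_def)

lemma linear_dd_tr:
  "c \<in> atlas M \<Longrightarrow> d \<in> atlas M \<Longrightarrow> x \<in> fst c \<Longrightarrow> x \<in> fst d \<Longrightarrow> linear (dd (tr c d) (snd c x))"
  using C1_on_bl[OF tr_C1(1) in_tr_dom] by (simp add: linear_conv_bounded_linear)

text \<open>The chain rule for components of tangent vectors, the cocycle identity behind every
  statement of independence of the chart.\<close>

lemma dd_tr_comp: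
  assumes c: "c \<in> atlas M" "d \<in> atlas M" "e \<in> atlas M" and x: "x \<in> fst c" "x \<in> fst d" "x \<in> fst e"
  shows "dd (tr c e) (snd c x) u = dd (tr d e) (snd d x) (dd (tr c d) (snd c x) u)"
proof -
  let ?S = "tr_dom c d \<inter> tr_dom c e"
  have S: "open ?S" "snd c x \<in> ?S"
    using c x by (auto intro: open_tr_dom in_tr_dom)
  have "dd (tr c e) (snd c x) = dd (\<lambda>a. tr d e (tr c d a)) (snd c x)"
    by (rule dd_cong[OF S]) (use c in \<open>simp add: tr_dom_iff tr_def\<close>)
  then have "dd (tr c e) (snd c x) u = dd (\<lambda>a. tr d e (tr c d a)) (snd c x) u"
    by simp
  also have "\<dots> = dd (tr d e) (tr c d (snd c x)) (dd (tr c d) (snd c x) u)"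
  proof (rule C1_on_compose(2)[of "tr_dom d e" _ ?S])
    show "C1_on ?S (tr c d)"
      by (rule C1_on_subset[OF tr_C1(1)]) (use c S in auto)
    show "tr c d ` ?S \<subseteq> tr_dom d e"
      using c by (auto simp: tr_dom_iff[of c] tr_def intro!: in_tr_dom)
  qed (use c S tr_C1 in auto)
  finally show ?thesis
    using c x by simp
qed

lemma dd_tr_id:
  assumes c: "c \<in> atlas M" and x: "x \<in> fst c"
  shows "dd (tr c c) (snd c x) u = u"
proof -
  have "dd (tr c c) (snd c x) = dd (\<lambda>a. a) (snd c x)"
    by (rule dd_cong[OF open_tr_dom[OF c c]]) (use c x in \<open>auto simp: tr_dom_iff tr_def in_tr_dom\<close>)
  then show ?thesis
    using dd_eq[OF has_derivative_ident] by simp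
qed

lemma dd_tr_inverse:
  assumes "c \<in> atlas M" "d \<in> atlas M" "x \<in> fst c" "x \<in> fst d"
  shows "dd (tr d c) (snd d x) (dd (tr c d) (snd c x) u) = u"
  using dd_tr_comp[of c d c x u] dd_tr_id[of c x u] assms by simp

text \<open>Continuity of \<open>f\<close> cannot be read off from its coordinate expression, which is defined by
  junk values outside the chart.\<close>

lemma chart_change_derivative:
  assumes c: "c \<in> atlas M" "d \<in> atlas M" and x: "f x \<in> fst c" "f x \<in> fst d" "x \<in> S"
    and f: "continuous (at x within S) f"
    and der: "(snd c \<circ> f has_derivative f') (at x within S)"
  shows "(snd d \<circ> f has_derivative (\<lambda>u. dd (tr c d) (snd c (f x)) (f' u))) (at x within S)"
proof -
  have "((\<lambda>y. tr c d ((snd c \<circ> f) y)) has_derivative (\<lambda>u. dd (tr c d) ((snd c \<circ> f) x) (f' u))) (at x within S)"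
    by (rule has_derivative_compose[OF der C1_on_deriv[OF tr_C1(1)]])
       (use c x in \<open>auto intro: in_tr_dom\<close>)
  moreover have "\<forall>\<^sub>F y in at x within S. f y \<in> fst c"
    using f x(1) chart_homeo(2)[OF c(1)] by (auto simp: continuous_within tendsto_def)
  then have "\<forall>\<^sub>F y in at x within S. tr c d ((snd c \<circ> f) y) = (snd d \<circ> f) y"
    by eventually_elim (use c in simp)
  ultimately show ?thesis
    using has_derivative_transform_eventually[of "\<lambda>y. tr c d ((snd c \<circ> f) y)"] c x by simp
qed

lemma chart_change_vector_derivative:
  assumes "c \<in> atlas M" "d \<in> atlas M" "f x \<in> fst c" "f x \<in> fst d" "x \<in> S"
    and "continuous (at x within S) f"
    and "(snd c \<circ> f has_vector_derivative u) (at x within S)"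
  shows "(snd d \<circ> f has_vector_derivative dd (tr c d) (snd c (f x)) u) (at x within S)"
proof -
  have "linear (dd (tr c d) (snd c (f x)))"
    using assms by (intro linear_dd_tr)
  then show ?thesis
    using chart_change_derivative[OF assms(1-6) assms(7)[unfolded has_vector_derivative_def]]
    by (simp add: has_vector_derivative_def linear_scale)
qed

section \<open>The metric in charts\<close>

abbreviation "gm \<equiv> chart_metric M"

lemma metric_bilinear: "bilinear (metric M x)"
  and metric_sym: "metric M x u w = metric M x w u"
  and metric_pos: "u \<noteq> 0 \<Longrightarrow> metric M x u u > 0"
  using riem by (auto simp: riemannian_manifold_def)

lemma gm_eq:
  assumes "c \<in> atlas M" "x \<in> fst c"
  shows "gm c (snd c x) u w = metric M x (dd (tr c (chart_at M x)) (snd c x) u) (dd (tr c (chart_at M x)) (snd c x) w)"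
  using assms by (simp add: chart_metric_def lift_vec_def tr_def)

lemma gm_chart_at: "gm (chart_at M x) (snd (chart_at M x) x) u w = metric M x u w"
  using gm_eq[of "chart_at M x" x u w] chart_at dd_tr_id by simp

text \<open>Components in c pass to those in the selected chart either directly or through d, and by
  \<open>dd_tr_comp\<close> with the same result. Lengths may therefore be computed in any
  convenient chart.\<close>

lemma gm_change:
  assumes c: "c \<in> atlas M" "d \<in> atlas M" and x: "x \<in> fst c" "x \<in> fst d"
  shows "gm d (snd d x) (dd (tr c d) (snd c x) u) (dd (tr c d) (snd c x) w) = gm c (snd c x) u w"
  using dd_tr_comp[OF c chart_at(1) x chart_at(2)] c x by (simp add: gm_eq)

lemma image_point:
  assumes "c \<in> atlas M" "a \<in> chart_image c"
  obtains x where "x \<in> fst c" "a = snd c x"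
  using assms by (auto simp: chart_image_def)

lemma gm_bilinear:
  assumes c: "c \<in> atlas M" and "a \<in> chart_image c"
  shows "bilinear (gm c a)"
proof -
  obtain x where x: "x \<in> fst c" and a: "a = snd c x"
    using assms by (rule image_point)
  let ?T = "dd (tr c (chart_at M x)) (snd c x)"
  have l: "linear ?T"
    using c x chart_at by (intro linear_dd_tr)
  have b: "bilinear (metric M x)"
    by (rule metric_bilinear)
  have "linear (\<lambda>w. metric M x (?T u) (?T w))" "linear (\<lambda>w. metric M x (?T w) (?T u))" for u
    using linear_compose[OF l, of "metric M x (?T u)"] linear_compose[OF l, of "\<lambda>w. metric M x w (?T u)"] b
    by (auto simp: bilinear_def o_def)
  then show "bilinear (gm c a)"
    unfolding bilinear_def a gm_eq[OF c x] by simp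
qed

lemma gm_sym: "c \<in> atlas M \<Longrightarrow> a \<in> chart_image c \<Longrightarrow> gm c a u w = gm c a w u"
  by (metis gm_eq image_point metric_sym)

lemma gm_pos:
  assumes c: "c \<in> atlas M" and "a \<in> chart_image c" and u: "u \<noteq> 0"
  shows "gm c a u u > 0"
proof -
  obtain x where x: "x \<in> fst c" and a: "a = snd c x"
    using assms(1,2) by (rule image_point)
  have "dd (tr c (chart_at M x)) (snd c x) u \<noteq> 0"
    using dd_tr_inverse[OF c chart_at(1) x chart_at(2), of u] u
      linear_0[OF linear_dd_tr[OF chart_at(1) c chart_at(2) x]] by auto
  then show "gm c a u u > 0"
    by (simp add: a gm_eq[OF c x] metric_pos)
qed

lemma gm_nonneg: "c \<in> atlas M \<Longrightarrow> a \<in> chart_image c \<Longrightarrow> gm c a u u \<ge> 0"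
  using gm_pos bilinear_lzero[OF gm_bilinear] by (metis less_eq_real_def order_refl)

lemma gm_C1:
  assumes "c \<in> atlas M"
  shows "C1_on (chart_image c) (\<lambda>a. gm c a u w)"
    "C1_on (chart_image c) (\<lambda>a. dd (\<lambda>b. gm c b u w) a y)"
  using smooth_on_C1[of "chart_image c" "\<lambda>a. gm c a u w"] riem assms chart_homeo(3)[OF assms]
  by (auto simp: riemannian_manifold_def)

end

text \<open>Both parts come from the squared length of the component of w orthogonal to u. The
  strict form makes the denominator of \<open>sectional_curvature\<close> positive.\<close>

lemma bilinear_CS:
  fixes g :: "'e::euclidean_space \<Rightarrow> 'e \<Rightarrow> real"
  assumes g: "bilinear g" and sym: "\<And>u w. g u w = g w u" and pos: "\<And>u. u \<noteq> 0 \<Longrightarrow> g u u > 0"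
  shows "(g u w)\<^sup>2 \<le> g u u * g w w"
    and "u \<noteq> 0 \<Longrightarrow> (\<forall>k. w \<noteq> k *\<^sub>R u) \<Longrightarrow> (g u w)\<^sup>2 < g u u * g w w"
proof -
  have *: "g (w - (g u w / g u u) *\<^sub>R u) (w - (g u w / g u u) *\<^sub>R u) * g u u = g u u * g w w - (g u w)\<^sup>2"
    if "u \<noteq> 0"
    using pos[OF that] sym[of w u]
    by (simp add: bilinear_lsub[OF g] bilinear_rsub[OF g] bilinear_lmul[OF g] bilinear_rmul[OF g]
        field_simps power2_eq_square)
  have nn: "g v v \<ge> 0" for v
    using pos[of v] bilinear_lzero[OF g] by (cases "v = 0") auto
  show "(g u w)\<^sup>2 \<le> g u u * g w w"
  proof (cases "u = 0")
    case False
    then show ?thesis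
      using *[OF False] nn[of "w - (g u w / g u u) *\<^sub>R u"] nn[of u]
      by (metis diff_ge_0_iff_ge mult_nonneg_nonneg)
  qed (simp add: bilinear_lzero[OF g])
  show "(g u w)\<^sup>2 < g u u * g w w" if u: "u \<noteq> 0" "\<forall>k. w \<noteq> k *\<^sub>R u"
  proof -
    have "w - (g u w / g u u) *\<^sub>R u \<noteq> 0"
      using u(2) by auto
    then show ?thesis
      using *[OF u(1)] mult_pos_pos[OF pos pos[OF u(1)]] by fastforce
  qed
qed

text \<open>The map that collects the inner products of z with the basis is the Gram operator of g;
  positivity makes it injective, hence bijective. The last part resolves the description operator in
  \<open>christoffel\<close>; the first two feed \<open>C1_on_solve\<close>.\<close>

lemma bilinear_riesz:
  fixes g :: "'e::euclidean_space \<Rightarrow> 'e \<Rightarrow> real"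
  assumes g: "bilinear g" and pos: "\<And>u. u \<noteq> 0 \<Longrightarrow> g u u > 0"
  shows "inj (\<lambda>z. \<Sum>i\<in>Basis. g z i *\<^sub>R i)" "linear (\<lambda>z. \<Sum>i\<in>Basis. g z i *\<^sub>R i)"
    and "(\<And>y. g z y = g z' y) \<Longrightarrow> z = z'"
    and "linear \<phi> \<Longrightarrow> \<exists>!z. \<forall>y. g z y = \<phi> y"
proof -
  let ?G = "\<lambda>z. \<Sum>i\<in>Basis. g z i *\<^sub>R i"
  have lin: "linear (g z)" "linear (\<lambda>z. g z y)" for z y
    using g by (auto simp: bilinear_def)
  have G: "?G z \<bullet> y = g z y" for z y
  proof -
    have "g z y = g z (\<Sum>i\<in>Basis. (y \<bullet> i) *\<^sub>R i)"
      by (simp add: euclidean_representation)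
    also have "\<dots> = (\<Sum>i\<in>Basis. (y \<bullet> i) * g z i)"
      using lin(1)[of z] by (simp add: linear_sum linear_scale)
    finally show ?thesis
      unfolding inner_sum_left by (simp add: inner_commute mult.commute)
  qed
  show l: "linear ?G"
    by (intro linear_compose_sum ballI linearI)
       (auto simp: bilinear_ladd[OF g] bilinear_lmul[OF g] scaleR_add_left)
  show eq: "z = z'" if "\<And>y. g z y = g z' y" for z z'
  proof (rule ccontr)
    assume "z \<noteq> z'"
    then show False
      using pos[of "z - z'"] that[of "z - z'"] by (simp add: bilinear_lsub[OF g])
  qed
  show inj: "inj ?G"
  proof (rule injI)
    fix z z' assume "?G z = ?G z'"
    then show "z = z'"
      by (intro eq) (metis G)
  qed
  show "\<exists>!z. \<forall>y. g z y = \<phi> y" if \<phi>: "linear \<phi>"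
  proof -
    have "surj ?G"
      using l inj by (simp add: linear_injective_imp_surjective)
    from surjD[OF this, of "\<Sum>i\<in>Basis. \<phi> i *\<^sub>R i"]
    obtain z where z: "?G z = (\<Sum>i\<in>Basis. \<phi> i *\<^sub>R i)"
      by (elim exE) simp
    have "g z y = \<phi> y" for y
    proof -
      have "\<phi> y = \<phi> (\<Sum>i\<in>Basis. (y \<bullet> i) *\<^sub>R i)"
        by (simp add: euclidean_representation)
      also have "\<dots> = (\<Sum>i\<in>Basis. (y \<bullet> i) * \<phi> i)"
        using \<phi> by (simp add: linear_sum linear_scale)
      also have "\<dots> = (\<Sum>i\<in>Basis. \<phi> i *\<^sub>R i) \<bullet> y"
        unfolding inner_sum_left by (simp add: inner_commute mult.commute)
      finally show ?thesis
        using G[of z y] z by simp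
    qed
    then show ?thesis
      by (intro ex1I[of _ z] eq) auto
  qed
qed

lemma linear_expand:
  fixes l :: "'e::euclidean_space \<Rightarrow> 'b::real_vector"
  assumes "linear l"
  shows "l u = (\<Sum>i\<in>Basis. (u \<bullet> i) *\<^sub>R l i)"
proof -
  have "l u = l (\<Sum>i\<in>Basis. (u \<bullet> i) *\<^sub>R i)"
    by (simp add: euclidean_representation)
  also have "\<dots> = (\<Sum>i\<in>Basis. (u \<bullet> i) *\<^sub>R l i)"
    using assms by (simp add: linear_sum linear_scale)
  finally show ?thesis .
qed

lemma dd_linear_family:
  fixes f :: "'a::euclidean_space \<Rightarrow> 'e::euclidean_space \<Rightarrow> 'b::euclidean_space"
  assumes lin: "\<And>a. a \<in> S \<Longrightarrow> linear (f a)" and f: "\<And>u. C1_on S (\<lambda>a. f a u)" and x: "x \<in> S"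
  shows "dd (\<lambda>a. f a u) x h = (\<Sum>i\<in>Basis. (u \<bullet> i) *\<^sub>R dd (\<lambda>a. f a i) x h)"
    and "linear (\<lambda>u. dd (\<lambda>a. f a u) x h)"
proof -
  show dexp: "dd (\<lambda>a. f a u) x h = (\<Sum>i\<in>Basis. (u \<bullet> i) *\<^sub>R dd (\<lambda>a. f a i) x h)" for u
  proof -
    have "((\<lambda>a. \<Sum>i\<in>Basis. (u \<bullet> i) *\<^sub>R f a i) has_derivative
        (\<lambda>h. \<Sum>i\<in>Basis. (u \<bullet> i) *\<^sub>R dd (\<lambda>a. f a i) x h)) (at x)"
      by (intro has_derivative_sum has_derivative_scaleR_right C1_on_deriv[OF f x])
    then have "((\<lambda>a. f a u) has_derivative (\<lambda>h. \<Sum>i\<in>Basis. (u \<bullet> i) *\<^sub>R dd (\<lambda>a. f a i) x h)) (at x)"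
      by (rule has_derivative_transform_within_open[OF _ C1_on_open[OF f] x])
         (rule linear_expand[OF lin, symmetric])
    from dd_eq[OF this] show ?thesis by simp
  qed
  show "linear (\<lambda>u. dd (\<lambda>a. f a u) x h)"
  proof (rule back_subst[of linear])
    show "linear (\<lambda>u. \<Sum>i\<in>Basis. (u \<bullet> i) *\<^sub>R dd (\<lambda>a. f a i) x h)"
      by (rule linearI) (simp_all add: inner_add_left scaleR_add_left sum.distrib scaleR_sum_right)
  qed (rule ext, rule dexp[symmetric])
qed

text \<open>A product rule in which the linear map itself moves along the curve x. Expansion of J in
  the basis reduces it to products of scalar functions with curves.\<close>

lemma vderiv_linear_family:
  fixes f :: "'a::euclidean_space \<Rightarrow> 'e::euclidean_space \<Rightarrow> 'b::euclidean_space" and x :: "real \<Rightarrow> 'a"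
  assumes lin: "\<And>a. a \<in> S \<Longrightarrow> linear (f a)" and f: "\<And>u. C1_on S (\<lambda>a. f a u)"
    and x: "(x has_vector_derivative x') (at t within T)" "x t \<in> S"
    and J: "(J has_vector_derivative J') (at t within T)" and nb: "\<forall>\<^sub>F s in at t within T. x s \<in> S" "t \<in> T"
  shows "((\<lambda>s. f (x s) (J s)) has_vector_derivative dd (\<lambda>a. f a (J t)) (x t) x' + f (x t) J') (at t within T)"
proof -
  note exp = linear_expand[OF lin]
  note dexp = dd_linear_family(1)[OF lin f x(2)]
  have fi: "((\<lambda>s. f (x s) i) has_vector_derivative dd (\<lambda>a. f a i) (x t) x') (at t within T)" for i
  proof -
    have "linear (dd (\<lambda>a. f a i) (x t))"
      using C1_on_bl[OF f x(2)] by (simp add: linear_conv_bounded_linear)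
    then show ?thesis
      using has_derivative_compose[OF x(1)[unfolded has_vector_derivative_def] C1_on_deriv[OF f[of i] x(2)]]
      by (simp add: has_vector_derivative_def linear_scale)
  qed
  have "((\<lambda>s. \<Sum>i\<in>Basis. (J s \<bullet> i) *\<^sub>R f (x s) i) has_vector_derivative
      (\<Sum>i\<in>Basis. (J t \<bullet> i) *\<^sub>R dd (\<lambda>a. f a i) (x t) x' + (J' \<bullet> i) *\<^sub>R f (x t) i)) (at t within T)"
    by (intro has_vector_derivative_sum bounded_bilinear.has_vector_derivative[OF bounded_bilinear_scaleR] fi
        bounded_linear.has_vector_derivative[OF bounded_linear_inner_left] J)
  also have "(\<Sum>i\<in>Basis. (J t \<bullet> i) *\<^sub>R dd (\<lambda>a. f a i) (x t) x' + (J' \<bullet> i) *\<^sub>R f (x t) i)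
      = dd (\<lambda>a. f a (J t)) (x t) x' + f (x t) J'"
    by (simp only: sum.distrib dexp[of "J t", symmetric] exp[OF x(2), of J', symmetric])
  finally have "((\<lambda>s. \<Sum>i\<in>Basis. (J s \<bullet> i) *\<^sub>R f (x s) i) has_vector_derivative
     dd (\<lambda>a. f a (J t)) (x t) x' + f (x t) J') (at t within T)" .
  moreover have "\<forall>\<^sub>F s in at t within T. (\<Sum>i\<in>Basis. (J s \<bullet> i) *\<^sub>R f (x s) i) = f (x s) (J s)"
    using nb(1) by eventually_elim (rule exp[symmetric])
  ultimately show "((\<lambda>s. f (x s) (J s)) has_vector_derivative dd (\<lambda>a. f a (J t)) (x t) x' + f (x t) J') (at t within T)"
    unfolding has_vector_derivative_def
    by (rule has_derivative_transform_eventually) (use nb(2) in \<open>simp_all add: exp[OF x(2), of "J t"]\<close>)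
qed

text \<open>\<open>vderiv_linear_family\<close> handles the first slot with a basis vector in the
  second; expanding W in the basis then handles the second slot.\<close>

lemma vderiv_bilinear_family:
  fixes f :: "'a::euclidean_space \<Rightarrow> 'e::euclidean_space \<Rightarrow> 'e \<Rightarrow> 'b::euclidean_space" and x :: "real \<Rightarrow> 'a"
  assumes bil: "\<And>a. a \<in> S \<Longrightarrow> bilinear (f a)" and f: "\<And>u w. C1_on S (\<lambda>a. f a u w)"
    and x: "(x has_vector_derivative x') (at t within T)" "x t \<in> S"
    and J: "(J has_vector_derivative J') (at t within T)" "(W has_vector_derivative W') (at t within T)"
    and nb: "\<forall>\<^sub>F s in at t within T. x s \<in> S" "t \<in> T"
  shows "((\<lambda>s. f (x s) (J s) (W s)) has_vector_derivative
    dd (\<lambda>a. f a (J t) (W t)) (x t) x' + f (x t) J' (W t) + f (x t) (J t) W') (at t within T)"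
proof -
  have lin: "linear (\<lambda>u. f a u w)" "linear (f a u)" if "a \<in> S" for a u w
    using bil[OF that] by (auto simp: bilinear_def)
  have fw: "((\<lambda>s. f (x s) (J s) i) has_vector_derivative dd (\<lambda>a. f a (J t) i) (x t) x' + f (x t) J' i) (at t within T)" for i
    by (rule vderiv_linear_family[OF lin(1) f x J(1) nb])
  have dl: "linear (\<lambda>w. dd (\<lambda>a. f a (J t) w) (x t) x')"
    by (rule dd_linear_family(2)[OF lin(2) f x(2)])
  note exp = linear_expand
  have "((\<lambda>s. \<Sum>i\<in>Basis. (W s \<bullet> i) *\<^sub>R f (x s) (J s) i) has_vector_derivative
      (\<Sum>i\<in>Basis. (W t \<bullet> i) *\<^sub>R (dd (\<lambda>a. f a (J t) i) (x t) x' + f (x t) J' i) + (W' \<bullet> i) *\<^sub>R f (x t) (J t) i)) (at t within T)"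
    by (intro has_vector_derivative_sum bounded_bilinear.has_vector_derivative[OF bounded_bilinear_scaleR] fw
        bounded_linear.has_vector_derivative[OF bounded_linear_inner_left] J)
  also have "(\<Sum>i\<in>Basis. (W t \<bullet> i) *\<^sub>R (dd (\<lambda>a. f a (J t) i) (x t) x' + f (x t) J' i) + (W' \<bullet> i) *\<^sub>R f (x t) (J t) i)
     = dd (\<lambda>a. f a (J t) (W t)) (x t) x' + f (x t) J' (W t) + f (x t) (J t) W'"
    by (simp only: scaleR_add_right sum.distrib exp[OF dl, symmetric] exp[OF lin(2)[OF x(2)], symmetric])
  finally have "((\<lambda>s. \<Sum>i\<in>Basis. (W s \<bullet> i) *\<^sub>R f (x s) (J s) i) has_vector_derivative
     dd (\<lambda>a. f a (J t) (W t)) (x t) x' + f (x t) J' (W t) + f (x t) (J t) W') (at t within T)" .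
  moreover have "\<forall>\<^sub>F s in at t within T. (\<Sum>i\<in>Basis. (W s \<bullet> i) *\<^sub>R f (x s) (J s) i) = f (x s) (J s) (W s)"
    using nb(1) by eventually_elim (rule exp[OF lin(2), symmetric])
  ultimately show ?thesis
    unfolding has_vector_derivative_def
    by (rule has_derivative_transform_eventually) (use nb(2) in \<open>simp_all add: exp[OF lin(2)[OF x(2)], of "J t" "W t"]\<close>)
qed

section \<open>The Levi-Civita connection in charts\<close>

context riemannian_mfd
begin

text \<open>Half the right-hand side of the Koszul formula for fields with constant components,
  whose Lie brackets vanish.\<close>

definition koszul :: "('m, 'e) chart \<Rightarrow> 'e \<Rightarrow> 'e \<Rightarrow> 'e \<Rightarrow> 'e \<Rightarrow> real" where
  "koszul c a u w y = (dd (\<lambda>b. gm c b w y) a u + dd (\<lambda>b. gm c b u y) a w - dd (\<lambda>b. gm c b u w) a y) / 2"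

abbreviation "\<Gamma> \<equiv> christoffel M"

context
  fixes c assumes c: "c \<in> atlas M"
begin

lemma gm_linear: "a \<in> chart_image c \<Longrightarrow> linear (gm c a u)" "a \<in> chart_image c \<Longrightarrow> linear (\<lambda>w. gm c a w u)"
  using gm_bilinear[OF c] by (auto simp: bilinear_def)

lemma dgm_linear:
  assumes a: "a \<in> chart_image c"
  shows "linear (dd (\<lambda>b. gm c b u w) a)"
    "linear (\<lambda>w. dd (\<lambda>b. gm c b u w) a y)"
    "linear (\<lambda>w. dd (\<lambda>b. gm c b w u) a y)"
proof -
  show "linear (dd (\<lambda>b. gm c b u w) a)"
    using C1_on_bl[OF gm_C1(1)[OF c] a] by (simp add: linear_conv_bounded_linear)
  show "linear (\<lambda>w. dd (\<lambda>b. gm c b u w) a y)"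
    by (rule dd_linear_family(2)[OF gm_linear(1) gm_C1(1)[OF c] a])
  show "linear (\<lambda>w. dd (\<lambda>b. gm c b w u) a y)"
    by (rule dd_linear_family(2)[OF gm_linear(2) gm_C1(1)[OF c] a])
qed

lemma dgm_sym: "a \<in> chart_image c \<Longrightarrow> dd (\<lambda>b. gm c b u w) a = dd (\<lambda>b. gm c b w u) a"
  by (rule dd_cong[OF chart_homeo(3)[OF c]]) (auto intro: gm_sym[OF c])

lemma koszul_linear:
  assumes a: "a \<in> chart_image c"
  shows "linear (koszul c a u w)" "linear (\<lambda>w. koszul c a u w y)" "linear (\<lambda>w. koszul c a w u y)"
  using dgm_linear[OF a] by (auto simp: koszul_def linear_iff algebra_simps add_divide_distrib diff_divide_distrib)

lemma gm_christoffel: "a \<in> chart_image c \<Longrightarrow> gm c a (\<Gamma> c a u w) y = koszul c a u w y"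
proof -
  assume a: "a \<in> chart_image c"
  have "\<exists>!z. \<forall>y. gm c a z y = koszul c a u w y"
    by (rule bilinear_riesz(4)[OF gm_bilinear[OF c a] gm_pos[OF c a] koszul_linear(1)[OF a]])
  then have "\<exists>!z. \<forall>y. 2 * gm c a z y = dd (\<lambda>b. gm c b w y) a u + dd (\<lambda>b. gm c b u y) a w - dd (\<lambda>b. gm c b u w) a y"
    by (simp add: koszul_def field_simps)
  from theI'[OF this]
  have "2 * gm c a (\<Gamma> c a u w) y = dd (\<lambda>b. gm c b w y) a u + dd (\<lambda>b. gm c b u y) a w - dd (\<lambda>b. gm c b u w) a y"
    unfolding christoffel_def by blast
  then show ?thesis
    by (simp add: koszul_def)
qed

lemma gm_eqI: "a \<in> chart_image c \<Longrightarrow> (\<And>y. gm c a z y = gm c a z' y) \<Longrightarrow> z = z'"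
  by (rule bilinear_riesz(3)[OF gm_bilinear[OF c] gm_pos[OF c]])

lemma christoffel_sym: "a \<in> chart_image c \<Longrightarrow> \<Gamma> c a u w = \<Gamma> c a w u"
  by (rule gm_eqI) (auto simp: gm_christoffel koszul_def dgm_sym[of _ u w])

lemma christoffel_bilinear:
  assumes a: "a \<in> chart_image c"
  shows "bilinear (\<Gamma> c a)"
  unfolding bilinear_def linear_iff
  by (auto intro!: gm_eqI[OF a] simp: gm_christoffel[OF a] linear_add[OF gm_linear(2)[OF a]]
      linear_scale[OF gm_linear(2)[OF a]] linear_add[OF koszul_linear(2)[OF a]] linear_add[OF koszul_linear(3)[OF a]]
      linear_scale[OF koszul_linear(2)[OF a]] linear_scale[OF koszul_linear(3)[OF a]])

text \<open>The Christoffel vector is the solution of a Gram system whose matrix and right-hand side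
  are C1.\<close>

lemma christoffel_C1: "C1_on (chart_image c) (\<lambda>a. \<Gamma> c a u w)"
proof (rule C1_on_solve)
  show "C1_on (chart_image c) (\<lambda>a. \<Sum>i\<in>Basis. gm c a e i *\<^sub>R i)" for e
    by (intro C1_on_sum finite_Basis chart_homeo(3)[OF c] C1_on_scaleR gm_C1(1)[OF c] C1_on_const)
  show "C1_on (chart_image c) (\<lambda>a. \<Sum>i\<in>Basis. koszul c a u w i *\<^sub>R i)"
    unfolding koszul_def divide_inverse
    by (intro C1_on_sum finite_Basis chart_homeo(3)[OF c] C1_on_scaleR C1_on_mult C1_on_add C1_on_diff gm_C1(2)[OF c] C1_on_const)
qed (auto simp: gm_christoffel intro!: bilinear_riesz(1,2) gm_bilinear[OF c] gm_pos[OF c])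

text \<open>Adding the Koszul expressions for (w, y) and (y, w) cancels everything but the
  derivative of the metric in direction u.\<close>

lemma metric_compatible:
  assumes a: "a \<in> chart_image c"
  shows "dd (\<lambda>b. gm c b w y) a u = gm c a (\<Gamma> c a u w) y + gm c a w (\<Gamma> c a u y)"
proof -
  have "gm c a w (\<Gamma> c a u y) = koszul c a u y w"
    by (simp add: gm_sym[OF c a, of w] gm_christoffel[OF a])
  then show ?thesis
    using dgm_sym[OF a, of y w] dgm_sym[OF a, of u y] dgm_sym[OF a, of u w]
    by (simp add: gm_christoffel[OF a] koszul_def field_simps)
qed

lemma christoffel_linear_simps:
  assumes a: "a \<in> chart_image c"
  shows "\<Gamma> c a (u + u') w = \<Gamma> c a u w + \<Gamma> c a u' w" "\<Gamma> c a w (u + u') = \<Gamma> c a w u + \<Gamma> c a w u'"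
    "\<Gamma> c a (r *\<^sub>R u) w = r *\<^sub>R \<Gamma> c a u w" "\<Gamma> c a w (r *\<^sub>R u) = r *\<^sub>R \<Gamma> c a w u"
    "\<Gamma> c a (- u) w = - \<Gamma> c a u w" "\<Gamma> c a w (- u) = - \<Gamma> c a w u"
  using christoffel_bilinear[OF a]
  by (auto simp: bilinear_ladd bilinear_radd bilinear_lmul bilinear_rmul bilinear_lneg bilinear_rneg)

text \<open>J' + \<Gamma>(v, J) is the covariant derivative of J along x; compatibility with the
  metric gathers the three terms of the ordinary product rule into two covariant ones.\<close>

lemma covariant_product_rule:
  assumes x: "(x has_vector_derivative v) (at t)" "x t \<in> chart_image c"
    and J: "(J has_vector_derivative J') (at t)" "(W has_vector_derivative W') (at t)"
  shows "((\<lambda>s. gm c (x s) (J s) (W s)) has_vector_derivative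
    gm c (x t) (J' + \<Gamma> c (x t) v (J t)) (W t) + gm c (x t) (J t) (W' + \<Gamma> c (x t) v (W t))) (at t)"
proof -
  have "isCont x t"
    using x(1) has_vector_derivative_continuous by blast
  then have "\<forall>\<^sub>F s in at t. x s \<in> chart_image c"
    using x(2) chart_homeo(3)[OF c] by (simp add: isCont_def tendsto_def)
  from vderiv_bilinear_family[OF gm_bilinear[OF c] gm_C1(1)[OF c] x J this]
  show ?thesis
    by (simp add: metric_compatible[OF x(2)] linear_add[OF gm_linear(1)[OF x(2)]] linear_add[OF gm_linear(2)[OF x(2)]] algebra_simps)
qed

section \<open>Jacobi fields in a chart\<close>

context
  fixes x v J P :: "real \<Rightarrow> 'e" and T
  assumes T: "open T" and xT: "\<And>t. t \<in> T \<Longrightarrow> x t \<in> chart_image c"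
    and x: "\<And>t. t \<in> T \<Longrightarrow> (x has_vector_derivative v t) (at t)"
      "\<And>t. t \<in> T \<Longrightarrow> (v has_vector_derivative - \<Gamma> c (x t) (v t) (v t)) (at t)"
    and J: "\<And>t. t \<in> T \<Longrightarrow> (J has_vector_derivative P t) (at t)"
      "\<And>t. t \<in> T \<Longrightarrow> (P has_vector_derivative
          - (dd (\<lambda>b. \<Gamma> c b (v t) (v t)) (x t) (J t) + 2 *\<^sub>R \<Gamma> c (x t) (v t) (P t))) (at t)"
begin

lemma jacobi_norm_deriv:
  "t \<in> T \<Longrightarrow> ((\<lambda>s. gm c (x s) (J s) (J s)) has_vector_derivative
     2 * gm c (x t) (P t + \<Gamma> c (x t) (v t) (J t)) (J t)) (at t)"
  using covariant_product_rule[OF x(1) xT J(1) J(1), of t]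
  by (simp add: gm_sym[OF c xT, of t "J t" "P t + \<Gamma> c (x t) (v t) (J t)"])

text \<open>Let K = P + \<Gamma>(v, J) be the covariant derivative of J. The linearised geodesic
  equation for (J, P) then is the Jacobi equation K' + \<Gamma>(v, K) = R(v, J)v, and
  differentiating 2 <K, J> once more gives the claim.\<close>

lemma jacobi_norm_deriv2:
  assumes t: "t \<in> T"
  shows "((\<lambda>s. 2 * gm c (x s) (P s + \<Gamma> c (x s) (v s) (J s)) (J s)) has_vector_derivative
     2 * (gm c (x t) (P t + \<Gamma> c (x t) (v t) (J t)) (P t + \<Gamma> c (x t) (v t) (J t)) +
       gm c (x t) (curvature M c (x t) (v t) (J t) (v t)) (J t))) (at t)"
proof -
  let ?a = "x t"
  have a: "?a \<in> chart_image c"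
    using xT[OF t] .
  have nb: "\<forall>\<^sub>F s in at t. x s \<in> chart_image c"
    using eventually_at_topological T t xT by blast
  have "((\<lambda>s. \<Gamma> c (x s) (v s) (J s)) has_vector_derivative
     dd (\<lambda>b. \<Gamma> c b (v t) (J t)) ?a (v t) + \<Gamma> c ?a (- \<Gamma> c ?a (v t) (v t)) (J t) + \<Gamma> c ?a (v t) (P t)) (at t)"
    by (rule vderiv_bilinear_family[OF christoffel_bilinear christoffel_C1 x(1)[OF t] a x(2)[OF t] J(1)[OF t] nb]) auto
  from has_vector_derivative_add[OF J(2)[OF t] this]
  have K: "((\<lambda>s. P s + \<Gamma> c (x s) (v s) (J s)) has_vector_derivative
     - (dd (\<lambda>b. \<Gamma> c b (v t) (v t)) ?a (J t) + 2 *\<^sub>R \<Gamma> c ?a (v t) (P t)) +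
     (dd (\<lambda>b. \<Gamma> c b (v t) (J t)) ?a (v t) + \<Gamma> c ?a (- \<Gamma> c ?a (v t) (v t)) (J t) + \<Gamma> c ?a (v t) (P t))) (at t)"
    (is "(?K has_vector_derivative ?K') _") .
  \<comment> \<open>The definition of \<open>curvature\<close> differentiates \<Gamma> with these
    two arguments exchanged.\<close>
  have "dd (\<lambda>b. \<Gamma> c b (v t) (J t)) ?a = dd (\<lambda>b. \<Gamma> c b (J t) (v t)) ?a"
    by (rule dd_cong[OF chart_homeo(3)[OF c] a]) (rule christoffel_sym)
  then have R: "?K' + \<Gamma> c ?a (v t) (?K t) = curvature M c ?a (v t) (J t) (v t)"
    using christoffel_sym[OF a, of "v t" "J t"] christoffel_sym[OF a, of "\<Gamma> c ?a (v t) (v t)" "J t"]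
    by (simp add: curvature_def christoffel_linear_simps[OF a] algebra_simps scaleR_2)
  have "((\<lambda>s. gm c (x s) (?K s) (J s)) has_vector_derivative
    gm c ?a (?K' + \<Gamma> c ?a (v t) (?K t)) (J t) + gm c ?a (?K t) (?K t)) (at t)"
    by (rule covariant_product_rule[OF x(1)[OF t] a K J(1)[OF t]])
  from has_vector_derivative_mult_right[OF this, of 2]
  show ?thesis
    unfolding R by (simp add: add.commute)
qed

end

end

section \<open>The sign of the curvature term\<close>

lemma curvature_swap: "curvature M c a u v w = - curvature M c a v u w"
  by (simp add: curvature_def)

lemma curvature_zero:
  assumes c: "c \<in> atlas M" "a \<in> chart_image c"
  shows "curvature M c a v (k *\<^sub>R v) v = 0"
proof -
  have "dd (\<lambda>b. \<Gamma> c b (k *\<^sub>R v) v) a = dd (\<lambda>b. k *\<^sub>R \<Gamma> c b v v) a"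
    by (rule dd_cong[OF chart_homeo(3)[OF c(1)] c(2)]) (simp add: christoffel_linear_simps[OF c(1)])
  also have "\<dots> = (\<lambda>h. k *\<^sub>R dd (\<lambda>b. \<Gamma> c b v v) a h)"
    by (intro dd_eq has_derivative_scaleR_right C1_on_deriv[OF christoffel_C1[OF c(1)] c(2)])
  finally have 1: "dd (\<lambda>b. \<Gamma> c b (k *\<^sub>R v) v) a v = k *\<^sub>R dd (\<lambda>b. \<Gamma> c b v v) a v"
    by simp
  have "linear (dd (\<lambda>b. \<Gamma> c b v v) a)"
    using C1_on_bl[OF christoffel_C1[OF c(1)] c(2)] by (simp add: linear_conv_bounded_linear)
  then show ?thesis
    by (simp add: curvature_def 1 linear_scale christoffel_linear_simps[OF c])
qed

lemma curvature_zero':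
  assumes c: "c \<in> atlas M" "a \<in> chart_image c"
  shows "curvature M c a 0 J 0 = 0"
proof -
  have z: "\<Gamma> c b 0 u = 0" "\<Gamma> c b u 0 = 0" if "b \<in> chart_image c" for b u
    using christoffel_bilinear[OF c(1) that] by (auto simp: bilinear_lzero bilinear_rzero)
  have "dd (\<lambda>b. \<Gamma> c b 0 0) a = dd (\<lambda>b. 0) a"
    by (rule dd_cong[OF chart_homeo(3)[OF c(1)] c(2)]) (simp add: z)
  also have "\<dots> = (\<lambda>h. 0)"
    by (intro dd_eq has_derivative_const)
  finally have "dd (\<lambda>b. \<Gamma> c b 0 0) a J = 0"
    by simp
  moreover have "linear (dd (\<lambda>b. \<Gamma> c b J 0) a)"
    using C1_on_bl[OF christoffel_C1[OF c(1)] c(2)] by (simp add: linear_conv_bounded_linear)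
  ultimately show ?thesis
    by (simp add: curvature_def linear_0 z[OF c(2)])
qed

text \<open>The curvature hypothesis speaks of linearly independent pairs; for proportional vectors
  the curvature term vanishes. The order of the arguments v and J, opposite to that in
  \<open>sectional_curvature\<close>, turns nonpositive into nonnegative.\<close>

lemma curvature_nonneg:
  assumes "nonpositive_curvature M"
  shows "metric M p (curvature M (chart_at M p) (snd (chart_at M p) p) v J v) J \<ge> 0"
proof -
  let ?c = "chart_at M p" let ?a = "snd ?c p"
  have a: "?c \<in> atlas M" "?a \<in> chart_image ?c"
    using chart_at[of p] by auto
  have lz: "metric M p 0 u = 0" "metric M p u 0 = 0" for u
    using metric_bilinear[of p] by (auto simp: bilinear_lzero bilinear_rzero)
  consider "v = 0" | k where "J = k *\<^sub>R v" | "v \<noteq> 0" "\<forall>k. J \<noteq> k *\<^sub>R v"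
    by blast
  then show ?thesis
  proof cases
    case 1
    then show ?thesis
      by (simp add: curvature_zero'[OF a] lz)
  next
    case 2
    then show ?thesis
      by (simp add: curvature_zero[OF a] lz)
  next
    case 3
    then have ind: "J \<noteq> v" "independent {J, v}"
      by (auto simp: independent_insert span_singleton dest: spec[of _ 1])
    have "sectional_curvature M p J v \<le> 0"
      using assms ind by (auto simp: nonpositive_curvature_def)
    \<comment> \<open>By the strict Cauchy-Schwarz inequality the quotient has the sign of its
      numerator.\<close>
    moreover have "metric M p J J * metric M p v v - (metric M p J v)\<^sup>2 > 0"
      using bilinear_CS(2)[OF metric_bilinear[of p] metric_sym metric_pos, of v J] 3
      by (auto simp: metric_sym[of p J v] mult.commute)
    ultimately have "metric M p (curvature M ?c ?a J v v) J \<le> 0"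
      by (simp add: sectional_curvature_def divide_le_0_iff)
    then show ?thesis
      using curvature_swap[of ?c ?a v J v] bilinear_lneg[OF metric_bilinear[of p]] by simp
  qed
qed

end

section \<open>Geodesics\<close>

lemma C1_on_bilinear_family:
  fixes f :: "'a::euclidean_space \<Rightarrow> 'e::euclidean_space \<Rightarrow> 'e \<Rightarrow> 'b::euclidean_space"
  assumes bil: "\<And>a. a \<in> S \<Longrightarrow> bilinear (f a)" and f: "\<And>u w. C1_on S (\<lambda>a. f a u w)" and S: "open S"
  shows "C1_on (S \<times> UNIV) (\<lambda>z. f (fst z) (snd z) (snd z))"
proof -
  have o: "open (S \<times> (UNIV::'e set))"
    using S by (intro open_Times) auto
  have sc: "C1_on (S \<times> (UNIV::'e set)) snd" and fc: "C1_on (S \<times> (UNIV::'e set)) fst"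
    using o by (auto intro: C1_on_bounded_linear bounded_linear_snd bounded_linear_fst)
  have *: "C1_on (S \<times> UNIV) (\<lambda>z. f (fst z) u (snd z))" for u
  proof (rule C1_on_blinear_apply[OF _ _ sc])
    show "linear (f (fst z) u)" if "z \<in> S \<times> UNIV" for z
      using bil that by (auto simp: bilinear_def)
    show "C1_on (S \<times> (UNIV::'e set)) (\<lambda>z. f (fst z) u w)" for w
      using C1_on_compose(1)[OF f[of u w] fc] by auto
  qed
  show ?thesis
  proof (rule C1_on_blinear_apply[OF _ * sc])
    show "linear (\<lambda>u. f (fst z) u (snd z))" if "z \<in> S \<times> UNIV" for z
      using bil that by (auto simp: bilinear_def)
  qed
qed

lemma C1_on_compact_lipschitz:
  assumes F: "C1_on \<Omega> F" and K: "compact K" "convex K" "K \<subseteq> \<Omega>"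
  obtains L where "L \<ge> 0" "\<And>x. x \<in> K \<Longrightarrow> norm (Blinfun (dd F x)) \<le> L"
    "\<And>x y. x \<in> K \<Longrightarrow> y \<in> K \<Longrightarrow> norm (F x - F y) \<le> L * norm (x - y)"
proof -
  have "bounded ((\<lambda>x. Blinfun (dd F x)) ` K)"
    by (intro compact_imp_bounded compact_continuous_image continuous_on_subset[OF C1_on_dd_Blinfun[OF F]] K)
  then obtain L where L: "L > 0" "\<And>x. x \<in> K \<Longrightarrow> norm (Blinfun (dd F x)) \<le> L"
    unfolding bounded_pos by auto
  have "norm (F x - F y) \<le> L * norm (x - y)" if xy: "x \<in> K" "y \<in> K" for x y
  proof (rule differentiable_bound[OF K(2) _ _ xy])
    show "(F has_derivative dd F u) (at u within K)" if "u \<in> K" for u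
      using C1_on_deriv[OF F] that K by (auto intro: has_derivative_at_withinI)
    show "onorm (dd F u) \<le> L" if "u \<in> K" for u
      using L(2)[OF that] C1_on_Blinfun[OF F] that K by (auto simp: norm_blinfun.rep_eq)
  qed
  with that L show thesis by (meson less_imp_le)
qed

context riemannian_mfd
begin

text \<open>The geodesic equation as a first-order vector field on pairs of position and velocity,
  to which the results on flows apply.\<close>

definition spray :: "('m, 'e) chart \<Rightarrow> 'e \<times> 'e \<Rightarrow> 'e \<times> 'e" where
  "spray c z = (snd z, - \<Gamma> c (fst z) (snd z) (snd z))"

text \<open>The phase of \<gamma> in the chart c, meaningful only at times at which \<gamma> lies in
  the domain of c.\<close>

definition st :: "('m, 'e) chart \<Rightarrow> (real \<Rightarrow> 'm) \<Rightarrow> real \<Rightarrow> 'e \<times> 'e" where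
  "st c \<gamma> t = (snd c (\<gamma> t), vector_derivative (snd c \<circ> \<gamma>) (at t))"

abbreviation phase :: "('m, 'e) chart \<Rightarrow> ('e \<times> 'e) set" where
  "phase c \<equiv> chart_image c \<times> UNIV"

lemma open_phase: "c \<in> atlas M \<Longrightarrow> open (phase c)"
  by (intro open_Times chart_homeo(3) open_UNIV)

lemma spray_C1:
  assumes c: "c \<in> atlas M"
  shows "C1_on (phase c) (spray c)"
proof -
  have *: "C1_on (phase c) (\<lambda>z. \<Gamma> c (fst z) (snd z) (snd z))"
    by (rule C1_on_bilinear_family[OF christoffel_bilinear[OF c] christoffel_C1[OF c] chart_homeo(3)[OF c]])
  have "C1_on (phase c) (\<lambda>z. (snd z, (0::'e) - \<Gamma> c (fst z) (snd z) (snd z)))"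
    by (intro C1_on_Pair C1_on_diff * C1_on_const C1_on_bounded_linear bounded_linear_snd open_phase[OF c])
  then show ?thesis
    by (simp add: spray_def[abs_def])
qed

text \<open>Differentiation along the line s -> (x + s J, v + s P) reduces the total derivative to
  the product rule. The result is the linear system imposed on (J, P) in
  \<open>jacobi_norm_deriv2\<close>.\<close>

lemma dd_spray:
  assumes c: "c \<in> atlas M" and x: "x \<in> chart_image c"
  shows "dd (spray c) (x, v) (J, P) = (P, - (dd (\<lambda>b. \<Gamma> c b v v) x J + 2 *\<^sub>R \<Gamma> c x v P))"
proof -
  let ?\<phi> = "\<lambda>s::real. (x + s *\<^sub>R J, v + s *\<^sub>R P)"
  have d1: "((\<lambda>s. x + s *\<^sub>R J) has_vector_derivative J) (at 0)" "((\<lambda>s. v + s *\<^sub>R P) has_vector_derivative P) (at 0)"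
    by (auto intro!: derivative_eq_intros)
  have "(?\<phi> has_vector_derivative (J, P)) (at 0)"
    by (intro has_vector_derivative_Pair d1)
  moreover have "(spray c has_derivative dd (spray c) (x, v)) (at (?\<phi> 0))"
    using C1_on_deriv[OF spray_C1[OF c]] x by simp
  ultimately have "((\<lambda>s. spray c (?\<phi> s)) has_derivative (\<lambda>h. dd (spray c) (x, v) (h *\<^sub>R (J, P)))) (at 0)"
    unfolding has_vector_derivative_def by (rule has_derivative_compose)
  moreover have "linear (dd (spray c) (x, v))"
    using C1_on_bl[OF spray_C1[OF c]] x by (simp add: linear_conv_bounded_linear)
  ultimately have 1: "((\<lambda>s. spray c (?\<phi> s)) has_vector_derivative dd (spray c) (x, v) (J, P)) (at 0)"
    unfolding has_vector_derivative_def by (simp only: linear_scale)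
  have nb: "\<forall>\<^sub>F s in at 0. x + s *\<^sub>R J \<in> chart_image c"
  proof -
    have "((\<lambda>s. x + s *\<^sub>R J) \<longlongrightarrow> x + 0 *\<^sub>R J) (at 0)"
      by (intro tendsto_intros)
    then show ?thesis
      using x chart_homeo(3)[OF c] by (simp add: tendsto_def)
  qed
  have "((\<lambda>s. \<Gamma> c (x + s *\<^sub>R J) (v + s *\<^sub>R P) (v + s *\<^sub>R P)) has_vector_derivative
     dd (\<lambda>b. \<Gamma> c b (v + 0 *\<^sub>R P) (v + 0 *\<^sub>R P)) (x + 0 *\<^sub>R J) J + \<Gamma> c (x + 0 *\<^sub>R J) P (v + 0 *\<^sub>R P)
      + \<Gamma> c (x + 0 *\<^sub>R J) (v + 0 *\<^sub>R P) P) (at 0)"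
    by (rule vderiv_bilinear_family[OF christoffel_bilinear[OF c] christoffel_C1[OF c] d1(1) _ d1(2) d1(2) nb])
       (use x in auto)
  then have "((\<lambda>s. \<Gamma> c (x + s *\<^sub>R J) (v + s *\<^sub>R P) (v + s *\<^sub>R P)) has_vector_derivative
     dd (\<lambda>b. \<Gamma> c b v v) x J + 2 *\<^sub>R \<Gamma> c x v P) (at 0)"
    using christoffel_sym[OF c x, of P v] by (simp add: scaleR_2 add.assoc)
  then have "((\<lambda>s. spray c (?\<phi> s)) has_vector_derivative (P, - (dd (\<lambda>b. \<Gamma> c b v v) x J + 2 *\<^sub>R \<Gamma> c x v P))) (at 0)"
    unfolding spray_def fst_conv snd_conv by (intro has_vector_derivative_Pair has_vector_derivative_minus d1)
  with 1 show ?thesis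
    by (rule vector_derivative_unique_at)
qed

lemma geodesic_cont: "geodesic_line M \<gamma> \<Longrightarrow> continuous_on UNIV \<gamma>"
  by (simp add: geodesic_line_def)

lemma geodesic_open: "geodesic_line M \<gamma> \<Longrightarrow> open S \<Longrightarrow> open {t. \<gamma> t \<in> S}"
  using open_vimage[of S \<gamma>] geodesic_cont[of \<gamma>] by (simp add: vimage_def)

text \<open>\<open>geodesic_line\<close> provides the derivative \<gamma>' existentially, chart by
  chart. At the times spent in the chart it is the vector derivative, which makes
  \<open>st c \<gamma>\<close> an integral curve of \<open>spray c\<close>.\<close>

lemma st_deriv:
  assumes g: "geodesic_line M \<gamma>" and c: "c \<in> atlas M" and t: "\<gamma> t \<in> fst c"
  shows "(st c \<gamma> has_vector_derivative spray c (st c \<gamma> t)) (at t)"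
proof -
  obtain \<gamma>' where \<gamma>': "\<And>t. \<gamma> t \<in> fst c \<Longrightarrow> (snd c \<circ> \<gamma> has_vector_derivative \<gamma>' t) (at t)"
    "\<And>t. \<gamma> t \<in> fst c \<Longrightarrow> (\<gamma>' has_vector_derivative - \<Gamma> c (snd c (\<gamma> t)) (\<gamma>' t) (\<gamma>' t)) (at t)"
    using g c unfolding geodesic_line_def by metis
  have eq: "vector_derivative (snd c \<circ> \<gamma>) (at t) = \<gamma>' t" if "\<gamma> t \<in> fst c" for t
    using \<gamma>'(1)[OF that] by (rule vector_derivative_at)
  have "((\<lambda>s. ((snd c \<circ> \<gamma>) s, \<gamma>' s)) has_vector_derivative (\<gamma>' t, - \<Gamma> c (snd c (\<gamma> t)) (\<gamma>' t) (\<gamma>' t))) (at t)"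
    by (intro has_vector_derivative_Pair \<gamma>' t)
  then have "((\<lambda>s. ((snd c \<circ> \<gamma>) s, \<gamma>' s)) has_vector_derivative spray c (st c \<gamma> t)) (at t)"
    by (simp add: spray_def st_def eq[OF t])
  then show ?thesis
    by (rule has_vector_derivative_transform_within_open[OF _ geodesic_open[OF g chart_homeo(2)[OF c]]])
       (use t eq in \<open>auto simp: st_def\<close>)
qed

lemma st_parts:
  assumes g: "geodesic_line M \<gamma>" and c: "c \<in> atlas M" and t: "\<gamma> t \<in> fst c"
  shows "((\<lambda>t. fst (st c \<gamma> t)) has_vector_derivative snd (st c \<gamma> t)) (at t)"
    "((\<lambda>t. snd (st c \<gamma> t)) has_vector_derivative - \<Gamma> c (fst (st c \<gamma> t)) (snd (st c \<gamma> t)) (snd (st c \<gamma> t))) (at t)"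
    "(snd c \<circ> \<gamma> has_vector_derivative snd (st c \<gamma> t)) (at t)"
    "isCont (st c \<gamma>) t"
proof -
  note d = st_deriv[OF g c t]
  show 1: "((\<lambda>t. fst (st c \<gamma> t)) has_vector_derivative snd (st c \<gamma> t)) (at t)"
    using bounded_linear.has_vector_derivative[OF bounded_linear_fst d] by (simp add: spray_def)
  show "((\<lambda>t. snd (st c \<gamma> t)) has_vector_derivative - \<Gamma> c (fst (st c \<gamma> t)) (snd (st c \<gamma> t)) (snd (st c \<gamma> t))) (at t)"
    using bounded_linear.has_vector_derivative[OF bounded_linear_snd d] by (simp add: spray_def)
  show "(snd c \<circ> \<gamma> has_vector_derivative snd (st c \<gamma> t)) (at t)"
    using 1 by (simp add: st_def o_def)
  show "isCont (st c \<gamma>) t"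
    using d has_vector_derivative_continuous by blast
qed

lemma fst_st [simp]: "fst (st c \<gamma> t) = snd c (\<gamma> t)"
  by (simp add: st_def)

lemma st_phase: "\<gamma> t \<in> fst c \<Longrightarrow> st c \<gamma> t \<in> phase c"
  by (simp add: st_def)

lemma velocity_st: "velocity M \<gamma> t = snd (st (chart_at M (\<gamma> t)) \<gamma> t)"
  by (simp add: velocity_def st_def)

lemma st_change:
  assumes g: "geodesic_line M \<gamma>" and c: "c \<in> atlas M" "d \<in> atlas M" and t: "\<gamma> t \<in> fst c" "\<gamma> t \<in> fst d"
  shows "snd (st d \<gamma> t) = dd (tr c d) (snd c (\<gamma> t)) (snd (st c \<gamma> t))"
proof -
  have "(snd d \<circ> \<gamma> has_vector_derivative dd (tr c d) (snd c (\<gamma> t)) (snd (st c \<gamma> t))) (at t)"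
    using c t st_parts(3)[OF g c(1) t(1)] geodesic_cont[OF g]
    by (intro chart_change_vector_derivative) (auto simp: continuous_on_eq_continuous_at)
  then show ?thesis
    using st_parts(3)[OF g c(2) t(2)] by (rule vector_derivative_unique_at[rotated])
qed

lemma st_velocity:
  assumes "geodesic_line M \<gamma>" "c \<in> atlas M" "\<gamma> t \<in> fst c"
  shows "snd (st c \<gamma> t) = dd (tr (chart_at M (\<gamma> t)) c) (snd (chart_at M (\<gamma> t)) (\<gamma> t)) (velocity M \<gamma> t)"
    "velocity M \<gamma> t = dd (tr c (chart_at M (\<gamma> t))) (snd c (\<gamma> t)) (snd (st c \<gamma> t))"
  using st_change[OF assms(1) chart_at(1) assms(2) chart_at(2) assms(3)]
    st_change[OF assms(1,2) chart_at(1) assms(3) chart_at(2)] by (auto simp: velocity_st)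

lemma st_eq_iff:
  assumes "geodesic_line M \<gamma>" "geodesic_line M \<sigma>" "c \<in> atlas M" "\<gamma> t \<in> fst c" "\<sigma> t \<in> fst c"
  shows "st c \<gamma> t = st c \<sigma> t \<longleftrightarrow> \<gamma> t = \<sigma> t \<and> velocity M \<gamma> t = velocity M \<sigma> t"
proof
  assume eq: "st c \<gamma> t = st c \<sigma> t"
  then have "snd c (\<gamma> t) = snd c (\<sigma> t)"
    by (simp add: st_def)
  then have "\<gamma> t = \<sigma> t"
    using assms by (metis chart_inv_snd)
  moreover have "velocity M \<gamma> t = velocity M \<sigma> t"
    using st_velocity(2)[OF assms(1,3,4)] st_velocity(2)[OF assms(2,3,5)] eq calculation by simp
  ultimately show "\<gamma> t = \<sigma> t \<and> velocity M \<gamma> t = velocity M \<sigma> t" ..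
next
  assume "\<gamma> t = \<sigma> t \<and> velocity M \<gamma> t = velocity M \<sigma> t"
  then have "snd (st c \<gamma> t) = snd (st c \<sigma> t)" "fst (st c \<gamma> t) = fst (st c \<sigma> t)"
    using st_velocity(1)[OF assms(1,3,4)] st_velocity(1)[OF assms(2,3,5)] by simp_all
  then show "st c \<gamma> t = st c \<sigma> t"
    by (rule prod_eqI[rotated])
qed

text \<open>The radius is written 2 \<rho> so that curves started within \<rho> of z have room to
  move.\<close>

lemma phase_box:
  assumes c: "c \<in> atlas M" and z: "z \<in> phase c"
  obtains \<rho> L where "\<rho> > 0" "cball z (2 * \<rho>) \<subseteq> phase c" "L \<ge> 0"
    "\<And>x. x \<in> cball z (2 * \<rho>) \<Longrightarrow> norm (Blinfun (dd (spray c) x)) \<le> L"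
    "\<And>x y. x \<in> cball z (2 * \<rho>) \<Longrightarrow> y \<in> cball z (2 * \<rho>) \<Longrightarrow> norm (spray c x - spray c y) \<le> L * norm (x - y)"
proof -
  obtain r where r: "r > 0" "cball z r \<subseteq> phase c"
    using open_phase[OF c] z open_contains_cball by blast
  obtain L where "L \<ge> 0" "\<And>x. x \<in> cball z r \<Longrightarrow> norm (Blinfun (dd (spray c) x)) \<le> L"
    "\<And>x y. x \<in> cball z r \<Longrightarrow> y \<in> cball z r \<Longrightarrow> norm (spray c x - spray c y) \<le> L * norm (x - y)"
    using C1_on_compact_lipschitz[OF spray_C1[OF c] compact_cball convex_cball r(2)] by metis
  with r show thesis
    by (intro that[of "r / 2" L]) auto
qed

text \<open>In one chart both phases solve the same Lipschitz system with equal values at t, so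
  \<open>short_gronwall\<close> with r = 0 makes them equal on both sides of t.\<close>

lemma geodesic_unique_local:
  assumes g: "geodesic_line M \<gamma>" "geodesic_line M \<sigma>"
    and eq: "\<gamma> t = \<sigma> t" "velocity M \<gamma> t = velocity M \<sigma> t"
  shows "\<exists>\<epsilon>>0. \<forall>s. \<bar>s - t\<bar> < \<epsilon> \<longrightarrow> \<gamma> s = \<sigma> s \<and> velocity M \<gamma> s = velocity M \<sigma> s"
proof -
  define c where "c = chart_at M (\<gamma> t)"
  have c: "c \<in> atlas M" "\<gamma> t \<in> fst c" "\<sigma> t \<in> fst c"
    using chart_at eq by (auto simp: c_def)
  have steq: "st c \<gamma> t = st c \<sigma> t"
    using st_eq_iff[OF g c] eq by simp
  define z where "z = st c \<gamma> t"
  obtain \<rho> L where \<rho>: "\<rho> > 0" "cball z (2 * \<rho>) \<subseteq> phase c" "L \<ge> 0"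
    and lip: "\<And>x y. x \<in> cball z (2 * \<rho>) \<Longrightarrow> y \<in> cball z (2 * \<rho>) \<Longrightarrow> norm (spray c x - spray c y) \<le> L * norm (x - y)"
    using phase_box[OF c(1) st_phase[of \<gamma> t, OF c(2)]] unfolding z_def by metis
  have ev: "\<forall>\<^sub>F s in nhds t. \<alpha> s \<in> fst c \<and> st c \<alpha> s \<in> cball z (2 * \<rho>)"
    if "geodesic_line M \<alpha>" "\<alpha> t \<in> fst c" "st c \<alpha> t = z" for \<alpha>
  proof (rule eventually_conj)
    show "\<forall>\<^sub>F s in nhds t. \<alpha> s \<in> fst c"
      using geodesic_open[OF that(1) chart_homeo(2)[OF c(1)]] that(2) by (simp add: eventually_nhds) blast
    have "(st c \<alpha> \<longlongrightarrow> z) (nhds t)"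
      using st_parts(4)[OF that(1) c(1) that(2)] that(3) by (metis isCont_def tendsto_at_iff_tendsto_nhds)
    then have "\<forall>\<^sub>F s in nhds t. st c \<alpha> s \<in> ball z (2 * \<rho>)"
      by (rule topological_tendstoD) (use \<rho>(1) in auto)
    then show "\<forall>\<^sub>F s in nhds t. st c \<alpha> s \<in> cball z (2 * \<rho>)"
      by eventually_elim auto
  qed
  have "\<forall>\<^sub>F s in nhds t. (\<gamma> s \<in> fst c \<and> st c \<gamma> s \<in> cball z (2 * \<rho>)) \<and> (\<sigma> s \<in> fst c \<and> st c \<sigma> s \<in> cball z (2 * \<rho>))"
    by (intro eventually_conj ev g c) (simp_all add: z_def steq)
  then obtain \<delta> where \<delta>: "\<delta> > 0" "\<And>s. \<bar>s - t\<bar> < \<delta> \<Longrightarrow> (\<gamma> s \<in> fst c \<and> st c \<gamma> s \<in> cball z (2 * \<rho>)) \<and> (\<sigma> s \<in> fst c \<and> st c \<sigma> s \<in> cball z (2 * \<rho>))"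
    unfolding eventually_nhds_metric dist_real_def by blast
  \<comment> \<open>Half of \<delta> keeps the closed interval inside the window; the second entry
    makes L times the length 2 \<epsilon> of the interval at most 1/2.\<close>
  define \<epsilon> where "\<epsilon> = min (\<delta> / 2) (1 / (4 * (L + 1)))"
  have \<epsilon>: "\<epsilon> > 0" "\<epsilon> < \<delta>" "L * (2 * \<epsilon>) \<le> 1 / 2"
  proof -
    show "\<epsilon> > 0" "\<epsilon> < \<delta>"
      using \<delta>(1) \<rho>(3) by (auto simp: \<epsilon>_def)
    have "L * (2 * \<epsilon>) \<le> (L + 1) * (2 * (1 / (4 * (L + 1))))"
      using \<rho>(3) \<open>\<epsilon> > 0\<close> by (intro mult_mono) (auto simp: \<epsilon>_def)
    also have "\<dots> = 1 / 2"
      using \<rho>(3) by (simp add: field_simps)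
    finally show "L * (2 * \<epsilon>) \<le> 1 / 2" .
  qed
  have "\<gamma> s = \<sigma> s \<and> velocity M \<gamma> s = velocity M \<sigma> s" if s: "\<bar>s - t\<bar> < \<epsilon>" for s
  proof -
    have in': "\<bar>u - t\<bar> < \<delta>" if "u \<in> {t - \<epsilon>..t + \<epsilon>}" for u
      using that \<epsilon> by auto
    have "norm (st c \<gamma> s - st c \<sigma> s) \<le> 2 * (norm (st c \<gamma> t - st c \<sigma> t) + ((t + \<epsilon>) - (t - \<epsilon>)) * 0)"
    proof (rule short_gronwall[where L = L])
      show "((\<lambda>s. st c \<gamma> s - st c \<sigma> s) has_vector_derivative spray c (st c \<gamma> u) - spray c (st c \<sigma> u)) (at u within {t - \<epsilon>..t + \<epsilon>})"
        if "u \<in> {t - \<epsilon>..t + \<epsilon>}" for u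
        using \<delta>(2)[OF in'[OF that]]
        by (intro has_vector_derivative_diff has_vector_derivative_at_within[OF st_deriv] g c(1)) auto
      show "norm (spray c (st c \<gamma> u) - spray c (st c \<sigma> u)) \<le> L * norm (st c \<gamma> u - st c \<sigma> u) + 0"
        if "u \<in> {t - \<epsilon>..t + \<epsilon>}" for u
        using lip \<delta>(2)[OF in'[OF that]] by auto
    qed (use \<epsilon> \<rho> s in auto)
    then have "st c \<gamma> s = st c \<sigma> s"
      using steq by simp
    then show ?thesis
      using st_eq_iff[OF g c(1)] \<delta>(2)[of s] s \<epsilon> by auto
  qed
  with \<epsilon>(1) show ?thesis by blast
qed

text \<open>The set of times at which position and velocity agree is open by local uniqueness,
  closed by continuity of the phases, and nonempty.\<close>

lemma geodesic_unique:
  assumes g: "geodesic_line M \<gamma>" "geodesic_line M \<sigma>"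
    and eq: "\<gamma> t = \<sigma> t" "velocity M \<gamma> t = velocity M \<sigma> t"
  shows "\<gamma> = \<sigma>"
proof -
  define A where "A = {t. \<gamma> t = \<sigma> t \<and> velocity M \<gamma> t = velocity M \<sigma> t}"
  have "open A"
    unfolding open_dist A_def dist_real_def using geodesic_unique_local[OF g] by blast
  moreover have "open (- A)"
  proof (subst open_subopen, intro ballI)
    fix t assume t: "t \<in> - A"
    show "\<exists>T. open T \<and> t \<in> T \<and> T \<subseteq> - A"
    proof (cases "\<gamma> t = \<sigma> t")
      case False
      have "open {t. \<gamma> t \<noteq> \<sigma> t}"
        using g by (intro open_Collect_neq geodesic_cont)
      with False show ?thesis
        by (intro exI[of _ "{t. \<gamma> t \<noteq> \<sigma> t}"]) (auto simp: A_def)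
    next
      case True
      \<comment> \<open>Equal positions but different velocities: since the chart behind
        \<open>velocity\<close> changes from point to point, the difference is followed in one fixed
        chart.\<close>
      define c where "c = chart_at M (\<gamma> t)"
      have c: "c \<in> atlas M" "\<gamma> t \<in> fst c" "\<sigma> t \<in> fst c"
        using chart_at True by (auto simp: c_def)
      have ne: "st c \<gamma> t \<noteq> st c \<sigma> t"
        using st_eq_iff[OF g c] t by (auto simp: A_def)
      have "\<forall>\<^sub>F s in nhds t. st c \<gamma> s - st c \<sigma> s \<in> - {0}"
      proof (rule topological_tendstoD[of _ "st c \<gamma> t - st c \<sigma> t"])
        show "((\<lambda>s. st c \<gamma> s - st c \<sigma> s) \<longlongrightarrow> st c \<gamma> t - st c \<sigma> t) (nhds t)"
          using st_parts(4)[OF g(1) c(1,2)] st_parts(4)[OF g(2) c(1,3)]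
          by (intro tendsto_diff) (simp_all add: isCont_def tendsto_at_iff_tendsto_nhds)
      qed (use ne in auto)
      moreover have "\<forall>\<^sub>F s in nhds t. \<gamma> s \<in> fst c" "\<forall>\<^sub>F s in nhds t. \<sigma> s \<in> fst c"
        using geodesic_open[OF g(1) chart_homeo(2)[OF c(1)]] geodesic_open[OF g(2) chart_homeo(2)[OF c(1)]] c
        by (auto simp: eventually_nhds)
      ultimately have "\<forall>\<^sub>F s in nhds t. s \<in> - A"
        by eventually_elim (use st_eq_iff[OF g c(1)] in \<open>auto simp: A_def\<close>)
      then show ?thesis
        by (auto simp: eventually_nhds)
    qed
  qed
  then have "closed A"
    by (simp add: closed_def)
  ultimately have "A = {} \<or> A = UNIV"
    using connected_UNIV connected_clopen by (metis connected_UNIV closedin_closed_subtopology subtopology_UNIV open_openin closed_closedin)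
  moreover have "t \<in> A"
    using eq by (simp add: A_def)
  ultimately show ?thesis
    by (auto simp: A_def fun_eq_iff)
qed

text \<open>Any real r is allowed: r = -1 and s = 1 reverse a geodesic, r = 0 gives constant
  curves.\<close>

lemma geodesic_affine:
  assumes g: "geodesic_line M \<gamma>"
  shows "geodesic_line M (\<lambda>t. \<gamma> (r * t + s))"
    and "velocity M (\<lambda>t. \<gamma> (r * t + s)) t = r *\<^sub>R velocity M \<gamma> (r * t + s)"
proof -
  have aff: "((\<lambda>t. r * t + s) has_vector_derivative r) (at t)" for t
    by (auto intro!: derivative_eq_intros simp: has_real_derivative_iff_has_vector_derivative[symmetric])
  have d1: "(snd c \<circ> (\<lambda>t. \<gamma> (r * t + s)) has_vector_derivative r *\<^sub>R snd (st c \<gamma> (r * t + s))) (at t)"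
    if c: "c \<in> atlas M" "\<gamma> (r * t + s) \<in> fst c" for c t
    using vector_diff_chain_at[OF aff[of t] st_parts(3)[OF g c]] by (simp add: o_def)
  have d2: "((\<lambda>t. r *\<^sub>R snd (st c \<gamma> (r * t + s))) has_vector_derivative
      - \<Gamma> c (snd c (\<gamma> (r * t + s))) (r *\<^sub>R snd (st c \<gamma> (r * t + s))) (r *\<^sub>R snd (st c \<gamma> (r * t + s)))) (at t)"
    if c: "c \<in> atlas M" "\<gamma> (r * t + s) \<in> fst c" for c t
    using has_vector_derivative_scaleR[OF DERIV_const, OF vector_diff_chain_at[OF aff[of t] st_parts(2)[OF g c]], of r]
    by (simp add: o_def christoffel_linear_simps[OF c(1) snd_in[OF c(2)]])
  show "geodesic_line M (\<lambda>t. \<gamma> (r * t + s))"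
    unfolding geodesic_line_def
  proof (intro conjI ballI)
    show "continuous_on UNIV (\<lambda>t. \<gamma> (r * t + s))"
      by (rule continuous_on_compose2[OF geodesic_cont[OF g]]) (auto intro!: continuous_intros)
    show "\<exists>\<gamma>'. \<forall>t. \<gamma> (r * t + s) \<in> fst c \<longrightarrow>
        (snd c \<circ> (\<lambda>t. \<gamma> (r * t + s)) has_vector_derivative \<gamma>' t) (at t) \<and>
        (\<gamma>' has_vector_derivative - \<Gamma> c (snd c (\<gamma> (r * t + s))) (\<gamma>' t) (\<gamma>' t)) (at t)" if "c \<in> atlas M" for c
      using d1[OF that] d2[OF that] by (intro exI[of _ "\<lambda>t. r *\<^sub>R snd (st c \<gamma> (r * t + s))"]) blast
  qed
  show "velocity M (\<lambda>t. \<gamma> (r * t + s)) t = r *\<^sub>R velocity M \<gamma> (r * t + s)"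
    using vector_derivative_at[OF d1[OF chart_at(1) chart_at(2)]] by (simp add: velocity_def st_def)
qed

text \<open>The velocity has vanishing covariant derivative along \<gamma>, so by
  \<open>covariant_product_rule\<close> its squared length has derivative 0.\<close>

lemma geodesic_speed:
  assumes g: "geodesic_line M \<gamma>"
  shows "tnorm M (\<gamma> t) (velocity M \<gamma> t) = tnorm M (\<gamma> 0) (velocity M \<gamma> 0)"
proof -
  define n where "n t = metric M (\<gamma> t) (velocity M \<gamma> t) (velocity M \<gamma> t)" for t
  have n: "n t = gm c (fst (st c \<gamma> t)) (snd (st c \<gamma> t)) (snd (st c \<gamma> t))"
    if "c \<in> atlas M" "\<gamma> t \<in> fst c" for c t
    using gm_change[OF that(1) chart_at(1) that(2) chart_at(2)] st_velocity(2)[OF g that]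
    by (simp add: n_def gm_chart_at)
  have "(n has_real_derivative 0) (at t)" for t
  proof -
    define c where "c = chart_at M (\<gamma> t)"
    have c: "c \<in> atlas M" "\<gamma> t \<in> fst c"
      using chart_at by (auto simp: c_def)
    have "((\<lambda>t. gm c (fst (st c \<gamma> t)) (snd (st c \<gamma> t)) (snd (st c \<gamma> t))) has_vector_derivative 0) (at t)"
      using covariant_product_rule[OF c(1) st_parts(1)[OF g c] _ st_parts(2)[OF g c] st_parts(2)[OF g c]]
        linear_0[OF gm_linear(1)[OF c(1) snd_in[OF c(2)]]] linear_0[OF gm_linear(2)[OF c(1) snd_in[OF c(2)]]] c(2)
      by simp
    then have "(n has_vector_derivative 0) (at t)"
      by (rule has_vector_derivative_transform_within_open[OF _ geodesic_open[OF g chart_homeo(2)[OF c(1)]]])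
         (use c n in auto)
    then show ?thesis
      by (simp add: has_real_derivative_iff_has_vector_derivative)
  qed
  then have "n t = n 0"
    using DERIV_isconst_all by blast
  then show ?thesis
    by (simp add: n_def tnorm_def)
qed

end

section \<open>The exponential map and Jacobi fields\<close>

text \<open>Real induction: the compact set of bad times would have a least element, and the
  hypothesis \<open>step\<close> excludes it.\<close>

lemma first_exit:
  fixes P :: "real \<Rightarrow> bool"
  assumes op: "open {t. P t}" and "P t0" "t0 \<le> t1"
    and step: "\<And>s. t0 < s \<Longrightarrow> s \<le> t1 \<Longrightarrow> (\<And>u. t0 \<le> u \<Longrightarrow> u < s \<Longrightarrow> P u) \<Longrightarrow> P s"
  shows "P t1"
proof (rule ccontr)
  assume n: "\<not> P t1"
  let ?B = "{t0..t1} - {t. P t}"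
  have "compact ?B"
    using op by (intro compact_diff) auto
  moreover have "?B \<noteq> {}"
    using n assms(3) by auto
  ultimately obtain s where s: "s \<in> ?B" "\<And>u. u \<in> ?B \<Longrightarrow> s \<le> u"
    using compact_attains_inf by meson
  have "P u" if "t0 \<le> u" "u < s" for u
    using s(2)[of u] s(1) that by force
  moreover have "t0 < s"
    using s(1) \<open>P t0\<close> by (cases "s = t0") auto
  ultimately show False
    using step[of s] s(1) by auto
qed

locale complete_mfd = riemannian_mfd M
  for M :: "('m::{t2_space,second_countable_topology}, 'e::euclidean_space) riemannian" +
  assumes complete: "complete_manifold M"
begin

definition geo :: "'m \<Rightarrow> 'e \<Rightarrow> real \<Rightarrow> 'm" where
  "geo p v = (THE \<gamma>. geodesic_line M \<gamma> \<and> \<gamma> 0 = p \<and> velocity M \<gamma> 0 = v)"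

lemma geo: "geodesic_line M (geo p v)" "geo p v 0 = p" "velocity M (geo p v) 0 = v"
proof -
  have "\<exists>!\<gamma>. geodesic_line M \<gamma> \<and> \<gamma> 0 = p \<and> velocity M \<gamma> 0 = v"
    using complete geodesic_unique unfolding complete_manifold_def by metis
  from theI'[OF this] show "geodesic_line M (geo p v)" "geo p v 0 = p" "velocity M (geo p v) 0 = v"
    unfolding geo_def by blast+
qed

lemma geo_unique: "geodesic_line M \<gamma> \<Longrightarrow> \<gamma> 0 = p \<Longrightarrow> velocity M \<gamma> 0 = v \<Longrightarrow> \<gamma> = geo p v"
  using geodesic_unique[of \<gamma> "geo p v" 0] geo by simp

lemma geo_scale: "geo p (r *\<^sub>R v) t = geo p v (r * t)"
proof -
  have "(\<lambda>t. geo p v (r * t + 0)) = geo p (r *\<^sub>R v)"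
    using geodesic_affine[OF geo(1), of p v r 0] geo by (intro geo_unique) auto
  then show ?thesis
    by (metis add.right_neutral)
qed

lemma rexp_geo: "rexp M p v = geo p v 1"
  by (simp add: rexp_def geo_def)

lemma rexp_scale: "rexp M p (t *\<^sub>R v) = geo p v t"
  by (simp add: rexp_geo geo_scale)

lemma open_st_ball:
  assumes g: "geodesic_line M \<gamma>" and c: "c \<in> atlas M"
  shows "open {s. \<gamma> s \<in> fst c \<and> st c \<gamma> s \<in> ball z r}"
proof -
  have o: "open {s. \<gamma> s \<in> fst c}"
    by (rule geodesic_open[OF g chart_homeo(2)[OF c]])
  have "continuous_on {s. \<gamma> s \<in> fst c} (st c \<gamma>)"
    using st_parts(4)[OF g c] by (simp add: continuous_at_imp_continuous_on)
  then have "open ({s. \<gamma> s \<in> fst c} \<inter> st c \<gamma> -` ball z r)"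
    by (rule continuous_open_preimage) (use o in auto)
  then show ?thesis
    by (simp add: vimage_def Int_def)
qed

text \<open>Lets a flow box around the phase at time t be entered slightly before t, so that t
  becomes interior to the time interval of the box.\<close>

lemma st_near_left:
  assumes g: "geodesic_line M \<gamma>" and c: "c \<in> atlas M" "\<gamma> t \<in> fst c" and "\<rho> > 0" "e > 0"
  obtains s where "t - e < s" "s < t" "\<gamma> s \<in> fst c" "st c \<gamma> s \<in> ball (st c \<gamma> t) \<rho>"
proof -
  let ?S = "{s. \<gamma> s \<in> fst c \<and> st c \<gamma> s \<in> ball (st c \<gamma> t) \<rho>}"
  have "t \<in> ?S"
    using assms by simp
  then obtain \<delta> where "\<delta> > 0" "ball t \<delta> \<subseteq> ?S"
    using open_st_ball[OF g c(1)] open_contains_ball by blast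
  moreover from this have "t - min \<delta> e / 2 \<in> ball t \<delta>"
    using \<open>e > 0\<close> by (auto simp: dist_real_def)
  moreover have "t - e < t - min \<delta> e / 2" "t - min \<delta> e / 2 < t"
    using \<open>e > 0\<close> \<open>\<delta> > 0\<close> by (auto simp: min_def)
  ultimately show thesis
    using that[of "t - min \<delta> e / 2"] by blast
qed

text \<open>The time \<epsilon> is uniform over all geodesics that start in the smaller ball: their
  phase has speed at most B and so moves by at most \<rho>/2. The difficulty is that the phase is
  meaningful only while the geodesic is in the chart, so staying in the chart and staying in the
  ball have to be proved together.\<close>

lemma flow_box:
  assumes c: "c \<in> atlas M" and z: "z \<in> phase c"
  obtains \<rho> L \<epsilon> where "\<rho> > 0" "cball z (2 * \<rho>) \<subseteq> phase c" "L \<ge> 0" "\<epsilon> > 0" "L * \<epsilon> \<le> 1/2"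
    "\<And>x. x \<in> cball z (2 * \<rho>) \<Longrightarrow> norm (Blinfun (dd (spray c) x)) \<le> L"
    "\<And>\<gamma> t0 t. geodesic_line M \<gamma> \<Longrightarrow> \<gamma> t0 \<in> fst c \<Longrightarrow> st c \<gamma> t0 \<in> cball z \<rho> \<Longrightarrow> t \<in> {t0..t0 + \<epsilon>} \<Longrightarrow>
      \<gamma> t \<in> fst c \<and> st c \<gamma> t \<in> cball z (2 * \<rho>)"
proof -
  obtain \<rho> L where \<rho>: "\<rho> > 0" "cball z (2 * \<rho>) \<subseteq> phase c" "L \<ge> 0"
    and L: "\<And>x. x \<in> cball z (2 * \<rho>) \<Longrightarrow> norm (Blinfun (dd (spray c) x)) \<le> L"
    using phase_box[OF c z] by metis
  have "compact (spray c ` cball z (2 * \<rho>))"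
    by (intro compact_continuous_image continuous_on_subset[OF C1_on_cont[OF spray_C1[OF c]]] \<rho> compact_cball)
  from compact_imp_bounded[OF this]
  obtain B where B: "B > 0" "\<And>x. x \<in> cball z (2 * \<rho>) \<Longrightarrow> norm (spray c x) \<le> B"
    unfolding bounded_pos by auto
  \<comment> \<open>The first entry serves \<open>short_gronwall\<close>, the second limits the
    displacement of the phase to \<rho>/2.\<close>
  define \<epsilon> where "\<epsilon> = min (1 / (2 * (L + 1))) (\<rho> / (2 * B))"
  have \<epsilon>: "\<epsilon> > 0" "B * \<epsilon> \<le> \<rho> / 2"
  proof -
    show "\<epsilon> > 0"
      using \<rho> B by (auto simp: \<epsilon>_def)
    have "B * \<epsilon> \<le> B * (\<rho> / (2 * B))"
      using B by (intro mult_left_mono) (auto simp: \<epsilon>_def)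
    then show "B * \<epsilon> \<le> \<rho> / 2"
      using B by simp
  qed
  have "L * \<epsilon> \<le> (L + 1) * (1 / (2 * (L + 1)))"
    using \<rho>(3) \<epsilon>(1) by (intro mult_mono) (auto simp: \<epsilon>_def)
  also have "\<dots> = 1 / 2"
    using \<rho>(3) by (simp add: field_simps)
  finally have L\<epsilon>: "L * \<epsilon> \<le> 1 / 2" .
  have stay: "\<gamma> t \<in> fst c \<and> st c \<gamma> t \<in> cball z (2 * \<rho>)"
    if g: "geodesic_line M \<gamma>" and t0: "\<gamma> t0 \<in> fst c" "st c \<gamma> t0 \<in> cball z \<rho>" and t: "t \<in> {t0..t0 + \<epsilon>}"
    for \<gamma> t0 t
  proof -
    define P where "P s \<longleftrightarrow> \<gamma> s \<in> fst c \<and> st c \<gamma> s \<in> ball z (2 * \<rho>)" for s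
    have "P t"
    proof (rule first_exit[of P t0 t])
      show "open {s. P s}"
        unfolding P_def by (rule open_st_ball[OF g c])
      show "P t0"
        using t0 \<rho>(1) by (auto simp: P_def)
      show "t0 \<le> t"
        using t by simp
      fix s assume s: "t0 < s" "s \<le> t" and Pu: "\<And>u. t0 \<le> u \<Longrightarrow> u < s \<Longrightarrow> P u"
      \<comment> \<open>3/2 \<rho> lies strictly below 2 \<rho>: the closed bound survives the limit
        u -> s and still implies the open condition P.\<close>
      have near: "st c \<gamma> u \<in> cball z (3/2 * \<rho>)" if u: "t0 \<le> u" "u < s" for u
      proof -
        have "norm (st c \<gamma> u - st c \<gamma> t0) \<le> B * norm (u - t0)"
        proof (rule differentiable_bound[of "{t0..u}" _ "\<lambda>r h. h *\<^sub>R spray c (st c \<gamma> r)"])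
          show "(st c \<gamma> has_derivative (\<lambda>h. h *\<^sub>R spray c (st c \<gamma> r))) (at r within {t0..u})" if "r \<in> {t0..u}" for r
            using st_deriv[OF g c, of r] Pu[of r] that u
            by (auto simp: has_vector_derivative_def P_def intro: has_derivative_at_withinI)
          show "onorm (\<lambda>h. h *\<^sub>R spray c (st c \<gamma> r)) \<le> B" if "r \<in> {t0..u}" for r
            using Pu[of r] that u by (intro order_trans[OF onorm_scaleR_vec_le B(2)]) (auto simp: P_def)
        qed (use u in auto)
        also have "\<dots> \<le> B * \<epsilon>"
          using u s t B by (intro mult_left_mono) auto
        finally have "dist (st c \<gamma> u) (st c \<gamma> t0) \<le> \<rho> / 2"
          using \<epsilon>(2) by (simp add: dist_norm)
        then show ?thesis
          using t0(2) dist_triangle[of z "st c \<gamma> u" "st c \<gamma> t0"] by (simp add: dist_commute)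
      qed
      \<comment> \<open>All positions before time s lie in this compact subset of the chart domain,
        so the position at time s does too, and the geodesic cannot leave the chart at s.\<close>
      let ?Q = "chart_inv c ` fst ` cball z (3/2 * \<rho>)"
      have sub: "cball z (3/2 * \<rho>) \<subseteq> cball z (2 * \<rho>)"
        using \<rho>(1) by (intro subset_cball) auto
      then have im: "fst ` cball z (3/2 * \<rho>) \<subseteq> chart_image c"
        using \<rho>(2) by auto
      have "compact ?Q"
        by (intro compact_continuous_image continuous_on_subset[OF chart_inv_cont[OF c] im] continuous_intros compact_cball)
      then have cQ: "closed ?Q"
        by (rule compact_imp_closed)
      have "\<gamma> ` {t0..<s} \<subseteq> ?Q"
      proof clarify
        fix u assume u: "u \<in> {t0..<s}"
        then have "\<gamma> u = chart_inv c (fst (st c \<gamma> u))"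
          using Pu[of u] c by (simp add: P_def)
        then show "\<gamma> u \<in> ?Q"
          using near[of u] u by (metis atLeastLessThan_iff imageI)
      qed
      then have "\<gamma> ` closure {t0..<s} \<subseteq> ?Q"
        by (intro image_closure_subset cQ continuous_on_subset[OF geodesic_cont[OF g]]) auto
      then have "\<gamma> s \<in> ?Q"
        using s by auto
      then have sc: "\<gamma> s \<in> fst c"
        using im c by auto
      have "st c \<gamma> ` closure {t0..<s} \<subseteq> cball z (3/2 * \<rho>)"
      proof (rule image_closure_subset)
        have "isCont (st c \<gamma>) u" if "u \<in> {t0..s}" for u
          using st_parts(4)[OF g c, of u] sc Pu[of u] that by (cases "u = s") (auto simp: P_def)
        then show "continuous_on (closure {t0..<s}) (st c \<gamma>)"
          using s by (simp add: continuous_at_imp_continuous_on)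
      qed (use near in auto)
      moreover have "s \<in> closure {t0..<s}"
        using s by simp
      ultimately have "st c \<gamma> s \<in> cball z (3/2 * \<rho>)"
        by blast
      then show "P s"
        using sc \<rho>(1) by (auto simp: P_def)
    qed
    then show ?thesis
      by (simp add: P_def)
  qed
  show thesis
    by (rule that[OF \<rho> \<epsilon>(1) L\<epsilon> L stay])
qed

section \<open>Differentiable dependence on the initial velocity\<close>

context
  fixes q :: 'm
begin

definition C1_near :: "('m, 'e) chart \<Rightarrow> 'e \<Rightarrow> real \<Rightarrow> bool" where
  "C1_near c a t \<longleftrightarrow> (\<exists>U. open U \<and> a \<in> U \<and> (\<forall>b\<in>U. geo q b t \<in> fst c) \<and> C1_on U (\<lambda>b. st c (geo q b) t))"

text \<open>The position changes by the transition map and the velocity by its differential. Both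
  are C1, since transition maps are smooth.\<close>

lemma C1_near_change:
  assumes c: "c \<in> atlas M" "d \<in> atlas M" and n: "C1_near c a t" and t: "geo q a t \<in> fst d"
  shows "C1_near d a t"
proof -
  obtain U where U: "open U" "a \<in> U" "\<And>b. b \<in> U \<Longrightarrow> geo q b t \<in> fst c" "C1_on U (\<lambda>b. st c (geo q b) t)"
    using n unfolding C1_near_def by blast
  let ?s = "\<lambda>b. st c (geo q b) t"
  let ?U = "U \<inter> (\<lambda>b. snd c (geo q b t)) -` tr_dom c d"
  have cf: "C1_on U (\<lambda>b. snd c (geo q b t))"
    using C1_on_linear_comp[OF linear_fst U(4)] by simp
  have cs: "C1_on U (\<lambda>b. snd (?s b))"
    using C1_on_linear_comp[OF linear_snd U(4)] by simp
  have o: "open ?U"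
    by (rule continuous_open_preimage[OF C1_on_cont[OF cf] U(1) open_tr_dom[OF c]])
  have in': "geo q b t \<in> fst c" "geo q b t \<in> fst d" if "b \<in> ?U" for b
    using that U(3)[of b] tr_dom_iff[OF c(1)] c by auto
  have sub: "C1_on ?U (\<lambda>b. snd c (geo q b t))" "C1_on ?U (\<lambda>b. snd (?s b))"
    using cf cs o by (auto intro: C1_on_subset)
  have im: "(\<lambda>b. snd c (geo q b t)) ` ?U \<subseteq> tr_dom c d"
    by auto
  have "C1_on ?U (\<lambda>b. (tr c d (snd c (geo q b t)), dd (tr c d) (snd c (geo q b t)) (snd (?s b))))"
  proof (rule C1_on_Pair[OF _ C1_on_blinear_apply[where f = "\<lambda>b. dd (tr c d) (snd c (geo q b t))", OF _ _ sub(2)]])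
    show "C1_on ?U (\<lambda>b. tr c d (snd c (geo q b t)))"
      by (rule C1_on_compose(1)[OF tr_C1(1)[OF c] sub(1) im])
    show "C1_on ?U (\<lambda>b. dd (tr c d) (snd c (geo q b t)) u)" for u
      by (rule C1_on_compose(1)[OF tr_C1(2)[OF c] sub(1) im])
    show "linear (dd (tr c d) (snd c (geo q b t)))" if "b \<in> ?U" for b
      by (rule linear_dd_tr[OF c in'[OF that]])
  qed
  moreover have "(tr c d (snd c (geo q b t)), dd (tr c d) (snd c (geo q b t)) (snd (?s b))) = st d (geo q b) t"
    if "b \<in> ?U" for b
    using st_change[OF geo(1) c in'[OF that]] in'[OF that] c by (intro prod_eqI) simp_all
  ultimately have "C1_on ?U (\<lambda>b. st d (geo q b) t)"
    by (rule C1_on_cong[rotated])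
  moreover have "a \<in> ?U"
    using U(2,3) t by (auto intro: in_tr_dom)
  ultimately show ?thesis
    unfolding C1_near_def using o in' by blast
qed

lemma st_geo_0:
  assumes "c \<in> atlas M" "q \<in> fst c"
  shows "st c (geo q b) 0 = (snd c q, dd (tr (chart_at M q) c) (snd (chart_at M q) q) b)"
  using st_velocity(1)[OF geo(1) assms(1), of q b 0] assms geo(2,3) by (intro prod_eqI) simp_all

lemma C1_near_0:
  assumes c: "c \<in> atlas M" "q \<in> fst c"
  shows "C1_near c a 0"
proof -
  have "C1_on UNIV (\<lambda>b. (snd c q, dd (tr (chart_at M q) c) (snd (chart_at M q) q) b))"
    by (intro C1_on_Pair C1_on_const C1_on_linear linear_dd_tr chart_at c open_UNIV)
  then show ?thesis
    unfolding C1_near_def using c by (intro exI[of _ UNIV]) (simp add: st_geo_0 geo(2))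
qed

text \<open>The neighbourhood U is common to all times of the interval; the linearised equation is
  recorded for the variation at a.\<close>

definition flow_ok :: "('m, 'e) chart \<Rightarrow> 'e \<Rightarrow> real \<Rightarrow> real \<Rightarrow> bool" where
  "flow_ok c a t0 \<epsilon> \<longleftrightarrow> (\<exists>U. open U \<and> a \<in> U \<and>
     (\<forall>t\<in>{t0..t0 + \<epsilon>}. (\<forall>b\<in>U. geo q b t \<in> fst c) \<and> C1_on U (\<lambda>b. st c (geo q b) t) \<and>
        (\<forall>w. ((\<lambda>s. dd (\<lambda>b. st c (geo q b) s) a w) has_vector_derivative
           dd (spray c) (st c (geo q a) t) (dd (\<lambda>b. st c (geo q b) t) a w)) (at t within {t0..t0 + \<epsilon>}))))"

text \<open>\<rho> and \<epsilon> depend on the box around z and not on a or t0. This uniformity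
  lets the continuation argument pass a limit time.\<close>

lemma flow_step:
  assumes c: "c \<in> atlas M" and z: "z \<in> phase c"
  obtains \<rho> \<epsilon> where "\<rho> > 0" "\<epsilon> > 0"
    "\<And>a t0. C1_near c a t0 \<Longrightarrow> st c (geo q a) t0 \<in> ball z \<rho> \<Longrightarrow> flow_ok c a t0 \<epsilon>"
proof -
  obtain \<rho> L \<epsilon> where \<rho>: "\<rho> > 0" "cball z (2 * \<rho>) \<subseteq> phase c" "L \<ge> 0" "\<epsilon> > 0" "L * \<epsilon> \<le> 1/2"
    and L: "\<And>x. x \<in> cball z (2 * \<rho>) \<Longrightarrow> norm (Blinfun (dd (spray c) x)) \<le> L"
    and stay: "\<And>\<gamma> t0 t. geodesic_line M \<gamma> \<Longrightarrow> \<gamma> t0 \<in> fst c \<Longrightarrow> st c \<gamma> t0 \<in> cball z \<rho> \<Longrightarrow> t \<in> {t0..t0 + \<epsilon>} \<Longrightarrow>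
      \<gamma> t \<in> fst c \<and> st c \<gamma> t \<in> cball z (2 * \<rho>)"
    using flow_box[OF c z] by blast
  show thesis
  proof (rule that[OF \<rho>(1,4)])
    fix a t0 assume n: "C1_near c a t0" and a: "st c (geo q a) t0 \<in> ball z \<rho>"
    obtain U where U: "open U" "a \<in> U" "\<And>b. b \<in> U \<Longrightarrow> geo q b t0 \<in> fst c" "C1_on U (\<lambda>b. st c (geo q b) t0)"
      using n unfolding C1_near_def by blast
    let ?U = "U \<inter> (\<lambda>b. st c (geo q b) t0) -` ball z \<rho>"
    have o: "open ?U"
      by (rule continuous_open_preimage[OF C1_on_cont[OF U(4)] U(1) open_ball])
    have st': "geo q b t \<in> fst c" "st c (geo q b) t \<in> cball z (2 * \<rho>)" if "b \<in> ?U" "t \<in> {t0..t0 + \<epsilon>}" for b t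
      using stay[OF geo(1), of q b t0 t] U(3)[of b] that by auto
    have init: "C1_on ?U (\<lambda>b. st c (geo q b) t0)"
      by (rule C1_on_subset[OF U(4) _ o]) auto
    have d: "(st c (geo q b) has_vector_derivative spray c (st c (geo q b) t)) (at t within {t0..t0 + \<epsilon>})"
      if "b \<in> ?U" "t \<in> {t0..t0 + \<epsilon>}" for b t
      by (rule has_vector_derivative_at_within[OF st_deriv[OF geo(1) c st'(1)[OF that]]])
    have le: "t0 \<le> t0 + \<epsilon>" "L * (t0 + \<epsilon> - t0) \<le> 1/2"
      using \<rho> by auto
    have flow: "C1_on ?U (\<lambda>b. st c (geo q b) t)" if "t \<in> {t0..t0 + \<epsilon>}" for t
      by (rule local_flow_C1[where F = "spray c" and z = "\<lambda>b. st c (geo q b)" and K = "cball z (2 * \<rho>)" and L = L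
          and lo = t0 and hi = "t0 + \<epsilon>" and U = ?U and \<Omega> = "phase c"];
          (rule spray_C1[OF c] \<rho>(2,3) compact_cball convex_cball le init that | (rule L st'(2) d; assumption)))
    have var: "((\<lambda>s. dd (\<lambda>b. st c (geo q b) s) b w) has_vector_derivative
           dd (spray c) (st c (geo q b) t) (dd (\<lambda>b. st c (geo q b) t) b w)) (at t within {t0..t0 + \<epsilon>})"
      if "b \<in> ?U" "t \<in> {t0..t0 + \<epsilon>}" for b t w
      by (rule local_flow_variation[where F = "spray c" and z = "\<lambda>b. st c (geo q b)" and K = "cball z (2 * \<rho>)" and L = L
          and lo = t0 and hi = "t0 + \<epsilon>" and U = ?U and \<Omega> = "phase c"];
          (rule spray_C1[OF c] \<rho>(2,3) compact_cball convex_cball le init that | (rule L st'(2) d; assumption)))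
    have aU: "a \<in> ?U"
      using U(2) a by auto
    show "flow_ok c a t0 \<epsilon>"
      unfolding flow_ok_def
    proof (intro exI conjI ballI allI)
      show "geo q b t \<in> fst c" if "t \<in> {t0..t0 + \<epsilon>}" "b \<in> ?U" for b t
        using st'(1)[OF that(2,1)] .
    qed (fact o aU flow var[OF aU])+
  qed
qed

text \<open>Continuation in time: the set of times up to which the dependence is C1 contains 0 and
  has no finite supremum, because a flow box around the phase at the supremum is entered from an
  earlier time and lasts beyond it.\<close>

lemma C1_near_all:
  assumes "0 \<le> T" "c \<in> atlas M" "geo q a T \<in> fst c"
  shows "C1_near c a T"
proof -
  define Q where "Q t \<longleftrightarrow> (\<forall>c\<in>atlas M. geo q a t \<in> fst c \<longrightarrow> C1_near c a t)" for t
  define R where "R = {T. 0 \<le> T \<and> (\<forall>t\<in>{0..T}. Q t)}"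
  have Q1: "Q t" if "C1_near c a t" "c \<in> atlas M" for c t
    using C1_near_change that unfolding Q_def by blast
  have R0: "0 \<in> R"
    unfolding R_def Q_def using C1_near_0 by (simp add: geo(2))
  \<comment> \<open>The box at time T is entered at some t0 with T - \<epsilon> < t0 < T, or at t0 =
    0 if T = 0; in either case its time interval reaches beyond T.\<close>
  have ext: "\<exists>s\<in>R. T < s" if T: "0 \<le> T" and below: "\<And>t. 0 \<le> t \<Longrightarrow> t < T \<Longrightarrow> Q t" for T
  proof -
    define c where "c = chart_at M (geo q a T)"
    have c: "c \<in> atlas M" "geo q a T \<in> fst c"
      using chart_at by (auto simp: c_def)
    obtain \<rho> \<epsilon> where \<rho>: "\<rho> > 0" "\<epsilon> > 0"
      and step: "\<And>a' t0. C1_near c a' t0 \<Longrightarrow> st c (geo q a') t0 \<in> ball (st c (geo q a) T) \<rho> \<Longrightarrow> flow_ok c a' t0 \<epsilon>"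
      using flow_step[OF c(1) st_phase[of "geo q a" T, OF c(2)]] by blast
    obtain t0 where t0: "0 \<le> t0" "t0 \<le> T" "T < t0 + \<epsilon>" "Q t0" "geo q a t0 \<in> fst c"
      "st c (geo q a) t0 \<in> ball (st c (geo q a) T) \<rho>"
    proof (cases "T = 0")
      case True
      then show thesis
        using that[of 0] \<rho> R0 c by (auto simp: R_def)
    next
      case False
      obtain s where "T - min T \<epsilon> < s" "s < T" "geo q a s \<in> fst c" "st c (geo q a) s \<in> ball (st c (geo q a) T) \<rho>"
        using st_near_left[of "geo q a" c T \<rho> "min T \<epsilon>"] geo(1) c \<rho> T False by auto
      then show thesis
        using that[of s] below[of s] by auto
    qed
    have "C1_near c a t0"
      using t0 c by (auto simp: Q_def)
    from step[OF this t0(6)] have near: "C1_near c a t" if "t \<in> {t0..t0 + \<epsilon>}" for t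
      using that unfolding C1_near_def flow_ok_def by blast
    have "t0 + \<epsilon> \<in> R"
      unfolding R_def
    proof (intro CollectI conjI ballI)
      fix t assume t: "t \<in> {0..t0 + \<epsilon>}"
      show "Q t"
      proof (cases "t < t0")
        case True
        then show ?thesis using below[of t] t t0 by auto
      next
        case False
        then show ?thesis using Q1[OF near c(1)] t by auto
      qed
    qed (use t0 \<rho> in auto)
    with t0(3) show ?thesis by blast
  qed
  have "Q T" if T: "0 \<le> T" for T
  proof (rule ccontr)
    assume nQ: "\<not> Q T"
    have bdd: "r < T" if "r \<in> R" for r
      using that nQ T unfolding R_def by (metis (mono_tags, lifting) atLeastAtMost_iff linorder_not_le mem_Collect_eq)
    then have b: "bdd_above R"
      by (meson bdd_aboveI less_imp_le)
    have "Q t" if t: "0 \<le> t" "t < Sup R" for t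
    proof -
      obtain r where "r \<in> R" "t < r"
        using less_cSup_iff[OF _ b, of t] R0 t by blast
      then show ?thesis
        using t by (auto simp: R_def)
    qed
    moreover have "0 \<le> Sup R"
      using cSup_upper[OF R0 b] .
    ultimately obtain s where "s \<in> R" "Sup R < s"
      using ext by blast
    then show False
      using cSup_upper[OF _ b, of s] by simp
  qed
  with assms show ?thesis
    unfolding Q_def by blast
qed

text \<open>The box is started before t, so the derivatives within a closed interval in
  \<open>flow_ok\<close> become two-sided derivatives near t.\<close>

lemma variation:
  assumes t: "t > 0" and c: "c \<in> atlas M" and tc: "geo q a t \<in> fst c"
  obtains \<epsilon> U where "\<epsilon> > 0" "open U" "a \<in> U"
    "\<And>s b. \<bar>s - t\<bar> < \<epsilon> \<Longrightarrow> b \<in> U \<Longrightarrow> geo q b s \<in> fst c"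
    "\<And>s. \<bar>s - t\<bar> < \<epsilon> \<Longrightarrow> C1_on U (\<lambda>b. st c (geo q b) s)"
    "\<And>s w. \<bar>s - t\<bar> < \<epsilon> \<Longrightarrow> ((\<lambda>s. dd (\<lambda>b. st c (geo q b) s) a w) has_vector_derivative
       dd (spray c) (st c (geo q a) s) (dd (\<lambda>b. st c (geo q b) s) a w)) (at s)"
proof -
  obtain \<rho> \<epsilon> where \<rho>: "\<rho> > 0" "\<epsilon> > 0"
    and step: "\<And>a' t0. C1_near c a' t0 \<Longrightarrow> st c (geo q a') t0 \<in> ball (st c (geo q a) t) \<rho> \<Longrightarrow> flow_ok c a' t0 \<epsilon>"
    using flow_step[OF c(1) st_phase[of "geo q a" t, OF tc]] by blast
  have "0 < min t \<epsilon>"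
    using t \<rho> by simp
  then obtain t0 where t0: "geo q a t0 \<in> fst c" "st c (geo q a) t0 \<in> ball (st c (geo q a) t) \<rho>" "t - min t \<epsilon> < t0" "t0 < t"
    using st_near_left[OF geo(1) c tc \<rho>(1)] by blast
  obtain U where U: "open U" "a \<in> U" and
    all: "\<And>s. s \<in> {t0..t0 + \<epsilon>} \<Longrightarrow> (\<forall>b\<in>U. geo q b s \<in> fst c) \<and> C1_on U (\<lambda>b. st c (geo q b) s) \<and>
      (\<forall>w. ((\<lambda>s. dd (\<lambda>b. st c (geo q b) s) a w) has_vector_derivative
         dd (spray c) (st c (geo q a) s) (dd (\<lambda>b. st c (geo q b) s) a w)) (at s within {t0..t0 + \<epsilon>}))"
  proof -
    have "flow_ok c a t0 \<epsilon>"
      using t0 c by (intro step C1_near_all) auto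
    then show thesis
      using that unfolding flow_ok_def by blast
  qed
  define \<delta> where "\<delta> = min (t - t0) (t0 + \<epsilon> - t)"
  have \<delta>: "\<delta> > 0"
    using t0(3,4) by (auto simp: \<delta>_def)
  have in': "s \<in> {t0<..<t0 + \<epsilon>}" if "\<bar>s - t\<bar> < \<delta>" for s
    using that by (auto simp: \<delta>_def)
  show thesis
  proof (rule that[OF \<delta> U])
    fix s w assume s: "\<bar>s - t\<bar> < \<delta>"
    have i: "s \<in> interior {t0..t0 + \<epsilon>}"
      using in'[OF s] by (simp add: interior_atLeastAtMost_real)
    show "((\<lambda>s. dd (\<lambda>b. st c (geo q b) s) a w) has_vector_derivative
       dd (spray c) (st c (geo q a) s) (dd (\<lambda>b. st c (geo q b) s) a w)) (at s)"
      using all[of s] in'[OF s] at_within_interior[OF i] by auto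
  qed (use all in' in fastforce)+
qed

end

end

section \<open>Differentials of C1 maps into the manifold\<close>

context riemannian_mfd
begin

definition dmap :: "('e \<Rightarrow> 'm) \<Rightarrow> 'e \<Rightarrow> 'e \<Rightarrow> 'e" where
  "dmap f a w = dd (snd (chart_at M (f a)) \<circ> f) a w"

text \<open>Continuity is a separate clause because coordinate expressions have arbitrary values
  outside the chart.\<close>

definition C1_map :: "('e \<Rightarrow> 'm) \<Rightarrow> bool" where
  "C1_map f \<longleftrightarrow> continuous_on UNIV f \<and> (\<forall>c\<in>atlas M. C1_on {b. f b \<in> fst c} (\<lambda>b. snd c (f b)))"

lemma dmap_chart:
  assumes c: "c \<in> atlas M" "f a \<in> fst c" and f: "isCont f a" "((\<lambda>b. snd c (f b)) has_derivative f') (at a)"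
  shows "dmap f a w = dd (tr c (chart_at M (f a))) (snd c (f a)) (f' w)"
    and "metric M (f a) (dmap f a w) (dmap f a w') = gm c (snd c (f a)) (f' w) (f' w')"
proof -
  have "(snd (chart_at M (f a)) \<circ> f has_derivative (\<lambda>u. dd (tr c (chart_at M (f a))) (snd c (f a)) (f' u))) (at a)"
    using chart_change_derivative[OF c(1) chart_at(1) c(2) chart_at(2) UNIV_I f(1)] f(2) by (simp add: o_def)
  from dd_eq[OF this]
  show *: "dmap f a w = dd (tr c (chart_at M (f a))) (snd c (f a)) (f' w)" for w
    by (simp add: dmap_def)
  show "metric M (f a) (dmap f a w) (dmap f a w') = gm c (snd c (f a)) (f' w) (f' w')"
    using gm_change[OF c(1) chart_at(1) c(2) chart_at(2)] by (simp add: * gm_chart_at)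
qed

lemma C1_map_isCont: "C1_map f \<Longrightarrow> isCont f a"
  by (simp add: C1_map_def continuous_on_eq_continuous_at)

lemma C1_map_dmap:
  assumes f: "C1_map f" and c: "c \<in> atlas M" "f a \<in> fst c"
  shows "metric M (f a) (dmap f a w) (dmap f a w') = gm c (snd c (f a)) (dd (\<lambda>b. snd c (f b)) a w) (dd (\<lambda>b. snd c (f b)) a w')"
    "dmap f a w = dd (tr c (chart_at M (f a))) (snd c (f a)) (dd (\<lambda>b. snd c (f b)) a w)"
proof -
  have d: "((\<lambda>b. snd c (f b)) has_derivative dd (\<lambda>b. snd c (f b)) a) (at a)"
    by (rule C1_on_deriv[of "{b. f b \<in> fst c}"]) (use f c in \<open>auto simp: C1_map_def\<close>)
  show "metric M (f a) (dmap f a w) (dmap f a w') = gm c (snd c (f a)) (dd (\<lambda>b. snd c (f b)) a w) (dd (\<lambda>b. snd c (f b)) a w')"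
    "dmap f a w = dd (tr c (chart_at M (f a))) (snd c (f a)) (dd (\<lambda>b. snd c (f b)) a w)"
    using dmap_chart[OF c(1), of f a] c(2) C1_map_isCont[OF f] d by blast+
qed

lemma gm_tendsto:
  assumes c: "c \<in> atlas M" "a \<in> chart_image c" and "(x \<longlongrightarrow> a) F" "(u \<longlongrightarrow> w) F"
  shows "((\<lambda>t. gm c (x t) (u t) (u t)) \<longlongrightarrow> gm c a w w) F"
proof -
  have "C1_on (phase c) (\<lambda>z. gm c (fst z) (snd z) (snd z))"
    by (rule C1_on_bilinear_family[OF gm_bilinear[OF c(1)] gm_C1(1)[OF c(1)] chart_homeo(3)[OF c(1)]])
  then have "isCont (\<lambda>z. gm c (fst z) (snd z) (snd z)) (a, w)"
    using C1_on_cont open_phase[OF c(1)] c(2) by (force simp: continuous_on_eq_continuous_at)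
  from isCont_tendsto_compose[OF this tendsto_Pair[OF assms(3,4)]] show ?thesis
    by simp
qed

end

locale hadamard_mfd = complete_mfd M
  for M :: "('m::{t2_space,second_countable_topology}, 'e::euclidean_space) riemannian" +
  assumes nonpositive: "nonpositive_curvature M" and sc: "simply_connected (UNIV :: 'm set)"
begin

lemma geo_C1_map:
  assumes t: "0 \<le> t"
  shows "C1_map (\<lambda>b. geo q b t)"
proof -
  have cont: "isCont (\<lambda>b. geo q b t) a" for a
  proof -
    define c where "c = chart_at M (geo q a t)"
    have c: "c \<in> atlas M" "geo q a t \<in> fst c"
      using chart_at by (auto simp: c_def)
    obtain U where U: "open U" "a \<in> U" "\<And>b. b \<in> U \<Longrightarrow> geo q b t \<in> fst c" "C1_on U (\<lambda>b. st c (geo q b) t)"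
      using C1_near_all[OF t c] unfolding C1_near_def by blast
    have "continuous_on U (\<lambda>b. fst (st c (geo q b) t))"
      by (intro continuous_intros C1_on_cont[OF U(4)])
    then have "continuous_on U (\<lambda>b. chart_inv c (fst (st c (geo q b) t)))"
      by (rule continuous_on_compose2[OF chart_inv_cont[OF c(1)]]) (use U(3) in auto)
    then have "continuous_on U (\<lambda>b. geo q b t)"
      by (rule continuous_on_eq) (use U(3) c in auto)
    then show ?thesis
      using U by (simp add: continuous_on_eq_continuous_at)
  qed
  then have cu: "continuous_on UNIV (\<lambda>b. geo q b t)"
    by (simp add: continuous_at_imp_continuous_on)
  show ?thesis
    unfolding C1_map_def
  proof (intro conjI ballI cu)
    fix c assume c: "c \<in> atlas M"
    show "C1_on {b. geo q b t \<in> fst c} (\<lambda>b. snd c (geo q b t))"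
    proof (rule C1_on_Un_local)
      show "open {b. geo q b t \<in> fst c}"
        using open_vimage[OF chart_homeo(2)[OF c] cu] by (simp add: vimage_def)
      fix a assume "a \<in> {b. geo q b t \<in> fst c}"
      then obtain U where U: "a \<in> U" "C1_on U (\<lambda>b. st c (geo q b) t)"
        using C1_near_all[OF t c, of q a] unfolding C1_near_def by blast
      then show "\<exists>T. a \<in> T \<and> C1_on T (\<lambda>b. snd c (geo q b t))"
        using C1_on_linear_comp[OF linear_fst U(2)] by auto
    qed
  qed
qed

lemma rexp_C1_map: "C1_map (rexp M q)"
  using geo_C1_map[of 1 q] by (simp add: rexp_geo[abs_def])

text \<open>Squared length of the Jacobi field along \<open>geo q a\<close> that arises by varying
  the initial velocity in direction w; the field vanishes at time 0 and has derivative w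
  there.\<close>

definition jnorm :: "'m \<Rightarrow> 'e \<Rightarrow> 'e \<Rightarrow> real \<Rightarrow> real" where
  "jnorm q a w t = metric M (geo q a t) (dmap (\<lambda>b. geo q b t) a w) (dmap (\<lambda>b. geo q b t) a w)"

lemma jnorm_nonneg: "jnorm q a w t \<ge> 0"
  unfolding jnorm_def
  using metric_pos bilinear_lzero[OF metric_bilinear] by (metis less_eq_real_def order_refl)

lemma jnorm_chart:
  assumes t: "0 \<le> t" and c: "c \<in> atlas M" "geo q a t \<in> fst c"
  shows "jnorm q a w t = gm c (fst (st c (geo q a) t)) (fst (dd (\<lambda>b. st c (geo q b) t) a w)) (fst (dd (\<lambda>b. st c (geo q b) t) a w))"
proof -
  obtain U where U: "a \<in> U" "C1_on U (\<lambda>b. st c (geo q b) t)"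
    using C1_near_all[OF t c] unfolding C1_near_def by blast
  have "((\<lambda>b. fst (st c (geo q b) t)) has_derivative (\<lambda>w. fst (dd (\<lambda>b. st c (geo q b) t) a w))) (at a)"
    by (intro has_derivative_fst C1_on_deriv[OF U(2,1)])
  from dd_eq[OF this] show ?thesis
    unfolding jnorm_def using C1_map_dmap(1)[OF geo_C1_map[OF t] c] by simp
qed

text \<open>For n = |J|^2 one has n' = 2 <DJ, J> and n'' = 2 (|DJ|^2 + R), where R >= 0 by
  nonpositive curvature. Cauchy-Schwarz gives n'^2 <= 4 |DJ|^2 |J|^2 <= 2 n n'', the condition of
  \<open>sqrt_convex\<close>.\<close>

lemma jnorm_convex: "convex_on {0<..} (\<lambda>t. sqrt (jnorm q a w t))"
proof -
  let ?n = "jnorm q a w"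
  \<comment> \<open>Stating the conditions with \<open>deriv\<close> makes them free of coordinates,
    so each time t can be treated in its own chart.\<close>
  have *: "(?n has_real_derivative deriv ?n t) (at t) \<and> (deriv ?n has_real_derivative deriv (deriv ?n) t) (at t) \<and>
      0 \<le> deriv (deriv ?n) t \<and> (deriv ?n t)\<^sup>2 \<le> 2 * ?n t * deriv (deriv ?n) t" if t: "t > 0" for t
  proof -
    define c where "c = chart_at M (geo q a t)"
    have c: "c \<in> atlas M" "geo q a t \<in> fst c"
      using chart_at by (auto simp: c_def)
    obtain \<epsilon>' U where \<epsilon>': "\<epsilon>' > 0" "a \<in> U"
      "\<And>s b. \<bar>s - t\<bar> < \<epsilon>' \<Longrightarrow> b \<in> U \<Longrightarrow> geo q b s \<in> fst c"
      "\<And>s w. \<bar>s - t\<bar> < \<epsilon>' \<Longrightarrow> ((\<lambda>s. dd (\<lambda>b. st c (geo q b) s) a w) has_vector_derivative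
         dd (spray c) (st c (geo q a) s) (dd (\<lambda>b. st c (geo q b) s) a w)) (at s)"
      using variation[OF t c] by metis
    \<comment> \<open>The minimum with t keeps all times in T positive, as
      \<open>jnorm_chart\<close> asks for nonnegative times.\<close>
    define \<epsilon> where "\<epsilon> = min \<epsilon>' t"
    define T where "T = ball t \<epsilon>"
    have T: "open T" "t \<in> T"
      using \<epsilon>'(1) t by (auto simp: T_def \<epsilon>_def)
    have T': "\<bar>s - t\<bar> < \<epsilon>'" "s > 0" if "s \<in> T" for s
      using that by (auto simp: T_def \<epsilon>_def dist_real_def)
    have inc: "geo q a s \<in> fst c" if "s \<in> T" for s
      using \<epsilon>'(2,3) T'(1)[OF that] by blast
    define x where "x = (\<lambda>s. fst (st c (geo q a) s))"
    define v where "v = (\<lambda>s. snd (st c (geo q a) s))"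
    define J where "J = (\<lambda>s. fst (dd (\<lambda>b. st c (geo q b) s) a w))"
    define P where "P = (\<lambda>s. snd (dd (\<lambda>b. st c (geo q b) s) a w))"
    have im: "x s \<in> chart_image c" if "s \<in> T" for s
      using inc[OF that] by (simp add: x_def)
    have xd: "(x has_vector_derivative v s) (at s)" "(v has_vector_derivative - \<Gamma> c (x s) (v s) (v s)) (at s)"
      if "s \<in> T" for s
      using st_parts(1,2)[OF geo(1) c(1) inc[OF that]] by (auto simp: x_def v_def)
    have Ed: "((\<lambda>s. dd (\<lambda>b. st c (geo q b) s) a w) has_vector_derivative
       (P s, - (dd (\<lambda>b. \<Gamma> c b (v s) (v s)) (x s) (J s) + 2 *\<^sub>R \<Gamma> c (x s) (v s) (P s)))) (at s)" if "s \<in> T" for s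
      using \<epsilon>'(4)[OF T'(1)[OF that], of w] dd_spray[OF c(1) im[OF that], of "v s" "J s" "P s"]
      by (simp add: x_def v_def J_def P_def del: fst_st)
    have Jd: "(J has_vector_derivative P s) (at s)"
      "(P has_vector_derivative - (dd (\<lambda>b. \<Gamma> c b (v s) (v s)) (x s) (J s) + 2 *\<^sub>R \<Gamma> c (x s) (v s) (P s))) (at s)"
      if "s \<in> T" for s
      using bounded_linear.has_vector_derivative[OF bounded_linear_fst Ed[OF that]]
        bounded_linear.has_vector_derivative[OF bounded_linear_snd Ed[OF that]]
      by (simp_all add: J_def[symmetric] P_def[symmetric])
    note jac = jacobi_norm_deriv[OF c(1) T(1) im xd Jd] jacobi_norm_deriv2[OF c(1) T(1) im xd Jd]
    define K where "K = (\<lambda>s. P s + \<Gamma> c (x s) (v s) (J s))"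
    have n: "?n s = gm c (x s) (J s) (J s)" if "s \<in> T" for s
      using jnorm_chart[OF _ c(1) inc[OF that], of w] T'(2)[OF that] by (simp add: x_def J_def)
    have n1: "(?n has_vector_derivative 2 * gm c (x s) (K s) (J s)) (at s)" if s: "s \<in> T" for s
      unfolding K_def
      by (rule has_vector_derivative_transform_within_open[OF jac(1) T(1) s]) (use s n in auto)
    then have n1': "(?n has_real_derivative 2 * gm c (x s) (K s) (J s)) (at s)" if s: "s \<in> T" for s
      using s by (simp add: has_real_derivative_iff_has_vector_derivative)
    have d1: "deriv ?n s = 2 * gm c (x s) (K s) (J s)" if "s \<in> T" for s
      using n1'[OF that] by (rule DERIV_imp_deriv)
    define R where "R = gm c (x t) (curvature M c (x t) (v t) (J t) (v t)) (J t)"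
    have "((\<lambda>s. 2 * gm c (x s) (K s) (J s)) has_vector_derivative 2 * (gm c (x t) (K t) (K t) + R)) (at t)"
      unfolding K_def R_def by (rule jac(2)[OF _ _ _ _ _ T(2)])
    then have "(deriv ?n has_vector_derivative 2 * (gm c (x t) (K t) (K t) + R)) (at t)"
      by (rule has_vector_derivative_transform_within_open[OF _ T]) (simp add: d1)
    then have n2: "(deriv ?n has_real_derivative 2 * (gm c (x t) (K t) (K t) + R)) (at t)"
      by (simp add: has_real_derivative_iff_has_vector_derivative)
    then have d2: "deriv (deriv ?n) t = 2 * (gm c (x t) (K t) (K t) + R)"
      by (rule DERIV_imp_deriv)
    have xt: "x t = snd c (geo q a t)"
      by (simp add: x_def)
    have R: "R \<ge> 0"
      using curvature_nonneg[OF nonpositive, of "geo q a t" "v t" "J t"]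
      unfolding R_def xt c_def gm_chart_at .
    have KK: "gm c (x t) (K t) (K t) \<ge> 0"
      by (rule gm_nonneg[OF c(1) im[OF T(2)]])
    have "(gm c (x t) (K t) (J t))\<^sup>2 \<le> gm c (x t) (K t) (K t) * gm c (x t) (J t) (J t)"
      by (rule bilinear_CS(1)[OF gm_bilinear[OF c(1) im[OF T(2)]] gm_sym[OF c(1) im[OF T(2)]] gm_pos[OF c(1) im[OF T(2)]]])
    also have "\<dots> \<le> (gm c (x t) (K t) (K t) + R) * gm c (x t) (J t) (J t)"
      using R gm_nonneg[OF c(1) im[OF T(2)]] by (intro mult_right_mono) auto
    finally have "(deriv ?n t)\<^sup>2 \<le> 2 * ?n t * deriv (deriv ?n) t"
      unfolding d2 d1[OF T(2)] n[OF T(2)] by (simp add: power_mult_distrib algebra_simps)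
    then show ?thesis
      using n1'[OF T(2)] n2 d1[OF T(2)] d2 KK R by simp
  qed
  show ?thesis
    by (rule sqrt_convex[of ?n "deriv ?n" "deriv (deriv ?n)"]) (use * jnorm_nonneg in auto)
qed

text \<open>In the chart at q the variation starts at 0 with time derivative w, so J(t)/t tends to
  w, and the metric is continuous in point and vector together.\<close>

lemma jnorm_limit: "((\<lambda>t. jnorm q a w t / t\<^sup>2) \<longlongrightarrow> metric M q w w) (at_right 0)"
proof -
  define c where "c = chart_at M q"
  have c: "c \<in> atlas M" "q \<in> fst c" and c0: "geo q a 0 \<in> fst c"
    using chart_at by (auto simp: c_def geo(2))
  have st0: "st c (geo q b) 0 = (snd c q, b)" for b
    using st_geo_0[OF c] dd_tr_id[OF c] by (simp add: c_def)
  obtain \<rho> \<epsilon> where \<rho>: "\<rho> > 0" "\<epsilon> > 0"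
    and step: "\<And>a' t0. C1_near q c a' t0 \<Longrightarrow> st c (geo q a') t0 \<in> ball (st c (geo q a) 0) \<rho> \<Longrightarrow> flow_ok q c a' t0 \<epsilon>"
    using flow_step[OF c(1) st_phase[of "geo q a" 0, OF c0]] by blast
  have "flow_ok q c a 0 \<epsilon>"
    using \<rho> by (intro step C1_near_0 c) auto
  then obtain U where U: "a \<in> U"
    and U1: "\<And>t b. t \<in> {0..\<epsilon>} \<Longrightarrow> b \<in> U \<Longrightarrow> geo q b t \<in> fst c"
    and U2: "\<And>t. t \<in> {0..\<epsilon>} \<Longrightarrow> ((\<lambda>s. dd (\<lambda>b. st c (geo q b) s) a w) has_vector_derivative
           dd (spray c) (st c (geo q a) t) (dd (\<lambda>b. st c (geo q b) t) a w)) (at t within {0..\<epsilon>})"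
    unfolding flow_ok_def by auto
  define E where "E t = dd (\<lambda>b. st c (geo q b) t) a w" for t
  have "((\<lambda>b. (snd c q, b)) has_derivative (\<lambda>w. (0, w))) (at a)"
    by (auto intro!: derivative_eq_intros)
  from dd_eq[OF this] have E0: "E 0 = (0, w)"
    by (simp add: E_def st0)
  have "(E has_vector_derivative dd (spray c) (snd c q, a) (0, w)) (at 0 within {0..\<epsilon>})"
    using U2[of 0] \<rho> E0 by (simp add: E_def[abs_def] st0)
  then have "(E has_vector_derivative (w, - (dd (\<lambda>b. \<Gamma> c b a a) (snd c q) 0 + 2 *\<^sub>R \<Gamma> c (snd c q) a w))) (at 0 within {0..\<epsilon>})"
    using dd_spray[OF c(1), of "snd c q" a 0 w] c by simp
  from bounded_linear.has_vector_derivative[OF bounded_linear_fst this]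
  have "((\<lambda>t. (1 / norm t) *\<^sub>R (fst (E t) - t *\<^sub>R w)) \<longlongrightarrow> 0) (at 0 within {0..\<epsilon>})"
    by (simp add: has_vector_derivative_def has_derivative_within E0)
  then have "((\<lambda>t. (1 / norm t) *\<^sub>R (fst (E t) - t *\<^sub>R w)) \<longlongrightarrow> 0) (at_right 0)"
    using at_within_Icc_at_right[OF \<rho>(2)] by simp
  moreover have "\<forall>\<^sub>F t in at_right 0. (1 / norm t) *\<^sub>R (fst (E t) - t *\<^sub>R w) = fst (E t) /\<^sub>R t - w"
    using eventually_at_right_less[of 0] by eventually_elim (simp add: scaleR_diff_right divide_inverse)
  ultimately have "((\<lambda>t. fst (E t) /\<^sub>R t - w) \<longlongrightarrow> 0) (at_right 0)"
    by (rule Lim_transform_eventually)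
  then have Jlim: "((\<lambda>t. fst (E t) /\<^sub>R t) \<longlongrightarrow> w) (at_right 0)"
    by (rule LIM_zero_cancel)
  have "isCont (\<lambda>t. fst (st c (geo q a) t)) 0"
    using st_parts(4)[OF geo(1) c(1) c0] by (rule isCont_fst)
  then have xlim: "((\<lambda>t. fst (st c (geo q a) t)) \<longlongrightarrow> snd c q) (at_right 0)"
    using geo(2)[of q a] by (simp add: isCont_def filterlim_at_split)
  have "((\<lambda>t. gm c (fst (st c (geo q a) t)) (fst (E t) /\<^sub>R t) (fst (E t) /\<^sub>R t)) \<longlongrightarrow> gm c (snd c q) w w) (at_right 0)"
    by (rule gm_tendsto[OF c(1) snd_in[OF c(2)] xlim Jlim])
  moreover have "\<forall>\<^sub>F t in at_right 0. t \<in> {0<..<\<epsilon>}"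
    using \<rho> by (intro eventually_at_right_real)
  then have "\<forall>\<^sub>F t in at_right 0. gm c (fst (st c (geo q a) t)) (fst (E t) /\<^sub>R t) (fst (E t) /\<^sub>R t) = jnorm q a w t / t\<^sup>2"
  proof eventually_elim
    case (elim t)
    then have ct: "geo q a t \<in> fst c"
      using U1[of t a] U by auto
    have b: "bilinear (gm c (fst (st c (geo q a) t)))"
      using gm_bilinear[OF c(1)] ct by simp
    show ?case
      using elim jnorm_chart[OF _ c(1) ct, of w] ct
      by (simp add: bilinear_lmul[OF b] bilinear_rmul[OF b] E_def[symmetric] power2_eq_square divide_inverse mult_ac del: fst_st)
  qed
  ultimately have "((\<lambda>t. jnorm q a w t / t\<^sup>2) \<longlongrightarrow> gm c (snd c q) w w) (at_right 0)"
    by (rule Lim_transform_eventually)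
  then show ?thesis
    by (simp add: c_def gm_chart_at)
qed

lemma rexp_expanding: "tnorm M q w \<le> tnorm M (rexp M q a) (dmap (rexp M q) a w)"
  using sqrt_convex_growth(2)[OF jnorm_convex jnorm_limit, of 1 q w a]
  by (simp add: jnorm_def tnorm_def rexp_geo[abs_def])

lemma rexp_scaled_contracting:
  assumes "0 < s" "s \<le> 1"
  shows "tnorm M (rexp M q (s *\<^sub>R a)) (dmap (\<lambda>b. rexp M q (s *\<^sub>R b)) a w) \<le> s * tnorm M (rexp M q a) (dmap (rexp M q) a w)"
  using sqrt_convex_growth(1)[OF jnorm_convex jnorm_limit assms, of q a w]
  by (simp add: jnorm_def tnorm_def rexp_scale) (simp add: rexp_geo[abs_def])

end

section \<open>Local diffeomorphisms and lifting of segments\<close>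

text \<open>The inverse function theorem gives the derivative g' of the inverse pointwise. As the
  solution of dd F (g y) (g' y u) = u it is continuous in y.\<close>

lemma C1_local_inverse:
  fixes F :: "'e::euclidean_space \<Rightarrow> 'e"
  assumes F: "C1_on X F" and a: "a \<in> X" and inj: "\<And>b. b \<in> X \<Longrightarrow> inj (dd F b)"
  obtains U V g where "open U" "a \<in> U" "U \<subseteq> X" "open V" "F a \<in> V" "homeomorphism U V F g" "C1_on V g"
proof -
  have lin: "linear (dd F b)" if "b \<in> X" for b
    using C1_on_bl[OF F that] by (simp add: linear_conv_bounded_linear)
  have inv: "bounded_linear (inv (dd F a))" "\<And>u. inv (dd F a) (dd F a u) = u"
    using lin[OF a] inj[OF a] linear_injective_imp_surjective[OF lin[OF a] inj[OF a]]
    by (auto simp: linear_conv_bounded_linear[symmetric] intro: inj_linear_imp_inv_linear)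
  have "Blinfun (inv (dd F a)) o\<^sub>L Blinfun (dd F a) = id_blinfun"
    by (rule blinfun_eqI) (simp add: inv bounded_linear_Blinfun_apply C1_on_bl[OF F a])
  from inverse_function_theorem[OF C1_on_open[OF F] _ C1_on_dd_Blinfun[OF F] a this]
  obtain U V g g' where U: "open U" "U \<subseteq> X" "a \<in> U" "open V" "F a \<in> V" and h: "homeomorphism U V F g"
    and g: "\<And>y. y \<in> V \<Longrightarrow> (g has_derivative (g' y)) (at y)"
    and g': "\<And>y. y \<in> V \<Longrightarrow> g' y = inv (blinfun_apply (Blinfun (dd F (g y))))"
    using C1_on_deriv[OF F] C1_on_Blinfun[OF F] by metis
  have gX: "g y \<in> X" if "y \<in> V" for y
    using h U that by (auto simp: homeomorphism_def)
  have "C1_on V g"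
  proof (rule C1_onI[OF U(4) g])
    show "continuous_on V (\<lambda>y. g' y u)" for u
    proof (rule continuous_on_solve[of V "\<lambda>y. dd F (g y)" "\<lambda>y. u"])
      show "continuous_on V (\<lambda>y. dd F (g y) e)" for e
        by (rule continuous_on_compose2[OF C1_on_cont_dd[OF F]]) (use h gX U(2) in \<open>auto simp: homeomorphism_def\<close>)
      show "dd F (g y) (g' y u) = u" if "y \<in> V" for y
        unfolding g'[OF that] C1_on_Blinfun[OF F gX[OF that]]
        by (rule surj_f_inv_f[OF linear_injective_imp_surjective[OF lin inj]]) (use gX[OF that] in auto)
    qed (use lin inj gX in auto)
  qed
  with U h show thesis
    by (intro that)
qed

text \<open>The set on which two lifts agree is closed, and it is open because F is injective near
  each value of g. F takes values in an arbitrary type, so the lemma also serves maps into the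
  manifold.\<close>

lemma lift_unique:
  fixes g h :: "'a::topological_space \<Rightarrow> 'e::real_normed_vector"
  assumes T: "connected T" and g: "continuous_on T g" and h: "continuous_on T h"
    and inj: "\<And>t. t \<in> T \<Longrightarrow> \<exists>U. open U \<and> g t \<in> U \<and> inj_on F U"
    and eq: "\<And>t. t \<in> T \<Longrightarrow> F (g t) = F (h t)" and "t0 \<in> T" "g t0 = h t0" "t \<in> T"
  shows "g t = h t"
proof -
  let ?E = "{t \<in> T. g t = h t}"
  have "closedin (top_of_set T) ?E"
    using continuous_closedin_preimage_constant[OF continuous_on_diff[OF g h], of 0] by simp
  moreover have "openin (top_of_set T) ?E"
  proof (subst openin_subopen, intro ballI)
    fix s assume s: "s \<in> ?E"
    then obtain U where U: "open U" "g s \<in> U" "inj_on F U"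
      using inj by blast
    let ?N = "(T \<inter> g -` U) \<inter> (T \<inter> h -` U)"
    have "openin (top_of_set T) ?N"
      using g h U(1) by (intro openin_Int continuous_openin_preimage_gen)
    moreover have "s \<in> ?N"
      using s U(2) by auto
    moreover have "?N \<subseteq> ?E"
      using U(3) eq by (auto simp: inj_on_def)
    ultimately show "\<exists>N. openin (top_of_set T) N \<and> s \<in> N \<and> N \<subseteq> ?E"
      by blast
  qed
  ultimately have "?E = {} \<or> ?E = T"
    using T by (auto simp: connected_clopen)
  then show ?thesis
    using assms(6-8) by blast
qed

section \<open>Lifting segments through an expanding map of Euclidean space\<close>

context
  fixes F :: "'e::euclidean_space \<Rightarrow> 'e" and X B :: "'e set" and k :: real and a0 :: 'e
  assumes F: "C1_on X F" and k: "k > 0" and expand: "\<And>b w. b \<in> X \<Longrightarrow> k * norm w \<le> norm (dd F b w)"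
    and B: "open B" "convex B"
    and comp: "\<And>\<sigma> a z. (\<And>n. \<sigma> n \<in> X) \<Longrightarrow> \<sigma> \<longlonglongrightarrow> a \<Longrightarrow> (\<lambda>n. F (\<sigma> n)) \<longlonglongrightarrow> z \<Longrightarrow> z \<in> B \<Longrightarrow> a \<in> X"
    and a0: "a0 \<in> X" "F a0 \<in> B"
begin

private lemma inj_dd: "b \<in> X \<Longrightarrow> inj (dd F b)"
proof -
  assume b: "b \<in> X"
  have lin: "linear (dd F b)"
    using C1_on_bl[OF F b] by (simp add: linear_conv_bounded_linear)
  have "w = 0" if "dd F b w = 0" for w
    using expand[OF b, of w] that k by (simp add: mult_le_0_iff)
  then show ?thesis
    using linear_injective_0[OF lin] by blast
qed

private lemma loc_inv:
  assumes "b \<in> X"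
  obtains U V g where "open U" "b \<in> U" "U \<subseteq> X" "open V" "F b \<in> V" "homeomorphism U V F g" "C1_on V g"
  using C1_local_inverse[OF F assms inj_dd] by metis

private lemma loc_inj: "b \<in> X \<Longrightarrow> \<exists>U. open U \<and> b \<in> U \<and> inj_on F U"
  by (rule loc_inv[of b]) (auto dest: homeomorphism_of_subsets simp: homeomorphism_def intro!: inj_on_inverseI exI)

private definition "line z t = F a0 + t *\<^sub>R (z - F a0)"

private lemma line_in: "z \<in> B \<Longrightarrow> t \<in> {0..1} \<Longrightarrow> line z t \<in> B"
proof -
  assume "z \<in> B" "t \<in> {0..1}"
  then have "(1 - t) *\<^sub>R F a0 + t *\<^sub>R z \<in> B"
    using B(2) a0(2) by (intro convexD) auto
  then show ?thesis
    by (simp add: line_def algebra_simps)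
qed

private definition "is_lift z T \<mu> \<longleftrightarrow> continuous_on {0..T} \<mu> \<and> \<mu> 0 = a0 \<and>
   (\<forall>t\<in>{0..T}. \<mu> t \<in> X \<and> F (\<mu> t) = line z t)"

private lemma is_lift_unique:
  assumes "is_lift z T \<mu>" "is_lift z T' \<nu>" "0 \<le> t" "t \<le> T" "t \<le> T'"
  shows "\<mu> t = \<nu> t"
proof (rule lift_unique[of "{0..t}" \<mu> \<nu> F 0])
  show "continuous_on {0..t} \<mu>" "continuous_on {0..t} \<nu>"
    using assms by (auto simp: is_lift_def intro: continuous_on_subset)
qed (use assms loc_inj in \<open>auto simp: is_lift_def\<close>)

text \<open>Locally the lift is a local inverse of F applied to the segment, hence differentiable.
  Since the differential of F expands by k, the speed of the lift is at most 1/k times that of the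
  segment.\<close>

private lemma is_lift_lipschitz:
  assumes \<mu>: "is_lift z T \<mu>" and t: "t \<in> {0..T}" "t' \<in> {0..T}"
  shows "norm (\<mu> t - \<mu> t') \<le> norm (z - F a0) / k * norm (t - t')"
proof -
  have "\<exists>d. (\<mu> has_vector_derivative d) (at s within {0..T}) \<and> norm d \<le> norm (z - F a0) / k"
    if s: "s \<in> {0..T}" for s
  proof -
    have \<mu>s: "\<mu> s \<in> X" "F (\<mu> s) = line z s"
      using \<mu> s by (auto simp: is_lift_def)
    obtain U V g where U: "open U" "\<mu> s \<in> U" "U \<subseteq> X" "open V" "F (\<mu> s) \<in> V" "homeomorphism U V F g" "C1_on V g"
      using loc_inv[OF \<mu>s(1)] .
    have lineD: "(line z has_vector_derivative z - F a0) (at s within {0..T})"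
      unfolding line_def by (auto intro!: derivative_eq_intros)
    have "((\<lambda>t. g (line z t)) has_derivative (\<lambda>h. dd g (line z s) (h *\<^sub>R (z - F a0)))) (at s within {0..T})"
      using lineD U(5) \<mu>s(2) unfolding has_vector_derivative_def
      by (intro has_derivative_compose[OF _ C1_on_deriv[OF U(7)]]) auto
    moreover have "linear (dd g (line z s))"
      using C1_on_bl[OF U(7)] U(5) \<mu>s(2) by (simp add: linear_conv_bounded_linear)
    ultimately have gd: "((\<lambda>t. g (line z t)) has_vector_derivative dd g (line z s) (z - F a0)) (at s within {0..T})"
      unfolding has_vector_derivative_def by (simp only: linear_scale)
    have "\<forall>\<^sub>F t in at s within {0..T}. \<mu> t \<in> U"
      using \<mu> s U(1,2) unfolding is_lift_def continuous_on_def by (auto dest: topological_tendstoD)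
    moreover have "\<forall>\<^sub>F t in at s within {0..T}. t \<in> {0..T}"
      by (simp add: eventually_at_filter)
    ultimately have ev: "\<forall>\<^sub>F t in at s within {0..T}. g (line z t) = \<mu> t"
    proof eventually_elim
      case (elim t)
      then have "F (\<mu> t) = line z t"
        using \<mu> by (simp add: is_lift_def)
      then show ?case
        using U(6) elim(1) homeomorphism_apply1 by fastforce
    qed
    have gs: "g (line z s) = \<mu> s"
      using U(2,6) \<mu>s(2) homeomorphism_apply1 by fastforce
    have d: "(\<mu> has_vector_derivative dd g (line z s) (z - F a0)) (at s within {0..T})"
      using has_derivative_transform_eventually[OF gd[unfolded has_vector_derivative_def] ev gs s]
      by (simp add: has_vector_derivative_def)
    let ?d = "dd g (line z s) (z - F a0)"
    have "(F has_derivative dd F (\<mu> s)) (at (g (line z s)))"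
      using C1_on_deriv[OF F \<mu>s(1)] by (simp add: gs)
    moreover have "(g has_derivative dd g (line z s)) (at (line z s))"
      using C1_on_deriv[OF U(7)] U(5) \<mu>s(2) by simp
    ultimately have "((\<lambda>y. F (g y)) has_derivative (\<lambda>h. dd F (\<mu> s) (dd g (line z s) h))) (at (line z s))"
      by (rule has_derivative_compose[rotated])
    moreover have "((\<lambda>y. F (g y)) has_derivative (\<lambda>h. h)) (at (line z s))"
      by (rule has_derivative_transform_within_open[OF has_derivative_ident U(4)])
         (use U(5,6) \<mu>s(2) in \<open>auto simp: homeomorphism_def\<close>)
    ultimately have "dd F (\<mu> s) ?d = z - F a0"
      by (metis has_derivative_unique)
    then have "k * norm ?d \<le> norm (z - F a0)"
      using expand[OF \<mu>s(1), of ?d] by simp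
    then have "norm ?d \<le> norm (z - F a0) / k"
      using k by (simp add: pos_le_divide_eq mult.commute)
    with d show ?thesis by blast
  qed
  then obtain d where d: "\<And>s. s \<in> {0..T} \<Longrightarrow> (\<mu> has_vector_derivative d s) (at s within {0..T})"
    "\<And>s. s \<in> {0..T} \<Longrightarrow> norm (d s) \<le> norm (z - F a0) / k"
    by metis
  show ?thesis
  proof (rule differentiable_bound[of "{0..T}" _ "\<lambda>s h. h *\<^sub>R d s"])
    show "onorm (\<lambda>h. h *\<^sub>R d s) \<le> norm (z - F a0) / k" if "s \<in> {0..T}" for s
      by (rule order_trans[OF onorm_scaleR_vec_le d(2)[OF that]])
  qed (use d t in \<open>auto simp: has_vector_derivative_def\<close>)
qed

text \<open>Lifts of the initial pieces of all segments with end point near zs, jointly continuous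
  in end point and time. The joint continuity is what makes the section in
  \<open>segment_section\<close> continuous.\<close>

private definition "lifts zs T W \<Lambda> \<longleftrightarrow> open W \<and> zs \<in> W \<and> W \<subseteq> B \<and> continuous_on (W \<times> {0..T}) (\<lambda>(z, t). \<Lambda> z t) \<and>
   (\<forall>z\<in>W. is_lift z T (\<Lambda> z))"

text \<open>Let T be the supremum of the times up to which the segments with end points near zs can
  be lifted. By the speed bound the lift over the segment to zs converges as time tends to T, by
  \<open>comp\<close> its limit lies in X, and a local inverse there continues all nearby lifts
  beyond T.\<close>

private lemma lifts_exist:
  assumes zs: "zs \<in> B"
  shows "\<exists>W \<Lambda>. lifts zs 1 W \<Lambda>"
proof -
  define R where "R = {T \<in> {0..1}. \<exists>W \<Lambda>. lifts zs T W \<Lambda>}"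
  have "lifts zs 0 B (\<lambda>z t. a0)"
    using B zs a0 by (auto simp: lifts_def is_lift_def line_def)
  then have R0: "0 \<in> R"
    unfolding R_def by auto
  have bdd: "bdd_above R"
    by (rule bdd_aboveI[of _ 1]) (auto simp: R_def)
  define T where "T = Sup R"
  have T: "0 \<le> T" "T \<le> 1"
    unfolding T_def using cSup_upper[OF R0 bdd] R0 by (auto intro!: cSup_least simp: R_def)
  have "T \<in> closure R"
    unfolding T_def using R0 bdd by (intro closure_contains_Sup) auto
  then obtain ts where ts: "\<And>n. ts n \<in> R" "ts \<longlonglongrightarrow> T"
    unfolding closure_sequential by blast
  have "\<forall>n. \<exists>W \<Lambda>. lifts zs (ts n) W \<Lambda>"
    using ts(1) by (auto simp: R_def)
  then obtain W \<Lambda> where L: "\<And>n. lifts zs (ts n) (W n) (\<Lambda> n)"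
    by metis
  have ts01: "0 \<le> ts n" "ts n \<le> 1" for n
    using ts(1)[of n] by (auto simp: R_def)
  have Lz: "is_lift zs (ts n) (\<Lambda> n zs)" for n
    using L[of n] by (simp add: lifts_def)
  \<comment> \<open>End points of the partial lifts. By uniqueness any two partial lifts agree on
    their common times, so the Lipschitz bound makes this sequence Cauchy.\<close>
  define \<sigma> where "\<sigma> n = \<Lambda> n zs (ts n)" for n
  define C where "C = norm (zs - F a0) / k"
  have C: "C \<ge> 0"
    using k by (simp add: C_def)
  have lip: "norm (\<sigma> n - \<sigma> m) \<le> C * norm (ts n - ts m)" for n m
  proof -
    have *: "norm (\<sigma> n - \<sigma> m) \<le> C * norm (ts n - ts m)" if "ts m \<le> ts n" for n m
    proof -
      have "\<sigma> m = \<Lambda> n zs (ts m)"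
        unfolding \<sigma>_def using that ts01 by (intro is_lift_unique[OF Lz Lz]) auto
      then show ?thesis
        unfolding \<sigma>_def C_def using is_lift_lipschitz[OF Lz[of n], of "ts n" "ts m"] that ts01 by simp
    qed
    show ?thesis
      using *[of m n] *[of n m] by (cases "ts m \<le> ts n") (auto simp: norm_minus_commute)
  qed
  have "Cauchy \<sigma>"
  proof (rule metric_CauchyI)
    fix e :: real assume e: "0 < e"
    have "Cauchy ts"
      using ts(2) by (rule LIMSEQ_imp_Cauchy)
    then obtain N where N: "\<And>m n. m \<ge> N \<Longrightarrow> n \<ge> N \<Longrightarrow> dist (ts m) (ts n) < e / (C + 1)"
      using metric_CauchyD[of ts "e / (C + 1)"] e C by auto
    have "dist (\<sigma> m) (\<sigma> n) < e" if "m \<ge> N" "n \<ge> N" for m n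
    proof -
      have "dist (\<sigma> m) (\<sigma> n) \<le> C * dist (ts m) (ts n)"
        using lip[of m n] by (simp add: dist_norm)
      also have "\<dots> \<le> C * (e / (C + 1))"
        using N[OF that] C by (intro mult_left_mono) auto
      also have "\<dots> < e"
        using e C by (simp add: field_simps)
      finally show ?thesis .
    qed
    then show "\<exists>N. \<forall>m\<ge>N. \<forall>n\<ge>N. dist (\<sigma> m) (\<sigma> n) < e"
      by blast
  qed
  then obtain a where a: "\<sigma> \<longlonglongrightarrow> a"
    using Cauchy_convergent_iff convergent_def by blast
  have \<sigma>X: "\<sigma> n \<in> X" "F (\<sigma> n) = line zs (ts n)" for n
    using Lz[of n] ts01[of n] by (auto simp: \<sigma>_def is_lift_def)
  have Fl: "(\<lambda>n. F (\<sigma> n)) \<longlonglongrightarrow> line zs T"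
    unfolding \<sigma>X line_def by (intro tendsto_intros ts(2))
  have aX: "a \<in> X"
    by (rule comp[OF \<sigma>X(1) a Fl line_in[OF zs]]) (use T in auto)
  then have "isCont F a"
    using C1_on_cont[OF F] C1_on_open[OF F] by (simp add: continuous_on_eq_continuous_at)
  from LIMSEQ_unique[OF isCont_tendsto_compose[OF this a] Fl] have Fa: "F a = line zs T"
    by simp
  obtain U V g where U: "open U" "a \<in> U" "U \<subseteq> X" "open V" "F a \<in> V" "homeomorphism U V F g" "C1_on V g"
    using loc_inv[OF aX] .
  obtain e where e: "e > 0" "ball (line zs T) e \<subseteq> V"
    using U(4,5) Fa open_contains_ball by metis
  \<comment> \<open>Half of e is spent on moving along the segment to zs, the other half on moving
    its end point within \<open>W'\<close>.\<close>
  define \<delta> where "\<delta> = e / (2 * (norm (zs - F a0) + 1))"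
  have \<delta>: "\<delta> > 0"
    using e by (simp add: \<delta>_def add_nonneg_pos)
  have near: "dist (line zs t) (line zs T) < e / 2" if "\<bar>t - T\<bar> < \<delta>" for t
  proof -
    have "dist (line zs t) (line zs T) = norm ((t - T) *\<^sub>R (zs - F a0))"
      by (simp add: line_def dist_norm algebra_simps)
    also have "\<dots> \<le> \<bar>t - T\<bar> * (norm (zs - F a0) + 1)"
      by (simp add: mult_left_mono)
    also have "\<dots> < \<delta> * (norm (zs - F a0) + 1)"
      using that by (intro mult_strict_right_mono) (auto simp: add_nonneg_pos)
    also have "\<dots> = e / 2"
      using add_nonneg_pos[OF norm_ge_zero zero_less_one, of "zs - F a0"] by (simp add: \<delta>_def field_simps)
    finally show ?thesis .
  qed
  have "\<forall>\<^sub>F n in sequentially. \<sigma> n \<in> U"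
    using a U(1,2) by (rule topological_tendstoD)
  moreover have "\<forall>\<^sub>F n in sequentially. \<bar>ts n - T\<bar> < \<delta>"
    using tendstoD[OF ts(2) \<delta>] by (simp add: dist_real_def)
  ultimately have "\<forall>\<^sub>F n in sequentially. \<sigma> n \<in> U \<and> \<bar>ts n - T\<bar> < \<delta>"
    by (rule eventually_conj)
  from eventually_happens'[OF sequentially_bot this]
  obtain n where n: "\<sigma> n \<in> U" "\<bar>ts n - T\<bar> < \<delta>"
    by blast
  let ?T1 = "ts n"
  \<comment> \<open>Lies strictly beyond T unless T = 1. As T2 turns out to be an admissible time as
    well, T2 <= T, and T2 = 1 follows.\<close>
  define T2 where "T2 = min 1 (T + \<delta> / 2)"
  have T1: "0 \<le> ?T1" "?T1 \<le> T" "?T1 \<le> T2"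
    using ts01[of n] cSup_upper[OF ts(1) bdd, of n] \<delta> by (auto simp: T2_def T_def)
  have T2: "\<bar>t - T\<bar> < \<delta>" "t \<in> {0..1}" if "t \<in> {?T1..T2}" for t
    using that n(2) \<delta> T1 by (auto simp: T2_def)
  let ?L = "\<Lambda> n"
  have cL: "continuous_on (W n \<times> {0..?T1}) (\<lambda>(z, t). ?L z t)" and Wo: "open (W n)" "zs \<in> W n" "W n \<subseteq> B"
    and lL: "\<And>z. z \<in> W n \<Longrightarrow> is_lift z ?T1 (?L z)"
    using L[of n] by (auto simp: lifts_def)
  have "continuous_on (W n) (\<lambda>z. (\<lambda>(z, t). ?L z t) (z, ?T1))"
    by (rule continuous_on_compose2[OF cL]) (use T1 in \<open>auto intro!: continuous_intros\<close>)
  then have cT1: "continuous_on (W n) (\<lambda>z. ?L z ?T1)"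
    by simp
  define W' where "W' = (W n \<inter> (\<lambda>z. ?L z ?T1) -` U) \<inter> ball zs (e / 2)"
  have W': "open W'" "zs \<in> W'" "W' \<subseteq> B" "W' \<subseteq> W n"
    using continuous_open_preimage[OF cT1 Wo(1) U(1)] Wo n(1) e by (auto simp: W'_def \<sigma>_def)
  have inV: "line z t \<in> V" if "z \<in> W'" "t \<in> {?T1..T2}" for z t
  proof -
    have "dist (line z t) (line zs t) = \<bar>t\<bar> * dist z zs"
      by (simp add: line_def dist_norm flip: norm_scaleR) (simp add: algebra_simps)
    also have "\<dots> \<le> 1 * dist z zs"
      using T2(2)[OF that(2)] by (intro mult_right_mono) auto
    finally have "dist (line z t) (line zs t) < e / 2"
      using that(1) by (simp add: W'_def dist_commute)
    then have "dist (line z t) (line zs T) < e"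
      using near[OF T2(1)[OF that(2)]] dist_triangle[of "line z t" "line zs T" "line zs t"] by simp
    then show ?thesis
      using e(2) by (auto simp: dist_commute)
  qed
  define L' where "L' z t = (if t \<le> ?T1 then ?L z t else g (line z t))" for z t
  \<comment> \<open>At the junction the old lift lies in U by the choice of \<open>W'\<close>, so
    the local inverse returns it.\<close>
  have glue: "?L z ?T1 = g (line z ?T1)" if "z \<in> W'" for z
  proof -
    have "?L z ?T1 \<in> U" "F (?L z ?T1) = line z ?T1"
      using that lL[of z] W'(4) T1 by (auto simp: W'_def is_lift_def)
    then show ?thesis
      using homeomorphism_apply1[OF U(6)] by metis
  qed
  have cL': "continuous_on (W' \<times> {0..T2}) (\<lambda>(z, t). L' z t)"
  proof -
    have "continuous_on (W' \<times> {0..T2}) (\<lambda>p. if snd p \<le> ?T1 then ?L (fst p) (snd p) else g (line (fst p) (snd p)))"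
    proof (rule continuous_on_cases_le)
      show "continuous_on {p \<in> W' \<times> {0..T2}. snd p \<le> ?T1} (\<lambda>p. ?L (fst p) (snd p))"
        by (rule continuous_on_subset[OF cL[unfolded case_prod_unfold]]) (use W'(4) in auto)
      show "continuous_on {p \<in> W' \<times> {0..T2}. ?T1 \<le> snd p} (\<lambda>p. g (line (fst p) (snd p)))"
        by (rule continuous_on_compose2[OF C1_on_cont[OF U(7)]])
           (use inV in \<open>auto simp: line_def[abs_def] intro!: continuous_intros\<close>)
    qed (use glue in \<open>auto intro!: continuous_intros\<close>)
    moreover have "(\<lambda>(z, t). L' z t) = (\<lambda>p. if snd p \<le> ?T1 then ?L (fst p) (snd p) else g (line (fst p) (snd p)))"
      by (auto simp: L'_def fun_eq_iff)
    ultimately show ?thesis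
      by simp
  qed
  have "lifts zs T2 W' L'"
    unfolding lifts_def
  proof (intro conjI W' cL' ballI)
    fix z assume z: "z \<in> W'"
    have lz: "is_lift z ?T1 (?L z)"
      using lL z W'(4) by auto
    show "is_lift z T2 (L' z)"
      unfolding is_lift_def
    proof (intro conjI ballI)
      have "continuous_on {0..T2} (\<lambda>t. (\<lambda>(z, t). L' z t) (z, t))"
        by (rule continuous_on_compose2[OF cL']) (use z in \<open>auto intro!: continuous_intros\<close>)
      then show "continuous_on {0..T2} (L' z)"
        by simp
      show "L' z 0 = a0"
        using lz T1 by (simp add: L'_def is_lift_def)
      fix t assume t: "t \<in> {0..T2}"
      show "L' z t \<in> X" "F (L' z t) = line z t"
        using lz t inV[OF z, of t] homeomorphism_apply2[OF U(6)] homeomorphism_image2[OF U(6)] U(3)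
        by (auto simp: L'_def is_lift_def)
    qed
  qed
  then have "T2 \<in> R"
    using T1 by (auto simp: R_def T2_def)
  then have "T2 \<le> T"
    unfolding T_def using bdd by (rule cSup_upper)
  then have "T2 = 1"
    using \<delta> T by (auto simp: T2_def min_def split: if_splits)
  with \<open>lifts zs T2 W' L'\<close> show ?thesis by blast
qed

text \<open>The section sends z to the end point of the lift of the segment from F a0 to z.\<close>

lemma segment_section:
  obtains s where "continuous_on B s" "s ` B \<subseteq> X" "\<And>z. z \<in> B \<Longrightarrow> F (s z) = z" "s (F a0) = a0"
proof -
  define s where "s z = (SOME \<mu>. is_lift z 1 \<mu>) 1" for z
  have s_eq: "s z = \<mu> 1" if "is_lift z 1 \<mu>" for z \<mu>
    unfolding s_def by (rule is_lift_unique[OF someI[of "is_lift z 1", OF that] that]) auto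
  have s_loc: "\<exists>W \<Lambda>. lifts z 1 W \<Lambda> \<and> (\<forall>z'\<in>W. s z' = \<Lambda> z' 1)" if "z \<in> B" for z
    using lifts_exist[OF that] s_eq unfolding lifts_def by metis
  show thesis
  proof
    show "continuous_on B s"
    proof (rule continuous_at_imp_continuous_on, intro ballI)
      fix z assume "z \<in> B"
      then obtain W \<Lambda> where W: "lifts z 1 W \<Lambda>" "\<And>z'. z' \<in> W \<Longrightarrow> s z' = \<Lambda> z' 1"
        using s_loc by blast
      then have c: "continuous_on (W \<times> {0..1}) (\<lambda>(z, t). \<Lambda> z t)"
        by (simp add: lifts_def)
      have "continuous_on W (\<lambda>z. (\<lambda>(z, t). \<Lambda> z t) (z, 1))"
        by (rule continuous_on_compose2[OF c]) (auto intro!: continuous_intros)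
      then have "continuous_on W s"
        by (rule continuous_on_eq) (simp add: W(2))
      then show "isCont s z"
        using W(1) by (simp add: lifts_def continuous_on_eq_continuous_at)
    qed
    have *: "s z \<in> X \<and> F (s z) = z" if z: "z \<in> B" for z
    proof -
      obtain W \<Lambda> where W: "lifts z 1 W \<Lambda>" "s z = \<Lambda> z 1"
        using s_loc[OF z] by (auto simp: lifts_def)
      then show ?thesis
        by (auto simp: lifts_def is_lift_def line_def)
    qed
    then show "s ` B \<subseteq> X" "\<And>z. z \<in> B \<Longrightarrow> F (s z) = z"
      by auto
    show "s (F a0) = a0"
      by (rule s_eq) (use a0 in \<open>auto simp: is_lift_def line_def\<close>)
  qed
qed

end

section \<open>The Cartan-Hadamard theorem\<close>

context riemannian_mfd
begin

lemma gm_cont: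
  assumes c: "c \<in> atlas M"
  shows "continuous_on (phase c) (\<lambda>z. gm c (fst z) (snd z) (snd z))"
  by (rule C1_on_cont[OF C1_on_bilinear_family[OF gm_bilinear[OF c] gm_C1(1)[OF c] chart_homeo(3)[OF c]]])

lemma gm_homogeneous:
  assumes "c \<in> atlas M" "a \<in> chart_image c"
  shows "gm c a u u = (norm u)\<^sup>2 * gm c a (u /\<^sub>R norm u) (u /\<^sub>R norm u)"
  using gm_bilinear[OF assms]
  by (cases "u = 0") (auto simp: bilinear_lmul bilinear_rmul bilinear_lzero power2_eq_square field_simps)

text \<open>By homogeneity it is enough to bound the metric on unit vectors over K, which form a
  compact set.\<close>

lemma gm_upper:
  assumes c: "c \<in> atlas M" and K: "compact K" "K \<subseteq> chart_image c"
  obtains C where "C > 0" "\<And>a u. a \<in> K \<Longrightarrow> sqrt (gm c a u u) \<le> C * norm u"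
proof -
  have "compact ((\<lambda>z. gm c (fst z) (snd z) (snd z)) ` (K \<times> sphere 0 1))"
    by (intro compact_continuous_image continuous_on_subset[OF gm_cont[OF c]] compact_Times K compact_sphere)
       (use K in auto)
  from compact_imp_bounded[OF this]
  obtain D where D: "D > 0" "\<And>z. z \<in> K \<times> sphere 0 1 \<Longrightarrow> \<bar>gm c (fst z) (snd z) (snd z)\<bar> \<le> D"
    unfolding bounded_pos by auto
  have "sqrt (gm c a u u) \<le> sqrt D * norm u" if a: "a \<in> K" for a u
  proof (cases "u = 0")
    case True
    then show ?thesis
      using gm_bilinear[OF c, of a] a K by (auto simp: bilinear_lzero)
  next
    case False
    then have "gm c a (u /\<^sub>R norm u) (u /\<^sub>R norm u) \<le> D"
      using D(2)[of "(a, u /\<^sub>R norm u)"] a by auto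
    then have "gm c a u u \<le> (norm u)\<^sup>2 * D"
      using gm_homogeneous[OF c, of a u] a K by (simp add: mult_left_mono subset_iff)
    then have "sqrt (gm c a u u) \<le> sqrt ((norm u)\<^sup>2 * D)"
      by (rule real_sqrt_le_mono)
    then show ?thesis
      by (simp add: real_sqrt_mult mult.commute)
  qed
  with that[of "sqrt D"] D show thesis by simp
qed

lemma tnorm_lower:
  obtains m where "m > 0" "\<And>w. m * norm w \<le> tnorm M q w"
proof -
  define c where "c = chart_at M q"
  have c: "c \<in> atlas M" "q \<in> fst c"
    using chart_at by (auto simp: c_def)
  let ?a = "snd c q"
  have eq: "metric M q w w = gm c ?a w w" for w
    by (simp add: c_def gm_chart_at)
  have "continuous_on (sphere 0 1) (\<lambda>w. (\<lambda>z. gm c (fst z) (snd z) (snd z)) (?a, w))"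
    by (rule continuous_on_compose2[OF gm_cont[OF c(1)]]) (use c in \<open>auto intro!: continuous_intros\<close>)
  then have "continuous_on (sphere (0::'e) 1) (\<lambda>w. gm c ?a w w)"
    by simp
  moreover have "sphere (0::'e) 1 \<noteq> {}"
    by simp
  ultimately obtain u where u: "u \<in> sphere 0 1" "\<And>w. w \<in> sphere 0 1 \<Longrightarrow> gm c ?a u u \<le> gm c ?a w w"
    using continuous_attains_inf[of "sphere 0 1" "\<lambda>w. gm c ?a w w"] compact_sphere by blast
  have pos: "gm c ?a u u > 0"
    by (rule gm_pos[OF c(1)]) (use u c in auto)
  have "sqrt (gm c ?a u u) * norm w \<le> tnorm M q w" for w
  proof (cases "w = 0")
    case True
    then show ?thesis
      using metric_bilinear[of q] by (simp add: tnorm_def bilinear_lzero)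
  next
    case False
    then have "gm c ?a u u \<le> gm c ?a (w /\<^sub>R norm w) (w /\<^sub>R norm w)"
      by (intro u(2)) auto
    then have "gm c ?a u u * (norm w)\<^sup>2 \<le> gm c ?a w w"
      using gm_homogeneous[OF c(1), of ?a w] c by (simp add: mult.commute mult_left_mono)
    then have "sqrt (gm c ?a u u * (norm w)\<^sup>2) \<le> sqrt (gm c ?a w w)"
      by (rule real_sqrt_le_mono)
    then show ?thesis
      by (simp add: real_sqrt_mult tnorm_def eq)
  qed
  with that[of "sqrt (gm c ?a u u)"] pos show thesis by simp
qed

section \<open>Expanding maps into the manifold and their local sections\<close>

context
  fixes f :: "'e \<Rightarrow> 'm" and m :: real
  assumes f: "C1_map f" and m: "m > 0" and expanding: "\<And>a w. m * norm w \<le> tnorm M (f a) (dmap f a w)"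
begin

lemma f_cont: "continuous_on UNIV f"
  using f by (simp add: C1_map_def)

lemma f_open: "open V \<Longrightarrow> open {b. f b \<in> V}"
  using open_vimage[OF _ f_cont] by (simp add: vimage_def)

lemma f_C1: "c \<in> atlas M \<Longrightarrow> C1_on {b. f b \<in> fst c} (\<lambda>b. snd c (f b))"
  using f by (simp add: C1_map_def)

lemma chart_expanding:
  assumes "c \<in> atlas M" "f a \<in> fst c"
  shows "m * norm w \<le> sqrt (gm c (snd c (f a)) (dd (\<lambda>b. snd c (f b)) a w) (dd (\<lambda>b. snd c (f b)) a w))"
  using expanding[of w a] C1_map_dmap(1)[OF f assms] by (simp add: tnorm_def)

lemma f_inj_dd:
  assumes c: "c \<in> atlas M" and a: "a \<in> {b. f b \<in> fst c}"
  shows "inj (dd (\<lambda>b. snd c (f b)) a)"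
proof -
  have lin: "linear (dd (\<lambda>b. snd c (f b)) a)"
    using C1_on_bl[OF f_C1[OF c] a] by (simp add: linear_conv_bounded_linear)
  have "w = 0" if "dd (\<lambda>b. snd c (f b)) a w = 0" for w
    using chart_expanding[OF c, of a w] a that m bilinear_lzero[OF gm_bilinear[OF c, of "snd c (f a)"]]
    by (simp add: mult_le_0_iff)
  then show ?thesis
    using linear_injective_0[OF lin] by blast
qed

lemma f_local_inverse:
  assumes c: "c \<in> atlas M" "f a \<in> fst c"
  obtains U V g where "open U" "a \<in> U" "U \<subseteq> {b. f b \<in> fst c}" "open V" "snd c (f a) \<in> V"
    "homeomorphism U V (\<lambda>b. snd c (f b)) g" "C1_on V g"
  using C1_local_inverse[OF f_C1[OF c(1)] _ f_inj_dd[OF c(1)], of a] c(2) by blast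

lemma f_local_inj: "\<exists>U. open U \<and> a \<in> U \<and> inj_on f U"
proof -
  obtain U V g where U: "open U" "a \<in> U" "homeomorphism U V (\<lambda>b. snd (chart_at M (f a)) (f b)) g"
    using f_local_inverse[OF chart_at] by metis
  have "inj_on f U"
    using U(3) by (intro inj_onI) (metis homeomorphism_apply1)
  with U show ?thesis by blast
qed

text \<open>V is a coordinate ball, chosen before a0. There the length of a vector is at most C
  times its Euclidean norm, so f read in the chart expands Euclidean norms by m / C, and
  \<open>segment_section\<close> applies to the whole ball. That every preimage of a point of V lies
  on a section over all of V is what makes f a covering.\<close>

lemma f_section:
  "\<exists>V. open V \<and> y \<in> V \<and> (\<forall>a0. f a0 \<in> V \<longrightarrow> (\<exists>s. continuous_on V s \<and> (\<forall>x\<in>V. f (s x) = x) \<and> s (f a0) = a0))"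
proof -
  define c where "c = chart_at M y"
  have c: "c \<in> atlas M" "y \<in> fst c"
    using chart_at by (auto simp: c_def)
  obtain r where r: "r > 0" "cball (snd c y) r \<subseteq> chart_image c"
    using chart_homeo(3)[OF c(1)] snd_in[OF c(2)] open_contains_cball by blast
  obtain C where C: "C > 0" "\<And>a u. a \<in> cball (snd c y) r \<Longrightarrow> sqrt (gm c a u u) \<le> C * norm u"
    using gm_upper[OF c(1) compact_cball r(2)] by blast
  define B where "B = ball (snd c y) r"
  define V where "V = fst c \<inter> snd c -` B"
  have V: "open V" "y \<in> V"
    unfolding V_def B_def using c r chart_homeo(2)[OF c(1)]
    by (auto intro!: continuous_open_preimage chart_cont)
  have Vi: "chart_inv c z \<in> V" if "z \<in> B" for z
    using that r c by (auto simp: V_def B_def subset_iff)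
  define F where "F b = snd c (f b)" for b
  define X where "X = {b. f b \<in> V}"
  have X: "open X"
    unfolding X_def by (rule f_open[OF V(1)])
  have FX: "C1_on X F"
    unfolding F_def by (rule C1_on_subset[OF f_C1[OF c(1)] _ X]) (auto simp: X_def V_def)
  have "\<exists>s. continuous_on V s \<and> (\<forall>x\<in>V. f (s x) = x) \<and> s (f a0) = a0" if a0: "f a0 \<in> V" for a0
  proof -
    have mC: "m / C > 0"
      using m C by simp
    have ex: "m / C * norm w \<le> norm (dd F b w)" if b: "b \<in> X" for b w
    proof -
      have "m * norm w \<le> C * norm (dd F b w)"
        unfolding F_def
        by (rule order_trans[OF chart_expanding[OF c(1)] C(2)]) (use b in \<open>auto simp: X_def V_def B_def\<close>)
      then show ?thesis
        using C(1) by (simp add: pos_divide_le_eq mult.commute)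
    qed
    \<comment> \<open>Both f a and the point with coordinates z are limits of f (\<sigma> n), and
      limits in a Hausdorff space are unique.\<close>
    have comp: "a \<in> X" if \<sigma>: "\<And>n. \<sigma> n \<in> X" "\<sigma> \<longlonglongrightarrow> a" "(\<lambda>n. F (\<sigma> n)) \<longlonglongrightarrow> z" "z \<in> B" for \<sigma> a z
    proof -
      have "isCont (chart_inv c) z"
        using chart_inv_cont[OF c(1)] chart_homeo(3)[OF c(1)] that(4) r
        by (auto simp: continuous_on_eq_continuous_at B_def subset_iff)
      then have "(\<lambda>n. chart_inv c (F (\<sigma> n))) \<longlonglongrightarrow> chart_inv c z"
        by (rule isCont_tendsto_compose) (rule \<sigma>(3))
      moreover have "chart_inv c (F (\<sigma> n)) = f (\<sigma> n)" for n
        using \<sigma>(1)[of n] c(1) by (auto simp: F_def X_def V_def)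
      moreover have "(\<lambda>n. f (\<sigma> n)) \<longlonglongrightarrow> f a"
        by (rule isCont_tendsto_compose[OF C1_map_isCont[OF f] \<sigma>(2)])
      ultimately have "f a = chart_inv c z"
        using LIMSEQ_unique by fastforce
      then show ?thesis
        using Vi[OF that(4)] by (simp add: X_def)
    qed
    obtain s where s: "continuous_on B s" "s ` B \<subseteq> X" "\<And>z. z \<in> B \<Longrightarrow> F (s z) = z" "s (F a0) = a0"
    proof (rule segment_section[of X F "m / C" B a0])
      show "m / C * norm w \<le> norm (dd F b w)" if "b \<in> X" for b w
        by (rule ex[OF that])
      show "a \<in> X" if "\<And>n. \<sigma> n \<in> X" "\<sigma> \<longlonglongrightarrow> a" "(\<lambda>n. F (\<sigma> n)) \<longlonglongrightarrow> z" "z \<in> B" for \<sigma> a z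
        by (rule comp[OF that])
      show "open B" "convex B"
        by (auto simp: B_def)
      show "a0 \<in> X" "F a0 \<in> B"
        using a0 by (auto simp: X_def F_def V_def)
    qed (use FX mC in blast)+
    have "continuous_on V (\<lambda>x. s (snd c x))"
      by (rule continuous_on_compose2[OF s(1) continuous_on_subset[OF chart_cont[OF c(1)]]]) (auto simp: V_def)
    moreover have "f (s (snd c x)) = x" if "x \<in> V" for x
    proof -
      have "snd c x \<in> B" "x \<in> fst c"
        using that by (auto simp: V_def)
      then have "s (snd c x) \<in> X" "snd c (f (s (snd c x))) = snd c x"
        using s(2,3) by (auto simp: F_def)
      then show ?thesis
        using chart_inv_snd[OF c(1)] \<open>x \<in> fst c\<close> unfolding X_def V_def by (metis IntD1 mem_Collect_eq)
    qed
    ultimately show ?thesis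
      using s(4) by (intro exI[of _ "\<lambda>x. s (snd c x)"]) (auto simp: F_def)
  qed
  with V show ?thesis by blast
qed

text \<open>Homotopies lift because the pull-back of \<open>f\<close> along \<open>H\<close> is a covering space of the square; this
  trades \<^typ>\<open>'m\<close>, which is no normed space, for the normed spaces of the library's lifting theorem.\<close>

lemma f_lift_square:
  fixes H :: "real \<times> real \<Rightarrow> 'm"
  defines "Q \<equiv> {0..1} \<times> {0..1}"
  assumes H: "continuous_on Q H" and z: "z \<in> Q" "H z = f a"
  obtains G where "continuous_on Q G" "\<And>x. x \<in> Q \<Longrightarrow> f (G x) = H x" "G z = a"
proof -
  have Qc: "convex Q"
    unfolding Q_def by (intro convex_Times convex_real_interval)
  \<comment> \<open>The pull-back of f along H. A section of its projection to Q is a lift of H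
    through f.\<close>
  define C where "C = {x. fst x \<in> Q \<and> H (fst x) = f (snd x)}"
  have cov: "covering_space C fst (fst ` C)" and "fst ` C = Q"
  proof -
    define EC where "EC T \<longleftrightarrow> (\<exists>v. \<Union>v = C \<inter> fst -` T \<and> (\<forall>u\<in>v. openin (top_of_set C) u) \<and> pairwise disjnt v \<and> (\<forall>u\<in>v. \<exists>q. homeomorphism u T fst q))" for T
    have loc: "\<exists>T. x \<in> T \<and> openin (top_of_set Q) T \<and> EC T
        \<and> (x \<in> fst ` C \<longrightarrow> T \<subseteq> fst ` C) \<and> (T \<inter> fst ` C \<noteq> {} \<longrightarrow> x \<in> fst ` C)" if x: "x \<in> Q" for x
    proof -
      obtain V where V: "open V" "H x \<in> V"
        and sec: "\<And>a0. f a0 \<in> V \<Longrightarrow> \<exists>s. continuous_on V s \<and> (\<forall>x\<in>V. f (s x) = x) \<and> s (f a0) = a0"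
        using f_section[of "H x"] by metis
      have "openin (top_of_set Q) (Q \<inter> H -` V)"
        using H V(1) by (rule continuous_openin_preimage_gen)
      then obtain \<delta> where \<delta>: "\<delta> > 0" "ball x \<delta> \<inter> Q \<subseteq> Q \<inter> H -` V"
        using V(2) x openin_contains_ball by (metis IntI vimageI2)
      \<comment> \<open>Convex as the intersection of two convex sets, hence connected; two sections
        that agree at one point of T then agree on T.\<close>
      define T where "T = Q \<inter> ball x \<delta>"
      have T: "x \<in> T" "openin (top_of_set Q) T" "H ` T \<subseteq> V" "T \<subseteq> Q"
        using \<delta> x by (auto simp: T_def)
      have Tc: "connected T"
        unfolding T_def by (intro convex_connected convex_Int Qc convex_ball)
      have HT: "continuous_on T H"
        using H T(4) by (rule continuous_on_subset)
      define S where "S = {s. continuous_on V s \<and> (\<forall>x\<in>V. f (s x) = x)}"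
      \<comment> \<open>The sheets over T: the graph of s after H for each local section s of f over
        V.\<close>
      define sh where "sh s = (\<lambda>x. (x, s (H x))) ` T" for s :: "'m \<Rightarrow> 'e"
      have sH: "continuous_on T (\<lambda>x. s (H x))" "\<And>x. x \<in> T \<Longrightarrow> f (s (H x)) = H x" if "s \<in> S" for s
        using that T(3) HT by (auto simp: S_def intro: continuous_on_compose2)
      have shC: "sh s \<subseteq> C" if "s \<in> S" for s
        using sH(2)[OF that] T(4) by (auto simp: sh_def C_def)
      have 1: "\<Union> (sh ` S) = C \<inter> fst -` T"
      proof (intro set_eqI iffI)
        fix w assume "w \<in> \<Union> (sh ` S)"
        then show "w \<in> C \<inter> fst -` T"
          using shC by (auto simp: sh_def)
      next
        fix w assume w: "w \<in> C \<inter> fst -` T"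
        then have w': "fst w \<in> T" "H (fst w) = f (snd w)"
          by (auto simp: C_def)
        moreover from this have "f (snd w) \<in> V"
          using T(3) by auto
        then obtain s where "s \<in> S" "s (f (snd w)) = snd w"
          using sec by (auto simp: S_def)
        ultimately have "w \<in> sh s"
          by (auto simp: sh_def image_iff intro!: bexI[of _ "fst w"] prod_eqI)
        with \<open>s \<in> S\<close> show "w \<in> \<Union> (sh ` S)" by blast
      qed
      have 2: "openin (top_of_set C) (sh s)" if s: "s \<in> S" for s
      proof (subst openin_subopen, intro ballI)
        fix w assume w: "w \<in> sh s"
        then have w': "fst w \<in> T" "snd w = s (H (fst w))"
          by (auto simp: sh_def)
        obtain U where U: "open U" "snd w \<in> U" "inj_on f U"
          using f_local_inj by blast
        have "openin (top_of_set T) (T \<inter> (\<lambda>x. s (H x)) -` U)"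
          using sH(1)[OF s] U(1) by (rule continuous_openin_preimage_gen)
        then have "openin (top_of_set Q) (T \<inter> (\<lambda>x. s (H x)) -` U)"
          using T(2) openin_trans by blast
        then obtain W where W: "open W" "T \<inter> (\<lambda>x. s (H x)) -` U = Q \<inter> W"
          by (auto simp: openin_open)
        have "openin (top_of_set C) (C \<inter> (W \<times> U))"
          using W(1) U(1) by (intro openin_open_Int open_Times)
        moreover have "w \<in> C \<inter> (W \<times> U)"
          using w w' shC[OF s] W(2) U(2) by (cases w) auto
        moreover have "C \<inter> (W \<times> U) \<subseteq> sh s"
        proof
          fix u assume u: "u \<in> C \<inter> (W \<times> U)"
          then have "fst u \<in> Q \<inter> W"
            by (auto simp: C_def)
          then have uT: "fst u \<in> T" "s (H (fst u)) \<in> U"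
            using W(2) by auto
          have "f (s (H (fst u))) = f (snd u)"
            using sH(2)[OF s uT(1)] u by (auto simp: C_def)
          then have "snd u = s (H (fst u))"
            using inj_onD[OF U(3) _ uT(2), of "snd u"] u by (simp add: mem_Times_iff)
          then show "u \<in> sh s"
            using uT(1) by (auto simp: sh_def image_iff intro!: bexI[of _ "fst u"] prod_eqI)
        qed
        ultimately show "\<exists>N. openin (top_of_set C) N \<and> w \<in> N \<and> N \<subseteq> sh s" by blast
      qed
      have 3: "pairwise disjnt (sh ` S)"
      proof -
        have "sh s = sh s'" if s: "s \<in> S" "s' \<in> S" and w: "w \<in> sh s" "w \<in> sh s'" for s s' w
        proof -
          obtain x0 where x0: "x0 \<in> T" "s (H x0) = s' (H x0)"
            using w by (auto simp: sh_def)
          have "s (H x) = s' (H x)" if "x \<in> T" for x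
            by (rule lift_unique[OF Tc sH(1)[OF s(1)] sH(1)[OF s(2)], where F = f, OF _ _ x0 that])
               (use f_local_inj sH(2) s in auto)
          then show ?thesis
            by (auto simp: sh_def)
        qed
        then show ?thesis
          unfolding pairwise_def disjnt_def by blast
      qed
      have 4: "\<exists>q. homeomorphism (sh s) T fst q" if "s \<in> S" for s
        unfolding homeomorphism_def
        by (intro exI[of _ "\<lambda>x. (x, s (H x))"] conjI continuous_intros sH(1)[OF that]) (auto simp: sh_def image_image)
      have 5: "T \<subseteq> fst ` C" if "s \<in> S" for s
      proof
        fix x assume "x \<in> T"
        then have "(x, s (H x)) \<in> C"
          using shC[OF that] by (auto simp: sh_def)
        then show "x \<in> fst ` C"
          by (rule image_eqI[rotated]) simp
      qed
      have 6: "S \<noteq> {}" if ne: "T \<inter> fst ` C \<noteq> {}"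
      proof -
        obtain w where "w \<in> C" "fst w \<in> T"
          using ne by blast
        then have "w \<in> \<Union> (sh ` S)"
          unfolding 1 by simp
        then show ?thesis
          by blast
      qed
      have "(x \<in> fst ` C \<longrightarrow> T \<subseteq> fst ` C) \<and> (T \<inter> fst ` C \<noteq> {} \<longrightarrow> x \<in> fst ` C)"
        using 5 6 T(1) by blast
      moreover have "EC T"
        unfolding EC_def
      proof (intro exI[of _ "sh ` S"] conjI ballI)
        show "\<exists>q. homeomorphism u T fst q" if "u \<in> sh ` S" for u
          using that 4 by (elim imageE) simp
        show "openin (top_of_set C) u" if "u \<in> sh ` S" for u
          using that 2 by (elim imageE) simp
      qed (rule 1 3)+
      ultimately show ?thesis
        using T(1,2) by blast
    qed
    have sub: "fst ` C \<subseteq> Q"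
      by (auto simp: C_def)
    \<comment> \<open>The projection of C is open and closed in Q and contains z, so it is all of Q.
      Thus every value of H is attained by f.\<close>
    have "openin (top_of_set Q) (fst ` C)"
    proof (subst openin_subopen, intro ballI)
      fix x assume x: "x \<in> fst ` C"
      then have "x \<in> Q"
        using sub by blast
      from loc[OF this] x show "\<exists>T. openin (top_of_set Q) T \<and> x \<in> T \<and> T \<subseteq> fst ` C"
        by blast
    qed
    moreover have "closedin (top_of_set Q) (fst ` C)"
    proof -
      have "openin (top_of_set Q) (Q - fst ` C)"
      proof (subst openin_subopen, intro ballI)
        fix x assume x: "x \<in> Q - fst ` C"
        then obtain T where "x \<in> T" "openin (top_of_set Q) T" "T \<inter> fst ` C = {}"
          using loc[of x] by blast
        moreover from this have "T \<subseteq> Q"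
          by (simp add: openin_imp_subset)
        ultimately show "\<exists>T. openin (top_of_set Q) T \<and> x \<in> T \<and> T \<subseteq> Q - fst ` C" by blast
      qed
      then show ?thesis
        using sub by (simp add: closedin_def)
    qed
    moreover have "(z, a) \<in> C"
      using z by (simp add: C_def)
    ultimately show CQ: "fst ` C = Q"
      using convex_connected[OF Qc] unfolding connected_clopen by blast
    show "covering_space C fst (fst ` C)"
      unfolding covering_space_def CQ
    proof (intro conjI ballI refl)
      show "continuous_on C fst"
        by (intro continuous_intros)
      fix x assume "x \<in> Q"
      from loc[OF this] show "\<exists>T. x \<in> T \<and> openin (top_of_set Q) T \<and>
          (\<exists>v. \<Union>v = C \<inter> fst -` T \<and> (\<forall>u\<in>v. openin (top_of_set C) u) \<and> pairwise disjnt v \<and> (\<forall>u\<in>v. \<exists>q. homeomorphism u T fst q))"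
        unfolding EC_def[symmetric] by blast
    qed
  qed
  have "simply_connected Q" "locally path_connected Q"
    using Qc by (auto intro: convex_imp_simply_connected convex_imp_locally_path_connected)
  then obtain G where G: "continuous_on Q G" "G \<in> Q \<rightarrow> C" "G z = (z, a)" "\<And>x. x \<in> Q \<Longrightarrow> fst (G x) = x"
    using covering_space_lift_strong[OF cov, of "(z, a)" z Q "\<lambda>x. x"] z \<open>fst ` C = Q\<close>
    by (auto simp: C_def)
  show thesis
  proof
    show "continuous_on Q (\<lambda>x. snd (G x))"
      by (intro continuous_intros G)
    show "f (snd (G x)) = H x" if "x \<in> Q" for x
      using G(2,4) that by (auto simp: C_def Pi_iff)
    show "snd (G z) = a"
      by (simp add: G(3))
  qed
qed

end

end

section \<open>Expanding maps into a Hadamard manifold have C1 inverses\<close>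

context hadamard_mfd
begin

context
  fixes f :: "'e \<Rightarrow> 'm" and m :: real
  assumes f: "C1_map f" and m: "m > 0" and expanding: "\<And>a w. m * norm w \<le> tnorm M (f a) (dmap f a w)"
begin

text \<open>If f a = f b, the segment from a to b maps to a loop, which contracts. In the lift G of
  the contraction the initial row is the segment and the final row is constant. The two sides lift
  the same path and agree at s = 1, hence also at s = 0, so a = b.\<close>

lemma expanding_inj: "inj f"
proof (rule injI)
  fix a b assume ab: "f a = f b"
  define l where "l = (\<lambda>t. f (linepath a b t))"
  have cl: "continuous_on {0..1} l"
    unfolding l_def
    by (rule continuous_on_compose2[OF conjunct1[OF f[unfolded C1_map_def]]]) (auto intro!: continuous_intros simp: linepath_def)
  have "homotopic_loops UNIV l (\<lambda>t. f a)"
    using sc cl ab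
    by (auto simp: simply_connected_def path_def pathstart_def pathfinish_def l_def linepath_def)
  then obtain H :: "real \<times> real \<Rightarrow> 'm" where H: "continuous_on ({0..1} \<times> {0..1}) H" "\<And>t. t \<in> {0..1} \<Longrightarrow> H (0, t) = l t"
    "\<And>t. t \<in> {0..1} \<Longrightarrow> H (1, t) = f a" "\<And>s. s \<in> {0..1} \<Longrightarrow> H (s, 0) = H (s, 1)"
    unfolding homotopic_loops pathstart_def pathfinish_def o_def by metis
  obtain G where G: "continuous_on ({0..1} \<times> {0..1}) G" "\<And>x. x \<in> {0..1} \<times> {0..1} \<Longrightarrow> f (G x) = H x" "G (0, 0) = a"
    using f_lift_square[OF f m expanding H(1), of "(0, 0)" a] H(2)[of 0] by (auto simp: l_def linepath_def)
  have row: "continuous_on {0..1} (\<lambda>t. G (s, t))" if "s \<in> {0..1}" for s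
    by (rule continuous_on_compose2[OF G(1)]) (use that in \<open>auto intro!: continuous_intros\<close>)
  have col: "continuous_on {0..1} (\<lambda>s. G (s, t))" if "t \<in> {0..1}" for t
    by (rule continuous_on_compose2[OF G(1)]) (use that in \<open>auto intro!: continuous_intros\<close>)
  note uniq = lift_unique[of "{0..1::real}" _ _ f, OF _ _ _ f_local_inj[OF f m expanding]]
  have "G (0, 1) = linepath a b 1"
    by (rule uniq[of "\<lambda>t. G (0, t)" "linepath a b" 0])
       (use row G H in \<open>auto simp: l_def intro!: continuous_intros simp: linepath_def\<close>)
  then have 1: "G (0, 1) = b"
    by (simp add: linepath_def)
  have 2: "G (1, 0) = G (1, 1)"
    by (rule uniq[of "\<lambda>t. G (1, t)" "\<lambda>t. G (1, 1)" 1])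
       (use row G H in auto)
  have "G (0, 0) = G (0, 1)"
    by (rule uniq[of "\<lambda>s. G (s, 0)" "\<lambda>s. G (s, 1)" 1])
       (use col G H 2 in auto)
  then show "a = b"
    using 1 G(3) by simp
qed

text \<open>In \<open>simply_connected\<close> any two loops are homotopic through loops; for the
  constant loops at x and y the track of the base point is a path from x to y.\<close>

lemma connected_manifold: "connected (UNIV :: 'm set)"
  unfolding connected_iff_connected_component
proof (intro ballI)
  fix x y :: 'm
  have "homotopic_loops UNIV (\<lambda>t. x) (\<lambda>t. y)"
    using sc by (auto simp: simply_connected_def path_def pathstart_def pathfinish_def)
  then obtain h :: "real \<times> real \<Rightarrow> 'm" where h: "continuous_on ({0..1} \<times> {0..1}) h" "\<And>t. t \<in> {0..1} \<Longrightarrow> h (0, t) = x"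
    "\<And>t. t \<in> {0..1} \<Longrightarrow> h (1, t) = y"
    unfolding homotopic_loops by blast
  have "continuous_on {0..1} (\<lambda>s. h (s, 0))"
    by (rule continuous_on_compose2[OF h(1)]) (auto intro!: continuous_intros)
  then have "connected ((\<lambda>s. h (s, 0)) ` {0..1})"
    by (intro connected_continuous_image) auto
  moreover have "x \<in> (\<lambda>s. h (s, 0)) ` {0..1}" "y \<in> (\<lambda>s. h (s, 0)) ` {0..1}"
    using h(2,3)[of 0] by (auto intro: image_eqI[of _ _ 0] image_eqI[of _ _ 1])
  ultimately show "connected_component UNIV x y"
    unfolding connected_component_def by blast
qed

text \<open>\<open>f_section\<close> at a point of the image shows that the image is open, and at a
  point outside it that the complement is open.\<close>

lemma expanding_surj: "surj f"
proof -
  have "open (range f)"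
  proof (subst open_subopen, clarify)
    fix a
    obtain V where "open V" "f a \<in> V" "\<And>a0. f a0 \<in> V \<Longrightarrow> \<exists>s. continuous_on V s \<and> (\<forall>x\<in>V. f (s x) = x) \<and> s (f a0) = a0"
      using f_section[OF f m expanding, of "f a"] by metis
    then show "\<exists>T. open T \<and> f a \<in> T \<and> T \<subseteq> range f"
      by (metis rangeI subsetI)
  qed
  moreover have "open (- range f)"
  proof (subst open_subopen, intro ballI)
    fix y assume y: "y \<in> - range f"
    obtain V where V: "open V" "y \<in> V" "\<And>a0. f a0 \<in> V \<Longrightarrow> \<exists>s. continuous_on V s \<and> (\<forall>x\<in>V. f (s x) = x) \<and> s (f a0) = a0"
      using f_section[OF f m expanding, of y] by metis
    have "V \<subseteq> - range f"
    proof (rule ccontr)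
      assume "\<not> V \<subseteq> - range f"
      then obtain a0 where "f a0 \<in> V" by blast
      then show False
        using V(2,3) y by (metis ComplD rangeI)
    qed
    with V(1,2) show "\<exists>T. open T \<and> y \<in> T \<and> T \<subseteq> - range f" by blast
  qed
  ultimately show ?thesis
    using connected_manifold unfolding connected_clopen
    by (metis UNIV_I closed_closedin closed_def empty_iff open_openin rangeI subtopology_UNIV)
qed

text \<open>By injectivity a local section coincides with the inverse.\<close>

lemma expanding_inv_cont: "continuous_on UNIV (inv f)"
proof (rule continuous_at_imp_continuous_on, intro ballI)
  fix y
  obtain V where V: "open V" "y \<in> V" and sec: "\<And>a0. f a0 \<in> V \<Longrightarrow> \<exists>s. continuous_on V s \<and> (\<forall>x\<in>V. f (s x) = x) \<and> s (f a0) = a0"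
    using f_section[OF f m expanding, of y] by metis
  have y: "f (inv f y) = y"
    using expanding_surj by (rule surj_f_inv_f)
  obtain s where s: "continuous_on V s" "\<And>x. x \<in> V \<Longrightarrow> f (s x) = x"
    using sec[of "inv f y"] V(2) unfolding y by blast
  have "continuous_on V (inv f)"
    by (rule continuous_on_eq[OF s(1)]) (metis s(2) expanding_inj inv_f_f)
  then show "isCont (inv f) y"
    using V by (simp add: continuous_on_eq_continuous_at)
qed

text \<open>Near z the inverse is the C1 local inverse of the coordinate expression of f.\<close>

lemma expanding_inv_C1:
  assumes c: "c \<in> atlas M"
  shows "C1_on (chart_image c) (\<lambda>z. inv f (chart_inv c z))"
proof (rule C1_on_Un_local[OF chart_homeo(3)[OF c]])
  fix z assume z: "z \<in> chart_image c"
  define a where "a = inv f (chart_inv c z)"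
  have a: "f a = chart_inv c z"
    unfolding a_def using expanding_surj by (rule surj_f_inv_f)
  then have fa: "f a \<in> fst c" "snd c (f a) = z"
    using c z by simp_all
  obtain U V g where U: "open U" "a \<in> U" "U \<subseteq> {b. f b \<in> fst c}" "open V" "snd c (f a) \<in> V"
    "homeomorphism U V (\<lambda>b. snd c (f b)) g" "C1_on V g"
    by (rule f_local_inverse[OF f m expanding c fa(1)])
  have "g y = inv f (chart_inv c y)" if "y \<in> V" for y
  proof -
    have "g y \<in> U" "snd c (f (g y)) = y"
      using homeomorphism_apply2[OF U(6) that] homeomorphism_image2[OF U(6)] that by auto
    then have "f (g y) = chart_inv c y"
      using U(3) c by (metis chart_inv_snd mem_Collect_eq subsetD)
    then show ?thesis
      by (metis expanding_inj inv_f_f)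
  qed
  then have "C1_on V (\<lambda>z. inv f (chart_inv c z))"
    by (rule C1_on_cong[OF _ U(7)])
  then show "\<exists>T. z \<in> T \<and> C1_on T (\<lambda>z. inv f (chart_inv c z))"
    using U(5) fa(2) by auto
qed

end

lemma rexp_expanding_norm:
  obtains m where "m > 0" "\<And>a w. m * norm w \<le> tnorm M (rexp M q a) (dmap (rexp M q) a w)"
  using tnorm_lower[of q] rexp_expanding[of q] order_trans by metis

text \<open>The Cartan-Hadamard theorem, as bijectivity together with a C1 inverse. The expansion
  constant m comes from comparing the norm at q with the Euclidean norm, so it may depend on
  q.\<close>

lemma rexp_bij: "bij (rexp M q)"
  and rexp_inv_cont: "continuous_on UNIV (rexp_inv M q)"
  and rexp_inv_C1: "c \<in> atlas M \<Longrightarrow> C1_on (chart_image c) (\<lambda>z. rexp_inv M q (chart_inv c z))"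
proof -
  obtain m where m: "m > 0" "\<And>a w. m * norm w \<le> tnorm M (rexp M q a) (dmap (rexp M q) a w)"
    using rexp_expanding_norm[of q] by blast
  show "bij (rexp M q)"
    using expanding_inj[OF rexp_C1_map m] expanding_surj[OF rexp_C1_map m] by (rule bijI)
  show "continuous_on UNIV (rexp_inv M q)"
    unfolding rexp_inv_def by (rule expanding_inv_cont[OF rexp_C1_map m])
  show "c \<in> atlas M \<Longrightarrow> C1_on (chart_image c) (\<lambda>z. rexp_inv M q (chart_inv c z))"
    unfolding rexp_inv_def by (rule expanding_inv_C1[OF rexp_C1_map m])
qed

lemma rexp_inv [simp]: "rexp M q (rexp_inv M q x) = x" "rexp_inv M q (rexp M q v) = v"
  using rexp_bij[of q] by (auto simp: rexp_inv_def bij_is_surj surj_f_inv_f bij_is_inj)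

end

section \<open>Length of curves\<close>

text \<open>\<open>velocity\<close> may have arbitrary values at the kinks and end points of a
  curve, so integrands are compared off a finite set.\<close>

lemma integral_le_off_finite:
  fixes f g :: "real \<Rightarrow> real"
  assumes f: "f integrable_on {a..b}" and g: "g integrable_on {a..b}" and S: "finite S"
    and le: "\<And>t. t \<in> {a<..<b} - S \<Longrightarrow> f t \<le> g t"
  shows "integral {a..b} f \<le> integral {a..b} g"
proof -
  let ?S = "S \<union> {a, b}"
  let ?f = "\<lambda>t. if t \<in> ?S then 0 else f t" and ?g = "\<lambda>t. if t \<in> ?S then 0 else g t"
  have "(?f has_integral integral {a..b} f) {a..b}"
    by (rule has_integral_spike_finite[of ?S _ _ f]) (use S f in \<open>auto simp: integrable_integral\<close>)
  moreover have "(?g has_integral integral {a..b} g) {a..b}"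
    by (rule has_integral_spike_finite[of ?S _ _ g]) (use S g in \<open>auto simp: integrable_integral\<close>)
  ultimately show ?thesis
    by (rule has_integral_le) (use le in auto)
qed

context riemannian_mfd
begin

definition speed :: "(real \<Rightarrow> 'm) \<Rightarrow> real \<Rightarrow> real" where
  "speed \<gamma> t = tnorm M (\<gamma> t) (velocity M \<gamma> t)"

lemma curve_length_speed: "curve_length M \<gamma> = integral {0..1} (speed \<gamma>)"
  by (simp add: curve_length_def speed_def[abs_def])

lemma tnorm_nonneg: "tnorm M x u \<ge> 0"
proof -
  have "metric M x u u \<ge> 0"
    using metric_pos[of u x] bilinear_lzero[OF metric_bilinear[of x]] by (cases "u = 0") auto
  then show ?thesis
    by (simp add: tnorm_def)
qed

lemma tnorm_scale: "tnorm M x (r *\<^sub>R u) = \<bar>r\<bar> * tnorm M x u"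
  using metric_bilinear[of x] real_sqrt_mult[of "r\<^sup>2" "metric M x u u"]
  by (simp add: tnorm_def bilinear_lmul bilinear_rmul power2_eq_square mult.assoc)

lemma tnorm_0 [simp]: "tnorm M x 0 = 0"
  using metric_bilinear[of x] by (simp add: tnorm_def bilinear_lzero)

lemma tnorm_pos: "u \<noteq> 0 \<Longrightarrow> tnorm M x u > 0"
  by (simp add: tnorm_def metric_pos)

lemma tnorm_minus [simp]: "tnorm M x (- u) = tnorm M x u"
  using tnorm_scale[of x "-1" u] by simp

lemma tnorm_CS: "metric M x u w \<le> tnorm M x u * tnorm M x w"
proof -
  have "(metric M x u w)\<^sup>2 \<le> metric M x u u * metric M x w w"
    by (rule bilinear_CS(1)[OF metric_bilinear metric_sym metric_pos])
  then have "sqrt ((metric M x u w)\<^sup>2) \<le> sqrt (metric M x u u * metric M x w w)"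
    by (rule real_sqrt_le_mono)
  then show ?thesis
    by (simp add: tnorm_def real_sqrt_mult)
qed

text \<open>\<open>velocity\<close> is a total function, so genuine differentiability at t has to be
  recorded; continuity is included for the change of charts.\<close>

definition vdiff :: "(real \<Rightarrow> 'm) \<Rightarrow> real \<Rightarrow> bool" where
  "vdiff \<gamma> t \<longleftrightarrow> isCont \<gamma> t \<and> (snd (chart_at M (\<gamma> t)) \<circ> \<gamma> has_vector_derivative velocity M \<gamma> t) (at t)"

lemma vdiffI:
  assumes c: "c \<in> atlas M" "\<gamma> t \<in> fst c" and "isCont \<gamma> t" and d: "(snd c \<circ> \<gamma> has_vector_derivative u) (at t)"
  shows "vdiff \<gamma> t" "velocity M \<gamma> t = dd (tr c (chart_at M (\<gamma> t))) (snd c (\<gamma> t)) u"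
    "speed \<gamma> t = sqrt (gm c (snd c (\<gamma> t)) u u)"
proof -
  have *: "(snd (chart_at M (\<gamma> t)) \<circ> \<gamma> has_vector_derivative dd (tr c (chart_at M (\<gamma> t))) (snd c (\<gamma> t)) u) (at t)"
    by (rule chart_change_vector_derivative[where f = \<gamma> and x = t, OF c(1) chart_at(1) c(2) chart_at(2) UNIV_I assms(3) d])
  then show v: "velocity M \<gamma> t = dd (tr c (chart_at M (\<gamma> t))) (snd c (\<gamma> t)) u"
    by (simp add: velocity_def vector_derivative_at)
  show "vdiff \<gamma> t"
    using * assms(3) by (simp add: vdiff_def v)
  show "speed \<gamma> t = sqrt (gm c (snd c (\<gamma> t)) u u)"
    using gm_change[OF c(1) chart_at(1) c(2) chart_at(2)] by (simp add: speed_def v tnorm_def gm_chart_at)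
qed

lemma vdiff_cong:
  assumes "vdiff \<gamma> t" "open T" "t \<in> T" "\<And>s. s \<in> T \<Longrightarrow> \<gamma> s = \<sigma> s"
  shows "vdiff \<sigma> t" "speed \<sigma> t = speed \<gamma> t"
proof -
  let ?c = "chart_at M (\<gamma> t)"
  have eq: "\<gamma> t = \<sigma> t"
    using assms by simp
  have "isCont \<sigma> t"
    using assms(1) unfolding vdiff_def isCont_def eq
    by (metis Lim_transform_within_open assms(2-4) eq)
  moreover have "(snd ?c \<circ> \<sigma> has_vector_derivative velocity M \<gamma> t) (at t)"
    by (rule has_vector_derivative_transform_within_open[of "snd ?c \<circ> \<gamma>" _ _ T]) (use assms in \<open>auto simp: vdiff_def\<close>)
  ultimately show "vdiff \<sigma> t" "speed \<sigma> t = speed \<gamma> t"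
    using vdiffI[of ?c \<sigma> t] chart_at[of "\<gamma> t"] gm_chart_at[of "\<gamma> t"] by (simp_all add: eq speed_def tnorm_def)
qed

lemma vdiff_affine:
  assumes v: "vdiff \<gamma> (r * t + s)"
  shows "vdiff (\<lambda>t. \<gamma> (r * t + s)) t" "speed (\<lambda>t. \<gamma> (r * t + s)) t = \<bar>r\<bar> * speed \<gamma> (r * t + s)"
proof -
  let ?c = "chart_at M (\<gamma> (r * t + s))"
  have aff: "((\<lambda>t. r * t + s) has_vector_derivative r) (at t)"
    by (auto intro!: derivative_eq_intros simp: has_real_derivative_iff_has_vector_derivative[symmetric])
  have d: "(snd ?c \<circ> (\<lambda>t. \<gamma> (r * t + s)) has_vector_derivative r *\<^sub>R velocity M \<gamma> (r * t + s)) (at t)"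
    using vector_diff_chain_at[OF aff, of "snd ?c \<circ> \<gamma>"] v by (simp add: o_def vdiff_def)
  have "isCont (\<lambda>t. \<gamma> (r * t + s)) t"
  proof (rule isCont_o2[where f = "\<lambda>t. r * t + s"])
    show "isCont (\<lambda>t. r * t + s) t"
      by (intro continuous_intros)
    show "isCont \<gamma> (r * t + s)"
      using v by (simp add: vdiff_def)
  qed
  note * = vdiffI[OF chart_at this d]
  show "vdiff (\<lambda>t. \<gamma> (r * t + s)) t" "speed (\<lambda>t. \<gamma> (r * t + s)) t = \<bar>r\<bar> * speed \<gamma> (r * t + s)"
    using *(1,3) tnorm_scale[of "\<gamma> (r * t + s)" r] by (simp_all add: gm_chart_at speed_def tnorm_def)
qed

section \<open>C1 and piecewise C1 curves\<close>

lemma C1_curve_subset: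
  assumes "C1_curve_on M a b \<gamma>" "{a'..b'} \<subseteq> {a..b}"
  shows "C1_curve_on M a' b' \<gamma>"
  unfolding C1_curve_on_def
proof (intro conjI ballI)
  show "continuous_on {a'..b'} \<gamma>"
    using assms by (auto simp: C1_curve_on_def intro: continuous_on_subset)
  fix c assume "c \<in> atlas M"
  then obtain \<gamma>' where \<gamma>': "continuous_on {t \<in> {a..b}. \<gamma> t \<in> fst c} \<gamma>'"
    "\<And>t. t \<in> {a..b} \<Longrightarrow> \<gamma> t \<in> fst c \<Longrightarrow> (snd c \<circ> \<gamma> has_vector_derivative \<gamma>' t) (at t within {a..b})"
    using assms(1) unfolding C1_curve_on_def by blast
  show "\<exists>\<gamma>'. continuous_on {t \<in> {a'..b'}. \<gamma> t \<in> fst c} \<gamma>' \<and>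
      (\<forall>t\<in>{a'..b'}. \<gamma> t \<in> fst c \<longrightarrow> (snd c \<circ> \<gamma> has_vector_derivative \<gamma>' t) (at t within {a'..b'}))"
  proof (intro exI[of _ \<gamma>'] conjI ballI impI)
    show "continuous_on {t \<in> {a'..b'}. \<gamma> t \<in> fst c} \<gamma>'"
      by (rule continuous_on_subset[OF \<gamma>'(1)]) (use assms(2) in blast)
    show "(snd c \<circ> \<gamma> has_vector_derivative \<gamma>' t) (at t within {a'..b'})" if "t \<in> {a'..b'}" "\<gamma> t \<in> fst c" for t
      by (rule has_vector_derivative_within_subset[OF \<gamma>'(2) assms(2)]) (use that assms(2) in blast)+
  qed
qed

lemma C1_curve_cong:
  assumes "C1_curve_on M a b \<gamma>" and eq: "\<And>t. t \<in> {a..b} \<Longrightarrow> \<gamma> t = \<sigma> t"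
  shows "C1_curve_on M a b \<sigma>"
  unfolding C1_curve_on_def
proof (intro conjI ballI)
  show "continuous_on {a..b} \<sigma>"
    using assms by (auto simp: C1_curve_on_def intro: continuous_on_eq)
  fix c assume "c \<in> atlas M"
  then obtain \<gamma>' where \<gamma>': "continuous_on {t \<in> {a..b}. \<gamma> t \<in> fst c} \<gamma>'"
    "\<And>t. t \<in> {a..b} \<Longrightarrow> \<gamma> t \<in> fst c \<Longrightarrow> (snd c \<circ> \<gamma> has_vector_derivative \<gamma>' t) (at t within {a..b})"
    using assms(1) unfolding C1_curve_on_def by blast
  have "{t \<in> {a..b}. \<sigma> t \<in> fst c} = {t \<in> {a..b}. \<gamma> t \<in> fst c}"
    using eq by auto
  moreover have "(snd c \<circ> \<sigma> has_vector_derivative \<gamma>' t) (at t within {a..b})"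
    if "t \<in> {a..b}" "\<sigma> t \<in> fst c" for t
    by (rule has_vector_derivative_transform[OF that(1) _ \<gamma>'(2)]) (use that eq in auto)
  ultimately show "\<exists>\<gamma>'. continuous_on {t \<in> {a..b}. \<sigma> t \<in> fst c} \<gamma>' \<and>
      (\<forall>t\<in>{a..b}. \<sigma> t \<in> fst c \<longrightarrow> (snd c \<circ> \<sigma> has_vector_derivative \<gamma>' t) (at t within {a..b}))"
    using \<gamma>'(1) by auto
qed

lemma C1_curve_affine:
  assumes "C1_curve_on M a b \<gamma>" and im: "\<And>t. t \<in> {a'..b'} \<Longrightarrow> r * t + s \<in> {a..b}"
  shows "C1_curve_on M a' b' (\<lambda>t. \<gamma> (r * t + s))"
  unfolding C1_curve_on_def
proof (intro conjI ballI)
  show "continuous_on {a'..b'} (\<lambda>t. \<gamma> (r * t + s))"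
    by (rule continuous_on_compose2[of "{a..b}" \<gamma>])
       (use assms in \<open>auto simp: C1_curve_on_def intro!: continuous_intros\<close>)
  fix c assume "c \<in> atlas M"
  then obtain \<gamma>' where \<gamma>': "continuous_on {t \<in> {a..b}. \<gamma> t \<in> fst c} \<gamma>'"
    "\<And>t. t \<in> {a..b} \<Longrightarrow> \<gamma> t \<in> fst c \<Longrightarrow> (snd c \<circ> \<gamma> has_vector_derivative \<gamma>' t) (at t within {a..b})"
    using assms(1) unfolding C1_curve_on_def by blast
  have aff: "((\<lambda>t. r * t + s) has_vector_derivative r) (at t within {a'..b'})" for t
    by (auto intro!: derivative_eq_intros simp: has_real_derivative_iff_has_vector_derivative[symmetric])
  have d: "(snd c \<circ> (\<lambda>t. \<gamma> (r * t + s)) has_vector_derivative r *\<^sub>R \<gamma>' (r * t + s)) (at t within {a'..b'})"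
    if "t \<in> {a'..b'}" "\<gamma> (r * t + s) \<in> fst c" for t
  proof -
    have "(snd c \<circ> \<gamma> has_vector_derivative \<gamma>' (r * t + s)) (at (r * t + s) within (\<lambda>t. r * t + s) ` {a'..b'})"
      using \<gamma>'(2)[OF im[OF that(1)] that(2)] by (rule has_vector_derivative_within_subset) (use im in auto)
    from vector_diff_chain_within[OF aff this] show ?thesis
      by (simp add: o_def)
  qed
  have "continuous_on {t \<in> {a'..b'}. \<gamma> (r * t + s) \<in> fst c} (\<lambda>t. r *\<^sub>R \<gamma>' (r * t + s))"
    by (intro continuous_on_scaleR continuous_on_const continuous_on_compose2[OF \<gamma>'(1), of _ "\<lambda>t. r * t + s"])
       (use im in \<open>auto intro!: continuous_intros\<close>)
  with d show "\<exists>\<gamma>'. continuous_on {t \<in> {a'..b'}. \<gamma> (r * t + s) \<in> fst c} \<gamma>' \<and>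
      (\<forall>t\<in>{a'..b'}. \<gamma> (r * t + s) \<in> fst c \<longrightarrow> (snd c \<circ> (\<lambda>t. \<gamma> (r * t + s)) has_vector_derivative \<gamma>' t) (at t within {a'..b'}))"
    by (intro exI[of _ "\<lambda>t. r *\<^sub>R \<gamma>' (r * t + s)"]) auto
qed

lemma C1_curve_vdiff:
  assumes "C1_curve_on M a b \<gamma>" "t \<in> {a<..<b}"
  shows "vdiff \<gamma> t"
proof -
  let ?c = "chart_at M (\<gamma> t)"
  obtain \<gamma>' where \<gamma>': "\<And>s. s \<in> {a..b} \<Longrightarrow> \<gamma> s \<in> fst ?c \<Longrightarrow> (snd ?c \<circ> \<gamma> has_vector_derivative \<gamma>' s) (at s within {a..b})"
    using assms(1) chart_at(1)[of "\<gamma> t"] unfolding C1_curve_on_def by blast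
  have i: "at t within {a..b} = at t"
    using assms(2) by (intro at_within_interior) (simp add: interior_atLeastAtMost_real)
  have "(snd ?c \<circ> \<gamma> has_vector_derivative \<gamma>' t) (at t)"
    using \<gamma>'[of t] assms(2) chart_at i by auto
  moreover have "isCont \<gamma> t"
  proof -
    have "continuous (at t within {a..b}) \<gamma>"
      using assms by (auto simp: C1_curve_on_def continuous_on_eq_continuous_within)
    then show ?thesis
      by (simp add: i)
  qed
  ultimately show ?thesis
    using vdiffI(1) chart_at by blast
qed

text \<open>Integrability is local. On short intervals inside one chart the speed is a continuous
  function except possibly at the end points, where \<open>velocity\<close> asks for a two-sided
  derivative.\<close>

lemma C1_curve_speed_integrable:
  assumes \<gamma>: "C1_curve_on M a b \<gamma>"
  shows "speed \<gamma> integrable_on {a..b}"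
proof -
  have "speed \<gamma> integrable_on cbox a b"
  proof (rule integrable_on_little_subintervals, intro ballI)
    fix t assume t: "t \<in> cbox a b"
    let ?c = "chart_at M (\<gamma> t)"
    obtain \<gamma>' where \<gamma>': "continuous_on {t \<in> {a..b}. \<gamma> t \<in> fst ?c} \<gamma>'"
      "\<And>s. s \<in> {a..b} \<Longrightarrow> \<gamma> s \<in> fst ?c \<Longrightarrow> (snd ?c \<circ> \<gamma> has_vector_derivative \<gamma>' s) (at s within {a..b})"
      using \<gamma> chart_at(1)[of "\<gamma> t"] unfolding C1_curve_on_def by blast
    have cont: "continuous_on {a..b} \<gamma>"
      using \<gamma> by (simp add: C1_curve_on_def)
    have "openin (top_of_set {a..b}) ({a..b} \<inter> \<gamma> -` fst ?c)"
      by (rule continuous_openin_preimage_gen[OF cont chart_homeo(2)[OF chart_at(1)]])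
    moreover have "t \<in> {a..b} \<inter> \<gamma> -` fst ?c"
      using t chart_at by auto
    ultimately obtain d where d: "d > 0" "ball t d \<inter> {a..b} \<subseteq> {a..b} \<inter> \<gamma> -` fst ?c"
      unfolding openin_contains_ball by blast
    have "speed \<gamma> integrable_on cbox u v" if uv: "t \<in> cbox u v" "cbox u v \<subseteq> ball t d" "cbox u v \<subseteq> cbox a b" for u v
    proof -
      have N: "{u..v} \<subseteq> {t \<in> {a..b}. \<gamma> t \<in> fst ?c}"
        using uv d(2) by auto
      have le: "a \<le> u" "v \<le> b"
        using uv by auto
      let ?h = "\<lambda>s. sqrt (gm ?c (snd ?c (\<gamma> s)) (\<gamma>' s) (\<gamma>' s))"
      have "continuous_on {u..v} (\<lambda>s. (snd ?c (\<gamma> s), \<gamma>' s))"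
        by (intro continuous_on_Pair continuous_on_compose2[OF chart_cont[OF chart_at(1)]]
            continuous_on_subset[OF \<gamma>'(1) N] continuous_on_subset[OF cont]) (use N in auto)
      then have "continuous_on {u..v} (\<lambda>s. (\<lambda>z. gm ?c (fst z) (snd z) (snd z)) (snd ?c (\<gamma> s), \<gamma>' s))"
        by (rule continuous_on_compose2[OF gm_cont[OF chart_at(1)]]) (use N in auto)
      then have "continuous_on {u..v} ?h"
        by (intro continuous_on_real_sqrt) simp
      then have "?h integrable_on {u..v}"
        by (rule integrable_continuous_real)
      then have "speed \<gamma> integrable_on {u..v}"
      proof (rule integrable_spike_finite[of "{u, v}", rotated 2])
        fix s assume s: "s \<in> {u..v} - {u, v}"
        then have s': "s \<in> {a<..<b}" "s \<in> {a..b}" "\<gamma> s \<in> fst ?c"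
          using N le by auto
        have "at s within {a..b} = at s"
          using s'(1) by (intro at_within_interior) (simp add: interior_atLeastAtMost_real)
        then show "speed \<gamma> s = ?h s"
          using vdiffI(3)[where \<gamma> = \<gamma> and t = s and u = "\<gamma>' s", OF chart_at(1) s'(3)] \<gamma>'(2)[OF s'(2,3)] C1_curve_vdiff[OF \<gamma> s'(1)]
          by (simp add: vdiff_def)
      qed simp
      then show ?thesis by simp
    qed
    with d(1) show "\<exists>d>0. \<forall>u v. t \<in> cbox u v \<and> cbox u v \<subseteq> ball t d \<and> cbox u v \<subseteq> cbox a b \<longrightarrow> speed \<gamma> integrable_on cbox u v"
      by blast
  qed
  then show ?thesis by simp
qed

lemma finite_gap:
  fixes S :: "real set"
  assumes "finite S"
  obtains d where "d > 0" "\<And>s. s \<in> S \<Longrightarrow> \<bar>s - t\<bar> < d \<Longrightarrow> s = t"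
proof -
  obtain d where "d > 0" "\<forall>s\<in>S. s \<noteq> t \<longrightarrow> d \<le> dist t s"
    using finite_set_avoid[OF assms] by blast
  then show thesis
    by (intro that[of d]) (auto simp: dist_real_def abs_minus_commute not_less[symmetric])
qed

lemma piecewise_C1_vdiff:
  assumes "piecewise_C1_curve M \<gamma>"
  obtains S where "finite S" "\<And>t. t \<in> {0<..<1} - S \<Longrightarrow> vdiff \<gamma> t"
proof -
  obtain S where S: "finite S" "\<And>a b. 0 \<le> a \<Longrightarrow> a < b \<Longrightarrow> b \<le> 1 \<Longrightarrow> {a<..<b} \<inter> S = {} \<Longrightarrow> C1_curve_on M a b \<gamma>"
    using assms unfolding piecewise_C1_curve_def by blast
  have "vdiff \<gamma> t" if t: "t \<in> {0<..<1} - S" for t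
  proof -
    obtain d where d: "d > 0" "\<And>s. s \<in> S \<Longrightarrow> \<bar>s - t\<bar> < d \<Longrightarrow> s = t"
      using finite_gap[OF S(1)] by blast
    let ?a = "max 0 (t - d)" and ?b = "min 1 (t + d)"
    have "{?a<..<?b} \<inter> S = {}"
    proof (rule equals0I)
      fix s assume s: "s \<in> {?a<..<?b} \<inter> S"
      then have "\<bar>s - t\<bar> < d"
        by auto
      then show False
        using d(2)[of s] s t by auto
    qed
    then have "C1_curve_on M ?a ?b \<gamma>"
      using t d by (intro S(2)) auto
    then show ?thesis
      by (rule C1_curve_vdiff) (use t d in auto)
  qed
  with S(1) that show thesis by blast
qed

text \<open>Near any t the only possible kink is t itself, so short intervals are split at
  t.\<close>

lemma piecewise_C1_integrable:
  assumes "piecewise_C1_curve M \<gamma>"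
  shows "speed \<gamma> integrable_on {0..1}"
proof -
  obtain S where S: "finite S" "\<And>a b. 0 \<le> a \<Longrightarrow> a < b \<Longrightarrow> b \<le> 1 \<Longrightarrow> {a<..<b} \<inter> S = {} \<Longrightarrow> C1_curve_on M a b \<gamma>"
    using assms unfolding piecewise_C1_curve_def by blast
  have "speed \<gamma> integrable_on cbox 0 1"
  proof (rule integrable_on_little_subintervals, intro ballI)
    fix t :: real assume t: "t \<in> cbox 0 1"
    obtain d where d: "d > 0" "\<And>s. s \<in> S \<Longrightarrow> \<bar>s - t\<bar> < d \<Longrightarrow> s = t"
      using finite_gap[OF S(1)] by blast
    have *: "speed \<gamma> integrable_on {a..b}"
      if "a \<le> b" "0 \<le> a" "b \<le> 1" "\<And>s. s \<in> {a<..<b} \<Longrightarrow> s \<noteq> t \<and> \<bar>s - t\<bar> < d" for a b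
    proof (cases "a = b")
      case False
      have "{a<..<b} \<inter> S = {}"
      proof (rule equals0I)
        fix s assume s: "s \<in> {a<..<b} \<inter> S"
        then show False
          using d(2)[of s] that(4)[of s] by auto
      qed
      then have "C1_curve_on M a b \<gamma>"
        using that False by (intro S(2)) auto
      then show ?thesis
        by (rule C1_curve_speed_integrable)
    qed (use integrable_on_refl[of "speed \<gamma>" b] in simp)
    have "speed \<gamma> integrable_on cbox u v" if uv: "t \<in> cbox u v" "cbox u v \<subseteq> ball t d" "cbox u v \<subseteq> cbox 0 1" for u v
    proof -
      have b: "\<bar>s - t\<bar> < d" "0 \<le> s" "s \<le> 1" if "s \<in> {u..v}" for s
        using uv(2,3) that by (force simp: dist_real_def)+
      have t': "u \<le> t" "t \<le> v"
        using uv(1) by auto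
      have near: "s \<noteq> t \<and> \<bar>s - t\<bar> < d" if "s \<in> {u<..<t} \<union> {t<..<v}" for s
        using b(1)[of s] that t' by auto
      have "speed \<gamma> integrable_on {u..t}"
      proof (rule *)
        show "s \<noteq> t \<and> \<bar>s - t\<bar> < d" if "s \<in> {u<..<t}" for s
          by (rule near) (use that in simp)
      qed (use t' b(2)[of u] b(3)[of t] in auto)
      moreover have "speed \<gamma> integrable_on {t..v}"
      proof (rule *)
        show "s \<noteq> t \<and> \<bar>s - t\<bar> < d" if "s \<in> {t<..<v}" for s
          by (rule near) (use that in simp)
      qed (use t' b(2)[of t] b(3)[of v] in auto)
      ultimately have "speed \<gamma> integrable_on {u..v}"
        using uv(1) by (intro Henstock_Kurzweil_Integration.integrable_combine[of u t v]) auto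
      then show ?thesis by simp
    qed
    with d(1) show "\<exists>d>0. \<forall>u v. t \<in> cbox u v \<and> cbox u v \<subseteq> ball t d \<and> cbox u v \<subseteq> cbox 0 1 \<longrightarrow> speed \<gamma> integrable_on cbox u v"
      by blast
  qed
  then show ?thesis by simp
qed

lemma piecewise_C1_has_integral:
  "piecewise_C1_curve M \<gamma> \<Longrightarrow> (speed \<gamma> has_integral curve_length M \<gamma>) {0..1}"
  unfolding curve_length_speed using piecewise_C1_integrable by (rule integrable_integral)

lemma curve_length_nonneg: "curve_length M \<gamma> \<ge> 0"
  unfolding curve_length_speed
  by (cases "speed \<gamma> integrable_on {0..1}")
     (auto intro!: integral_nonneg simp: speed_def tnorm_nonneg not_integrable_integral)

lemma C1_curve_piecewise: "C1_curve_on M 0 1 \<gamma> \<Longrightarrow> piecewise_C1_curve M \<gamma>"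
  unfolding piecewise_C1_curve_def
proof (intro conjI exI[of _ "{}"] allI impI)
  assume "C1_curve_on M 0 1 \<gamma>"
  then show "continuous_on {0..1} \<gamma>"
    by (simp add: C1_curve_on_def)
  show "C1_curve_on M a b \<gamma>" if "0 \<le> a \<and> a < b \<and> b \<le> 1 \<and> {a<..<b} \<inter> {} = {}" for a b
    by (rule C1_curve_subset[OF \<open>C1_curve_on M 0 1 \<gamma>\<close>]) (use that in auto)
qed simp

end

section \<open>The Riemannian distance\<close>

context riemannian_mfd
begin

text \<open>The summands 0 and - 1 give both halves the shape r * t + s of the lemmas on affine
  reparametrisation.\<close>

definition join_curves :: "(real \<Rightarrow> 'm) \<Rightarrow> (real \<Rightarrow> 'm) \<Rightarrow> real \<Rightarrow> 'm" where
  "join_curves \<gamma> \<sigma> t = (if t \<le> 1/2 then \<gamma> (2 * t + 0) else \<sigma> (2 * t + - 1))"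

lemma piecewise_C1_pieces:
  assumes "continuous_on {0..1} \<gamma>" "finite S"
    "\<And>a b. 0 \<le> a \<Longrightarrow> a < b \<Longrightarrow> b \<le> 1 \<Longrightarrow> {a<..<b} \<inter> S = {} \<Longrightarrow> C1_curve_on M a b \<gamma>"
  shows "piecewise_C1_curve M \<gamma>"
  using assms unfolding piecewise_C1_curve_def by blast

lemma reverse_curve:
  assumes \<gamma>: "piecewise_C1_curve M \<gamma>"
  shows "piecewise_C1_curve M (\<lambda>t. \<gamma> (- 1 * t + 1))" "curve_length M (\<lambda>t. \<gamma> (- 1 * t + 1)) = curve_length M \<gamma>"
proof -
  obtain S where S: "finite S" "\<And>a b. 0 \<le> a \<Longrightarrow> a < b \<Longrightarrow> b \<le> 1 \<Longrightarrow> {a<..<b} \<inter> S = {} \<Longrightarrow> C1_curve_on M a b \<gamma>"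
    using \<gamma> unfolding piecewise_C1_curve_def by blast
  show p: "piecewise_C1_curve M (\<lambda>t. \<gamma> (- 1 * t + 1))"
  proof (rule piecewise_C1_pieces[of _ "(\<lambda>s. 1 - s) ` S"])
    show "continuous_on {0..1} (\<lambda>t. \<gamma> (- 1 * t + 1))"
      by (rule continuous_on_compose2[of "{0..1}" \<gamma>])
         (use \<gamma> in \<open>auto simp: piecewise_C1_curve_def intro!: continuous_intros\<close>)
    show "C1_curve_on M a b (\<lambda>t. \<gamma> (- 1 * t + 1))" if "0 \<le> a" "a < b" "b \<le> 1" "{a<..<b} \<inter> (\<lambda>s. 1 - s) ` S = {}" for a b
    proof (rule C1_curve_affine)
      have "{1 - b<..<1 - a} \<inter> S = {}"
      proof (rule equals0I)
        fix s assume "s \<in> {1 - b<..<1 - a} \<inter> S"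
        then have "1 - s \<in> {a<..<b} \<inter> (\<lambda>s. 1 - s) ` S"
          by auto
        with that(4) show False by blast
      qed
      then show "C1_curve_on M (1 - b) (1 - a) \<gamma>"
        using that by (intro S(2)) auto
    qed auto
  qed (use S in simp)
  obtain S where S: "finite S" "\<And>t. t \<in> {0<..<1} - S \<Longrightarrow> vdiff \<gamma> t"
    using piecewise_C1_vdiff[OF \<gamma>] by blast
  have "((\<lambda>t. speed \<gamma> (- 1 *\<^sub>R t + 1)) has_integral (1 / \<bar>- 1\<bar> ^ DIM(real)) *\<^sub>R curve_length M \<gamma>)
      ((\<lambda>x. (1 / - 1) *\<^sub>R x + - ((1 / - 1) *\<^sub>R 1)) ` cbox 0 1)"
    by (rule has_integral_affinity) (use piecewise_C1_has_integral[OF \<gamma>] in auto)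
  moreover have "(\<lambda>x. (1 / - 1) *\<^sub>R x + - ((1 / - 1) *\<^sub>R 1)) ` cbox 0 1 = {0..1::real}"
    by (auto simp: image_iff intro!: bexI[of _ "1 - x" for x])
  ultimately have "((\<lambda>t. speed \<gamma> (- 1 * t + 1)) has_integral curve_length M \<gamma>) {0..1}"
    by simp
  then have "(speed (\<lambda>t. \<gamma> (- 1 * t + 1)) has_integral curve_length M \<gamma>) {0..1}"
  proof (rule has_integral_spike_finite[of "insert 0 (insert 1 ((\<lambda>s. 1 - s) ` S))", rotated 2])
    fix t :: real assume t: "t \<in> {0..1} - insert 0 (insert 1 ((\<lambda>s. 1 - s) ` S))"
    then have "- 1 * t + 1 \<in> {0<..<1} - S"
      by (auto simp: image_iff)
    from vdiff_affine(2)[OF S(2)[OF this]] show "speed (\<lambda>t. \<gamma> (- 1 * t + 1)) t = speed \<gamma> (- 1 * t + 1)"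
      by simp
  qed (use S in simp)
  then show "curve_length M (\<lambda>t. \<gamma> (- 1 * t + 1)) = curve_length M \<gamma>"
    unfolding curve_length_speed by (rule integral_unique)
qed

lemma half_integral:
  fixes f :: "real \<Rightarrow> real"
  assumes "(f has_integral I) {0..1::real}"
  shows "((\<lambda>t. 2 * f (2 * t + s)) has_integral I) {- s / 2..(1 - s) / 2}"
proof -
  have "((\<lambda>t. f (2 *\<^sub>R t + s)) has_integral (1 / \<bar>2\<bar> ^ DIM(real)) *\<^sub>R I)
      ((\<lambda>x. (1 / 2) *\<^sub>R x + - ((1 / 2) *\<^sub>R s)) ` cbox 0 1)"
    by (rule has_integral_affinity) (use assms in auto)
  moreover have "(\<lambda>x. (1 / 2) *\<^sub>R x + - ((1 / 2) *\<^sub>R s)) ` cbox 0 1 = {- s / 2..(1 - s) / 2}"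
    using image_affinity_atLeastAtMost[of "1/2" "- (s / 2)" 0 1] by (simp add: diff_divide_distrib)
  ultimately have "((\<lambda>t. f (2 * t + s)) has_integral I / 2) {- s / 2..(1 - s) / 2}"
    by simp
  from has_integral_mult_right[OF this, of 2] show ?thesis
    by simp
qed

lemma join_curve:
  assumes \<gamma>: "piecewise_C1_curve M \<gamma>" and \<sigma>: "piecewise_C1_curve M \<sigma>" and eq: "\<gamma> 1 = \<sigma> 0"
  shows "piecewise_C1_curve M (join_curves \<gamma> \<sigma>)" "curve_length M (join_curves \<gamma> \<sigma>) = curve_length M \<gamma> + curve_length M \<sigma>"
proof -
  obtain S where S: "finite S" "\<And>a b. 0 \<le> a \<Longrightarrow> a < b \<Longrightarrow> b \<le> 1 \<Longrightarrow> {a<..<b} \<inter> S = {} \<Longrightarrow> C1_curve_on M a b \<gamma>"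
    using \<gamma> unfolding piecewise_C1_curve_def by blast
  obtain S' where S': "finite S'" "\<And>a b. 0 \<le> a \<Longrightarrow> a < b \<Longrightarrow> b \<le> 1 \<Longrightarrow> {a<..<b} \<inter> S' = {} \<Longrightarrow> C1_curve_on M a b \<sigma>"
    using \<sigma> unfolding piecewise_C1_curve_def by blast
  let ?j = "join_curves \<gamma> \<sigma>"
  have jl: "?j t = \<gamma> (2 * t + 0)" if "t \<le> 1/2" for t
    using that by (simp add: join_curves_def)
  have jr: "?j t = \<sigma> (2 * t + - 1)" if "t \<ge> 1/2" for t
  proof (cases "t = 1/2")
    case True
    show ?thesis
      unfolding True using eq by (simp add: join_curves_def)
  qed (use that in \<open>simp add: join_curves_def\<close>)
  show "piecewise_C1_curve M ?j"
  proof (rule piecewise_C1_pieces[of _ "insert (1/2) ((\<lambda>s. s / 2) ` S \<union> (\<lambda>s. (s + 1) / 2) ` S')"])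
    have c1: "continuous_on {0..1/2} ?j"
    proof (rule continuous_on_eq)
      show "continuous_on {0..1/2} (\<lambda>t. \<gamma> (2 * t + 0))"
        by (rule continuous_on_compose2[of "{0..1}" \<gamma>])
           (use \<gamma> in \<open>auto simp: piecewise_C1_curve_def intro!: continuous_intros\<close>)
    qed (use jl in auto)
    have c2: "continuous_on {1/2..1} ?j"
    proof (rule continuous_on_eq)
      show "continuous_on {1/2..1} (\<lambda>t. \<sigma> (2 * t + - 1))"
        by (rule continuous_on_compose2[of "{0..1}" \<sigma>])
           (use \<sigma> in \<open>auto simp: piecewise_C1_curve_def intro!: continuous_intros\<close>)
    qed (use jr in auto)
    have "continuous_on ({0..1/2} \<union> {1/2..1}) ?j"
      by (rule continuous_on_closed_Un[OF _ _ c1 c2]) auto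
    moreover have "{0..1/2} \<union> {1/2..1} = {0..1::real}"
      by auto
    ultimately show "continuous_on {0..1} ?j"
      by simp
    fix a b :: real
    assume ab: "0 \<le> a" "a < b" "b \<le> 1" and d: "{a<..<b} \<inter> insert (1/2) ((\<lambda>s. s / 2) ` S \<union> (\<lambda>s. (s + 1) / 2) ` S') = {}"
    have "b \<le> 1/2 \<or> 1/2 \<le> a"
    proof -
      have "1/2 \<notin> {a<..<b}"
        using d by blast
      then show ?thesis by auto
    qed
    then show "C1_curve_on M a b ?j"
    proof
      assume b: "b \<le> 1/2"
      have "{2 * a<..<2 * b} \<inter> S = {}"
      proof (rule equals0I)
        fix s assume "s \<in> {2 * a<..<2 * b} \<inter> S"
        then have "s / 2 \<in> {a<..<b} \<inter> (\<lambda>s. s / 2) ` S"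
          by auto
        with d show False by blast
      qed
      then have "C1_curve_on M (2 * a) (2 * b) \<gamma>"
        using ab b by (intro S(2)) auto
      then have "C1_curve_on M a b (\<lambda>t. \<gamma> (2 * t + 0))"
        by (rule C1_curve_affine) auto
      then show ?thesis
        by (rule C1_curve_cong) (use b jl in auto)
    next
      assume a: "1/2 \<le> a"
      have "{2 * a - 1<..<2 * b - 1} \<inter> S' = {}"
      proof (rule equals0I)
        fix s assume "s \<in> {2 * a - 1<..<2 * b - 1} \<inter> S'"
        then have "(s + 1) / 2 \<in> {a<..<b} \<inter> (\<lambda>s. (s + 1) / 2) ` S'"
          by auto
        with d show False by blast
      qed
      then have "C1_curve_on M (2 * a - 1) (2 * b - 1) \<sigma>"
        using ab a by (intro S'(2)) auto
      then have "C1_curve_on M a b (\<lambda>t. \<sigma> (2 * t + - 1))"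
        by (rule C1_curve_affine) auto
      then show ?thesis
        by (rule C1_curve_cong) (use a jr in auto)
    qed
  qed (use S S' in simp)
  obtain R where R: "finite R" "\<And>t. t \<in> {0<..<1} - R \<Longrightarrow> vdiff \<gamma> t"
    using piecewise_C1_vdiff[OF \<gamma>] by blast
  obtain R' where R': "finite R'" "\<And>t. t \<in> {0<..<1} - R' \<Longrightarrow> vdiff \<sigma> t"
    using piecewise_C1_vdiff[OF \<sigma>] by blast
  have "((\<lambda>t. 2 * speed \<gamma> (2 * t + 0)) has_integral curve_length M \<gamma>) {0..1/2}"
    using half_integral[OF piecewise_C1_has_integral[OF \<gamma>], of 0] by simp
  then have 1: "(speed ?j has_integral curve_length M \<gamma>) {0..1/2}"
  proof (rule has_integral_spike_finite[of "insert 0 (insert (1/2) ((\<lambda>s. s / 2) ` R))", rotated 2])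
    fix t :: real assume t: "t \<in> {0..1/2} - insert 0 (insert (1/2) ((\<lambda>s. s / 2) ` R))"
    then have "2 * t + 0 \<in> {0<..<1} - R"
      by (auto simp: image_iff mult.commute)
    note v = vdiff_affine[OF R(2)[OF this]]
    have "speed ?j t = speed (\<lambda>t. \<gamma> (2 * t + 0)) t"
      by (rule vdiff_cong(2)[OF v(1), of "{..<1/2}"]) (use t jl in auto)
    with v(2) show "speed ?j t = 2 * speed \<gamma> (2 * t + 0)"
      by simp
  qed (use R in simp)
  have "((\<lambda>t. 2 * speed \<sigma> (2 * t + - 1)) has_integral curve_length M \<sigma>) {1/2..1}"
    using half_integral[OF piecewise_C1_has_integral[OF \<sigma>], of "- 1"] by simp
  then have 2: "(speed ?j has_integral curve_length M \<sigma>) {1/2..1}"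
  proof (rule has_integral_spike_finite[of "insert 1 (insert (1/2) ((\<lambda>s. (s + 1) / 2) ` R'))", rotated 2])
    fix t :: real assume t: "t \<in> {1/2..1} - insert 1 (insert (1/2) ((\<lambda>s. (s + 1) / 2) ` R'))"
    then have "2 * t + - 1 \<in> {0<..<1} - R'"
      by (auto simp: image_iff field_simps)
    note v = vdiff_affine[OF R'(2)[OF this]]
    have "speed ?j t = speed (\<lambda>t. \<sigma> (2 * t + - 1)) t"
      by (rule vdiff_cong(2)[OF v(1), of "{1/2<..}"]) (use t jr in auto)
    with v(2) show "speed ?j t = 2 * speed \<sigma> (2 * t + - 1)"
      by simp
  qed (use R' in simp)
  have "(speed ?j has_integral curve_length M \<gamma> + curve_length M \<sigma>) {0..1}"
    by (rule has_integral_combine[OF _ _ 1 2]) auto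
  then show "curve_length M ?j = curve_length M \<gamma> + curve_length M \<sigma>"
    unfolding curve_length_speed by (rule integral_unique)
qed

lemma rdist_le: "piecewise_C1_curve M \<gamma> \<Longrightarrow> \<gamma> 0 = x \<Longrightarrow> \<gamma> 1 = y \<Longrightarrow> rdist M x y \<le> curve_length M \<gamma>"
  unfolding rdist_def by (rule cInf_lower) (auto intro!: bdd_belowI[of _ 0] curve_length_nonneg)

lemma C1_map_vdiff:
  assumes f: "C1_map f" and c: "(c has_vector_derivative c') (at t)"
  shows "vdiff (\<lambda>s. f (c s)) t" "velocity M (\<lambda>s. f (c s)) t = dmap f (c t) c'"
proof -
  define d where "d = chart_at M (f (c t))"
  have d: "d \<in> atlas M" "f (c t) \<in> fst d"
    using chart_at by (auto simp: d_def)
  have D: "C1_on {b. f b \<in> fst d} (\<lambda>b. snd d (f b))"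
    using f d by (simp add: C1_map_def)
  have "linear (dd (\<lambda>b. snd d (f b)) (c t))"
    using C1_on_bl[OF D] d by (simp add: linear_conv_bounded_linear)
  then have "((\<lambda>s. snd d (f (c s))) has_vector_derivative dd (\<lambda>b. snd d (f b)) (c t) c') (at t)"
    using has_derivative_compose[OF c[unfolded has_vector_derivative_def] C1_on_deriv[OF D]] d
    by (simp add: has_vector_derivative_def linear_scale)
  moreover have "isCont (\<lambda>s. f (c s)) t"
    by (rule isCont_o2[OF has_vector_derivative_continuous[OF c] C1_map_isCont[OF f]])
  ultimately show "vdiff (\<lambda>s. f (c s)) t" "velocity M (\<lambda>s. f (c s)) t = dmap f (c t) c'"
    using vdiffI[of d "\<lambda>s. f (c s)" t] d C1_map_dmap(2)[OF f d] by (auto simp: o_def)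
qed

lemma C1_map_curve:
  assumes f: "C1_map f" and c': "continuous_on {a..b} c'"
    and c: "\<And>t. t \<in> {a..b} \<Longrightarrow> (c has_vector_derivative c' t) (at t within {a..b})"
  shows "C1_curve_on M a b (\<lambda>t. f (c t))"
  unfolding C1_curve_on_def
proof (intro conjI ballI)
  have cc: "continuous_on {a..b} c"
    by (rule continuous_on_vector_derivative[OF c])
  show "continuous_on {a..b} (\<lambda>t. f (c t))"
    by (rule continuous_on_compose2[OF _ cc, of UNIV f]) (use f in \<open>auto simp: C1_map_def\<close>)
  fix d assume d: "d \<in> atlas M"
  let ?N = "{t \<in> {a..b}. f (c t) \<in> fst d}"
  have D: "C1_on {b. f b \<in> fst d} (\<lambda>b. snd d (f b))"
    using f d by (simp add: C1_map_def)
  show "\<exists>\<gamma>'. continuous_on ?N \<gamma>' \<and> (\<forall>t\<in>{a..b}. f (c t) \<in> fst d \<longrightarrow>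
     (snd d \<circ> (\<lambda>t. f (c t)) has_vector_derivative \<gamma>' t) (at t within {a..b}))"
  proof (intro exI[of _ "\<lambda>t. dd (\<lambda>b. snd d (f b)) (c t) (c' t)"] conjI ballI impI)
    show "continuous_on ?N (\<lambda>t. dd (\<lambda>b. snd d (f b)) (c t) (c' t))"
      by (rule continuous_on_dd_comp[OF D continuous_on_subset[OF cc] _ continuous_on_subset[OF c']]) auto
    fix t assume t: "t \<in> {a..b}" "f (c t) \<in> fst d"
    have "linear (dd (\<lambda>b. snd d (f b)) (c t))"
      using C1_on_bl[OF D] t by (simp add: linear_conv_bounded_linear)
    then show "(snd d \<circ> (\<lambda>t. f (c t)) has_vector_derivative dd (\<lambda>b. snd d (f b)) (c t) (c' t)) (at t within {a..b})"
      using has_derivative_compose[OF c[OF t(1), unfolded has_vector_derivative_def] C1_on_deriv[OF D]] t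
      by (simp add: has_vector_derivative_def linear_scale o_def)
  qed
qed

text \<open>Reparametrised affinely on the unit interval, the geodesic piece has constant speed, and
  its length is the right-hand side.\<close>

lemma geodesic_rdist_le:
  assumes g: "geodesic_line M \<gamma>"
  shows "rdist M (\<gamma> s) (\<gamma> t) \<le> \<bar>t - s\<bar> * tnorm M (\<gamma> 0) (velocity M \<gamma> 0)"
proof -
  let ?\<sigma> = "\<lambda>\<tau>. \<gamma> ((t - s) * \<tau> + s)"
  have \<sigma>: "geodesic_line M ?\<sigma>"
    by (rule geodesic_affine(1)[OF g])
  have "C1_curve_on M 0 1 ?\<sigma>"
    unfolding C1_curve_on_def
  proof (intro conjI ballI)
    show "continuous_on {0..1} ?\<sigma>"
      using geodesic_cont[OF \<sigma>] continuous_on_subset by blast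
    fix c assume c: "c \<in> atlas M"
    show "\<exists>\<gamma>'. continuous_on {\<tau> \<in> {0..1}. ?\<sigma> \<tau> \<in> fst c} \<gamma>' \<and> (\<forall>\<tau>\<in>{0..1}. ?\<sigma> \<tau> \<in> fst c \<longrightarrow>
       (snd c \<circ> ?\<sigma> has_vector_derivative \<gamma>' \<tau>) (at \<tau> within {0..1}))"
    proof (intro exI[of _ "\<lambda>\<tau>. snd (st c ?\<sigma> \<tau>)"] conjI ballI impI)
      show "continuous_on {\<tau> \<in> {0..1}. ?\<sigma> \<tau> \<in> fst c} (\<lambda>\<tau>. snd (st c ?\<sigma> \<tau>))"
        by (intro continuous_at_imp_continuous_on ballI isCont_snd st_parts(4)[OF \<sigma> c]) auto
      show "(snd c \<circ> ?\<sigma> has_vector_derivative snd (st c ?\<sigma> \<tau>)) (at \<tau> within {0..1})" if "?\<sigma> \<tau> \<in> fst c" for \<tau>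
        by (rule has_vector_derivative_at_within[OF st_parts(3)[OF \<sigma> c that]])
    qed
  qed
  from rdist_le[OF C1_curve_piecewise[OF this]]
  have "rdist M (\<gamma> s) (\<gamma> t) \<le> curve_length M ?\<sigma>"
    by simp
  also have "\<dots> = integral {0..1} (\<lambda>\<tau>::real. \<bar>t - s\<bar> * tnorm M (\<gamma> 0) (velocity M \<gamma> 0))"
  proof -
    have "speed ?\<sigma> = (\<lambda>\<tau>. \<bar>t - s\<bar> * tnorm M (\<gamma> 0) (velocity M \<gamma> 0))"
    proof
      show "speed ?\<sigma> \<tau> = \<bar>t - s\<bar> * tnorm M (\<gamma> 0) (velocity M \<gamma> 0)" for \<tau>
        by (simp only: speed_def geodesic_affine(2)[OF g] tnorm_scale geodesic_speed[OF g, of "(t - s) * \<tau> + s"])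
    qed
    then show ?thesis
      unfolding curve_length_speed by simp
  qed
  finally show ?thesis by simp
qed

end

section \<open>Pulling curves back to a tangent space\<close>

context hadamard_mfd
begin

text \<open>The chain rule with the inverse of \<open>rexp M q\<close> read in a chart gives
  continuous derivatives locally; they fit together because the derivative within an interval is
  unique.\<close>

lemma lift_curve_C1:
  assumes \<sigma>: "C1_curve_on M a b \<sigma>" and ab: "a < b"
  shows "\<exists>c'. continuous_on {a..b} c' \<and> (\<forall>t\<in>{a..b}. ((\<lambda>t. rexp_inv M q (\<sigma> t)) has_vector_derivative c' t) (at t within {a..b}))"
proof -
  let ?c = "\<lambda>t. rexp_inv M q (\<sigma> t)"
  have cont: "continuous_on {a..b} \<sigma>"
    using \<sigma> by (simp add: C1_curve_on_def)
  have loc: "\<exists>N c'. openin (top_of_set {a..b}) N \<and> t \<in> N \<and> continuous_on N c' \<and>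
      (\<forall>s\<in>N. (?c has_vector_derivative c' s) (at s within {a..b}))" if t: "t \<in> {a..b}" for t
  proof -
    define d where "d = chart_at M (\<sigma> t)"
    have d: "d \<in> atlas M" "\<sigma> t \<in> fst d"
      using chart_at by (auto simp: d_def)
    obtain \<gamma>' where \<gamma>': "continuous_on {t \<in> {a..b}. \<sigma> t \<in> fst d} \<gamma>'"
      "\<And>s. s \<in> {a..b} \<Longrightarrow> \<sigma> s \<in> fst d \<Longrightarrow> (snd d \<circ> \<sigma> has_vector_derivative \<gamma>' s) (at s within {a..b})"
      using \<sigma> d(1) unfolding C1_curve_on_def by blast
    define N where "N = {a..b} \<inter> \<sigma> -` fst d"
    have N: "openin (top_of_set {a..b}) N" "t \<in> N"
      unfolding N_def using cont chart_homeo(2)[OF d(1)] t d(2) by (auto intro: continuous_openin_preimage_gen)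
    have Nin: "s \<in> {a..b}" "\<sigma> s \<in> fst d" if "s \<in> N" for s
      using that by (auto simp: N_def)
    let ?g = "\<lambda>z. rexp_inv M q (chart_inv d z)"
    have g: "C1_on (chart_image d) ?g"
      by (rule rexp_inv_C1[OF d(1)])
    have "(?c has_vector_derivative dd ?g (snd d (\<sigma> s)) (\<gamma>' s)) (at s within {a..b})" if s: "s \<in> N" for s
    proof -
      have "linear (dd ?g (snd d (\<sigma> s)))"
        using C1_on_bl[OF g] Nin[OF s] by (simp add: linear_conv_bounded_linear)
      then have "((\<lambda>s. ?g (snd d (\<sigma> s))) has_vector_derivative dd ?g (snd d (\<sigma> s)) (\<gamma>' s)) (at s within {a..b})"
        using has_derivative_compose[OF \<gamma>'(2)[OF Nin[OF s], unfolded has_vector_derivative_def o_def] C1_on_deriv[OF g]] Nin[OF s]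
        by (simp add: has_vector_derivative_def linear_scale)
      moreover have "\<forall>\<^sub>F u in at s within {a..b}. ?g (snd d (\<sigma> u)) = ?c u"
      proof -
        have "\<forall>\<^sub>F u in at s within {a..b}. \<sigma> u \<in> fst d"
          using cont Nin[OF s] chart_homeo(2)[OF d(1)] unfolding continuous_on_def by (auto dest: topological_tendstoD)
        then show ?thesis
          by eventually_elim (use d in simp)
      qed
      ultimately show ?thesis
        unfolding has_vector_derivative_def
        by (rule has_derivative_transform_eventually) (use Nin[OF s] d in auto)
    qed
    moreover have "continuous_on N (\<lambda>s. dd ?g (snd d (\<sigma> s)) (\<gamma>' s))"
    proof (rule continuous_on_dd_comp[OF g])
      show "continuous_on N (\<lambda>s. snd d (\<sigma> s))"
        by (rule continuous_on_compose2[OF chart_cont[OF d(1)] continuous_on_subset[OF cont]]) (use Nin in auto)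
      show "continuous_on N \<gamma>'"
        by (rule continuous_on_subset[OF \<gamma>'(1)]) (use Nin in auto)
    qed (use Nin in auto)
    ultimately show ?thesis
      using N by blast
  qed
  have uniq: "u = w" if "(?c has_vector_derivative u) (at t within {a..b})" "(?c has_vector_derivative w) (at t within {a..b})"
    "t \<in> {a..b}" for t u w
    using vector_derivative_unique_within_closed_interval[of a b t ?c u w] that ab by simp
  define c' where "c' t = vector_derivative ?c (at t within {a..b})" for t
  have c': "(?c has_vector_derivative c' t) (at t within {a..b})" if "t \<in> {a..b}" for t
    using loc[OF that] unfolding c'_def by (metis differentiableI_vector vector_derivative_works)
  have "continuous_on {a..b} c'"
    unfolding continuous_on_eq_continuous_within
  proof
    fix t assume t: "t \<in> {a..b}"
    from loc[OF this] obtain N d' where N: "openin (top_of_set {a..b}) N" "t \<in> N" "continuous_on N d'"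
      "\<And>s. s \<in> N \<Longrightarrow> (?c has_vector_derivative d' s) (at s within {a..b})"
      by (elim exE conjE) blast
    have sub: "N \<subseteq> {a..b}"
      using N(1) by (simp add: openin_imp_subset)
    have "continuous_on N c'"
      by (rule continuous_on_eq[OF N(3)]) (use N(4) c' sub uniq in blast)
    then have "continuous (at t within N) c'"
      using N(2) by (simp add: continuous_on_eq_continuous_within)
    moreover have "at t within {a..b} = at t within N"
    proof -
      obtain W where "open W" "N = {a..b} \<inter> W"
        using N(1) by (auto simp: openin_open)
      then show ?thesis
        using N(2) by (intro at_within_nhd[of t W]) auto
    qed
    ultimately show "continuous (at t within {a..b}) c'"
      by simp
  qed
  with c' show ?thesis by blast
qed

text \<open>The second part differentiates \<sigma> as the image under \<open>rexp M q\<close> of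
  its pull-back, which expresses its velocity by the derivative of the pull-back.\<close>

lemma lift_curve_vdiff:
  assumes v: "vdiff \<sigma> t"
  shows "\<exists>c'. ((\<lambda>t. rexp_inv M q (\<sigma> t)) has_vector_derivative c') (at t) \<and>
    velocity M \<sigma> t = dmap (rexp M q) (rexp_inv M q (\<sigma> t)) c'"
proof -
  define d where "d = chart_at M (\<sigma> t)"
  have d: "d \<in> atlas M" "\<sigma> t \<in> fst d"
    using chart_at by (auto simp: d_def)
  let ?g = "\<lambda>z. rexp_inv M q (chart_inv d z)"
  have g: "C1_on (chart_image d) ?g"
    by (rule rexp_inv_C1[OF d(1)])
  have \<sigma>: "(snd d \<circ> \<sigma> has_vector_derivative velocity M \<sigma> t) (at t)" "isCont \<sigma> t"
    using v by (auto simp: vdiff_def d_def)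
  have "linear (dd ?g (snd d (\<sigma> t)))"
    using C1_on_bl[OF g] d by (simp add: linear_conv_bounded_linear)
  then have "((\<lambda>s. ?g (snd d (\<sigma> s))) has_vector_derivative dd ?g (snd d (\<sigma> t)) (velocity M \<sigma> t)) (at t)"
    using has_derivative_compose[OF \<sigma>(1)[unfolded has_vector_derivative_def o_def] C1_on_deriv[OF g]] d
    by (simp add: has_vector_derivative_def linear_scale)
  moreover have "\<forall>\<^sub>F u in at t. ?g (snd d (\<sigma> u)) = rexp_inv M q (\<sigma> u)"
  proof -
    have "\<forall>\<^sub>F u in at t. \<sigma> u \<in> fst d"
      using \<sigma>(2) d chart_homeo(2)[OF d(1)] unfolding isCont_def by (auto dest: topological_tendstoD)
    then show ?thesis
      by eventually_elim (use d in simp)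
  qed
  ultimately have c: "((\<lambda>t. rexp_inv M q (\<sigma> t)) has_vector_derivative dd ?g (snd d (\<sigma> t)) (velocity M \<sigma> t)) (at t)"
    unfolding has_vector_derivative_def
    by (rule has_derivative_transform_eventually) (use d in auto)
  have eq: "\<sigma> = (\<lambda>s. rexp M q (rexp_inv M q (\<sigma> s)))"
    by (rule ext) (rule rexp_inv(1)[symmetric])
  have "velocity M \<sigma> t = velocity M (\<lambda>s. rexp M q (rexp_inv M q (\<sigma> s))) t"
    by (rule arg_cong[OF eq])
  also have "\<dots> = dmap (rexp M q) (rexp_inv M q (\<sigma> t)) (dd ?g (snd d (\<sigma> t)) (velocity M \<sigma> t))"
    by (rule C1_map_vdiff(2)[OF rexp_C1_map c])
  finally have "velocity M \<sigma> t = dmap (rexp M q) (rexp_inv M q (\<sigma> t)) (dd ?g (snd d (\<sigma> t)) (velocity M \<sigma> t))" .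
  with c have "((\<lambda>t. rexp_inv M q (\<sigma> t)) has_vector_derivative dd ?g (snd d (\<sigma> t)) (velocity M \<sigma> t)) (at t) \<and>
      velocity M \<sigma> t = dmap (rexp M q) (rexp_inv M q (\<sigma> t)) (dd ?g (snd d (\<sigma> t)) (velocity M \<sigma> t))"
    by (rule conjI)
  then show ?thesis
    by (rule exI)
qed

text \<open>Let w = b - a and let c be the curve pulled back to the tangent space at q. Then |w|^2
  is the integral of <w, c'>, which is at most |w| times the integral of |c'|, and |c'| is at most
  the speed of \<sigma> because \<open>rexp M q\<close> expands.\<close>

lemma curve_length_ge:
  assumes \<sigma>: "piecewise_C1_curve M \<sigma>" and e: "\<sigma> 0 = rexp M q a" "\<sigma> 1 = rexp M q b"
  shows "tnorm M q (b - a) \<le> curve_length M \<sigma>"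
proof (cases "a = b")
  case True
  then show ?thesis
    by (simp add: curve_length_nonneg)
next
  case False
  let ?c = "\<lambda>t. rexp_inv M q (\<sigma> t)"
  define w where "w = b - a"
  have w: "tnorm M q w > 0"
    using False by (intro tnorm_pos) (simp add: w_def)
  obtain S where S: "finite S" "\<And>t. t \<in> {0<..<1} - S \<Longrightarrow> vdiff \<sigma> t"
    using piecewise_C1_vdiff[OF \<sigma>] by blast
  have "\<exists>c'. (?c has_vector_derivative c') (at t) \<and> velocity M \<sigma> t = dmap (rexp M q) (?c t) c'" if "t \<in> {0<..<1} - S" for t
    by (rule lift_curve_vdiff[OF S(2)[OF that]])
  then obtain c' where c': "\<And>t. t \<in> {0<..<1} - S \<Longrightarrow> (?c has_vector_derivative c' t) (at t)"
    "\<And>t. t \<in> {0<..<1} - S \<Longrightarrow> velocity M \<sigma> t = dmap (rexp M q) (?c t) (c' t)"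
    by metis
  have bl: "bounded_linear (metric M q w)"
    using metric_bilinear[of q] by (simp add: bilinear_def linear_conv_bounded_linear)
  have cc: "continuous_on {0..1} ?c"
    by (rule continuous_on_compose2[OF rexp_inv_cont]) (use \<sigma> in \<open>auto simp: piecewise_C1_curve_def\<close>)
  have "((\<lambda>t. metric M q w (c' t)) has_integral metric M q w (?c 1) - metric M q w (?c 0)) {0..1}"
  proof (rule fundamental_theorem_of_calculus_interior_strong[OF S(1)])
    show "((\<lambda>t. metric M q w (?c t)) has_vector_derivative metric M q w (c' t)) (at t)" if "t \<in> {0<..<1} - S" for t
      by (rule bounded_linear.has_vector_derivative[OF bl c'(1)[OF that]])
    show "continuous_on {0..1} (\<lambda>t. metric M q w (?c t))"
      by (rule bounded_linear.continuous_on[OF bl cc])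
  qed simp
  moreover have "metric M q w (?c 1) - metric M q w (?c 0) = metric M q w w"
    using bilinear_rsub[OF metric_bilinear[of q], of w b a] by (simp add: e w_def)
  ultimately have I: "((\<lambda>t. metric M q w (c' t)) has_integral metric M q w w) {0..1}"
    by simp
  have "integral {0..1} (\<lambda>t. metric M q w (c' t)) \<le> integral {0..1} (\<lambda>t. tnorm M q w * speed \<sigma> t)"
  proof (rule integral_le_off_finite[OF _ _ S(1)])
    show "(\<lambda>t. metric M q w (c' t)) integrable_on {0..1}"
      using I by (rule has_integral_integrable)
    show "(\<lambda>t. tnorm M q w * speed \<sigma> t) integrable_on {0..1}"
      by (rule integrable_on_mult_right[OF piecewise_C1_integrable[OF \<sigma>]])
    fix t :: real assume t: "t \<in> {0<..<1} - S"
    have "metric M q w (c' t) \<le> tnorm M q w * tnorm M q (c' t)"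
      by (rule tnorm_CS)
    also have "\<dots> \<le> tnorm M q w * speed \<sigma> t"
      using rexp_expanding[of q "c' t" "?c t"] c'(2)[OF t] by (intro mult_left_mono) (auto simp: speed_def tnorm_nonneg)
    finally show "metric M q w (c' t) \<le> tnorm M q w * speed \<sigma> t" .
  qed
  then have "metric M q w w \<le> tnorm M q w * curve_length M \<sigma>"
    using integral_unique[OF I] by (simp add: curve_length_speed)
  moreover have "metric M q w w = tnorm M q w * tnorm M q w"
    using w by (simp add: tnorm_def)
  ultimately show ?thesis
    using w by (simp add: w_def)
qed

lemma segment_curve:
  assumes "C1_map f"
  shows "piecewise_C1_curve M (\<lambda>t. f (a + t *\<^sub>R w))"
    "speed (\<lambda>t. f (a + t *\<^sub>R w)) t = tnorm M (f (a + t *\<^sub>R w)) (dmap f (a + t *\<^sub>R w) w)"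
proof -
  have d: "((\<lambda>t. a + t *\<^sub>R w) has_vector_derivative w) (at t within T)" for t T
    unfolding has_vector_derivative_def by (rule has_derivative_eq_rhs, (rule derivative_intros)+) simp
  have "C1_curve_on M 0 1 (\<lambda>t. f (a + t *\<^sub>R w))"
    by (rule C1_map_curve[OF assms _ d]) (intro continuous_on_const)
  then show "piecewise_C1_curve M (\<lambda>t. f (a + t *\<^sub>R w))"
    by (rule C1_curve_piecewise)
  show "speed (\<lambda>t. f (a + t *\<^sub>R w)) t = tnorm M (f (a + t *\<^sub>R w)) (dmap f (a + t *\<^sub>R w) w)"
    using C1_map_vdiff(2)[OF assms d] by (simp add: speed_def)
qed

text \<open>Makes the set whose infimum is \<open>rdist\<close> nonempty, so that lower bounds for
  lengths are lower bounds for distances.\<close>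

lemma connecting_curve:
  obtains \<gamma> where "piecewise_C1_curve M \<gamma>" "\<gamma> 0 = x" "\<gamma> 1 = y"
proof
  let ?a = "rexp_inv M x x" and ?b = "rexp_inv M x y"
  let ?\<gamma> = "\<lambda>t. rexp M x (?a + t *\<^sub>R (?b - ?a))"
  show "piecewise_C1_curve M ?\<gamma>"
    by (rule segment_curve(1)[OF rexp_C1_map])
  show "?\<gamma> 0 = x" "?\<gamma> 1 = y"
    by simp_all
qed

lemma rdist_greatest:
  assumes "\<And>\<gamma>. piecewise_C1_curve M \<gamma> \<Longrightarrow> \<gamma> 0 = x \<Longrightarrow> \<gamma> 1 = y \<Longrightarrow> K \<le> curve_length M \<gamma>"
  shows "K \<le> rdist M x y"
  unfolding rdist_def
proof (rule cInf_greatest)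
  obtain \<gamma> where "piecewise_C1_curve M \<gamma>" "\<gamma> 0 = x" "\<gamma> 1 = y"
    using connecting_curve by blast
  then show "{curve_length M \<gamma> |\<gamma>. piecewise_C1_curve M \<gamma> \<and> \<gamma> 0 = x \<and> \<gamma> 1 = y} \<noteq> {}"
    by blast
qed (use assms in auto)

lemma rdist_nonneg: "rdist M x y \<ge> 0"
  by (rule rdist_greatest) (rule curve_length_nonneg)

lemma rdist_sym: "rdist M x y = rdist M y x"
proof -
  have "rdist M x y \<le> rdist M y x" for x y
  proof (rule rdist_greatest)
    fix \<gamma> assume \<gamma>: "piecewise_C1_curve M \<gamma>" "\<gamma> 0 = y" "\<gamma> 1 = x"
    show "rdist M x y \<le> curve_length M \<gamma>"
      using rdist_le[OF reverse_curve(1)[OF \<gamma>(1)], of x y] reverse_curve(2)[OF \<gamma>(1)] \<gamma> by simp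
  qed
  then show ?thesis
    by (intro antisym)
qed

lemma rdist_triangle: "rdist M x z \<le> rdist M x y + rdist M y z"
proof -
  have "rdist M x z - rdist M y z \<le> rdist M x y"
  proof (rule rdist_greatest)
    fix \<gamma> assume \<gamma>: "piecewise_C1_curve M \<gamma>" "\<gamma> 0 = x" "\<gamma> 1 = y"
    have "rdist M x z - curve_length M \<gamma> \<le> rdist M y z"
    proof (rule rdist_greatest)
      fix \<sigma> assume \<sigma>: "piecewise_C1_curve M \<sigma>" "\<sigma> 0 = y" "\<sigma> 1 = z"
      have eq: "\<gamma> 1 = \<sigma> 0"
        using \<gamma> \<sigma> by simp
      have "rdist M x z \<le> curve_length M (join_curves \<gamma> \<sigma>)"
        by (rule rdist_le[OF join_curve(1)[OF \<gamma>(1) \<sigma>(1) eq]]) (use \<gamma> \<sigma> in \<open>simp_all add: join_curves_def\<close>)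
      then show "rdist M x z - curve_length M \<gamma> \<le> curve_length M \<sigma>"
        using join_curve(2)[OF \<gamma>(1) \<sigma>(1) eq] by simp
    qed
    then show "rdist M x z - rdist M y z \<le> curve_length M \<gamma>"
      by simp
  qed
  then show ?thesis
    by simp
qed

lemma rdist_rexp_ge: "tnorm M q (b - a) \<le> rdist M (rexp M q a) (rexp M q b)"
  by (rule rdist_greatest) (rule curve_length_ge)

lemma rexp_0 [simp]: "rexp M q 0 = q"
  using rexp_scale[of q 0 0] geo(2)[of q 0] by simp

lemma rdist_rexp: "rdist M q (rexp M q a) = tnorm M q a"
proof (rule antisym)
  show "rdist M q (rexp M q a) \<le> tnorm M q a"
    using geodesic_rdist_le[OF geo(1), of q a 0 1] by (simp add: geo(2,3) rexp_geo)
  show "tnorm M q a \<le> rdist M q (rexp M q a)"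
    using rdist_rexp_ge[of q a 0] by simp
qed

lemma rdist_rexp_inv: "tnorm M q (rexp_inv M q x) = rdist M q x"
  using rdist_rexp[of q "rexp_inv M q x"] by simp

text \<open>The map taking \<open>rexp M q b\<close> to \<open>rexp M q (s *\<^sub>R b)\<close>
  multiplies the speed of a curve by at most s (\<open>rexp_scaled_contracting\<close>). Applied to
  all curves between the two end points it contracts the distance.\<close>

lemma rdist_rexp_scaled:
  assumes s: "0 < s" "s \<le> 1"
  shows "rdist M (rexp M q (s *\<^sub>R a)) (rexp M q (s *\<^sub>R b)) \<le> s * rdist M (rexp M q a) (rexp M q b)"
proof -
  let ?F = "\<lambda>b. rexp M q (s *\<^sub>R b)"
  have F: "C1_map ?F"
    using geo_C1_map[of s q] s by (simp add: rexp_scale)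
  have "rdist M (?F a) (?F b) / s \<le> rdist M (rexp M q a) (rexp M q b)"
  proof (rule rdist_greatest)
    fix \<sigma> assume \<sigma>: "piecewise_C1_curve M \<sigma>" "\<sigma> 0 = rexp M q a" "\<sigma> 1 = rexp M q b"
    let ?c = "\<lambda>t. rexp_inv M q (\<sigma> t)"
    let ?\<gamma> = "\<lambda>t. ?F (?c t)"
    obtain R where R: "finite R" "\<And>a b. 0 \<le> a \<Longrightarrow> a < b \<Longrightarrow> b \<le> 1 \<Longrightarrow> {a<..<b} \<inter> R = {} \<Longrightarrow> C1_curve_on M a b \<sigma>"
      using \<sigma>(1) unfolding piecewise_C1_curve_def by blast
    have \<gamma>: "piecewise_C1_curve M ?\<gamma>"
    proof (rule piecewise_C1_pieces[OF _ R(1)])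
      show "continuous_on {0..1} ?\<gamma>"
      proof (rule continuous_on_compose2[of UNIV ?F])
        show "continuous_on UNIV ?F"
          using F by (simp add: C1_map_def)
        show "continuous_on {0..1} ?c"
          by (rule continuous_on_compose2[OF rexp_inv_cont]) (use \<sigma> in \<open>auto simp: piecewise_C1_curve_def\<close>)
      qed simp
      fix a b :: real assume ab: "0 \<le> a" "a < b" "b \<le> 1" "{a<..<b} \<inter> R = {}"
      obtain c' where "continuous_on {a..b} c'" "\<And>t. t \<in> {a..b} \<Longrightarrow> (?c has_vector_derivative c' t) (at t within {a..b})"
        using lift_curve_C1[OF R(2)[OF ab] ab(2), of q] by blast
      then show "C1_curve_on M a b ?\<gamma>"
        by (rule C1_map_curve[OF F])
    qed
    obtain S where S: "finite S" "\<And>t. t \<in> {0<..<1} - S \<Longrightarrow> vdiff \<sigma> t"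
      using piecewise_C1_vdiff[OF \<sigma>(1)] by blast
    have "integral {0..1} (speed ?\<gamma>) \<le> integral {0..1} (\<lambda>t. s * speed \<sigma> t)"
    proof (rule integral_le_off_finite[OF piecewise_C1_integrable[OF \<gamma>] _ S(1)])
      show "(\<lambda>t. s * speed \<sigma> t) integrable_on {0..1}"
        by (rule integrable_on_mult_right[OF piecewise_C1_integrable[OF \<sigma>(1)]])
      fix t :: real assume "t \<in> {0<..<1} - S"
      from lift_curve_vdiff[OF S(2)[OF this], of q]
      obtain c' where c': "(?c has_vector_derivative c') (at t)" "velocity M \<sigma> t = dmap (rexp M q) (?c t) c'"
        by blast
      show "speed ?\<gamma> t \<le> s * speed \<sigma> t"
        using rexp_scaled_contracting[OF s, of q "?c t" c'] C1_map_vdiff(2)[OF F c'(1)] c'(2)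
        by (simp add: speed_def)
    qed
    then have "curve_length M ?\<gamma> \<le> s * curve_length M \<sigma>"
      by (simp add: curve_length_speed)
    moreover have "rdist M (?F a) (?F b) \<le> curve_length M ?\<gamma>"
      by (rule rdist_le[OF \<gamma>]) (simp_all add: \<sigma>)
    ultimately show "rdist M (?F a) (?F b) / s \<le> curve_length M \<sigma>"
      using s by (simp add: pos_divide_le_eq mult.commute)
  qed
  then show ?thesis
    using s by (simp add: pos_divide_le_eq mult.commute)
qed

text \<open>Links \<open>rdist\<close> with the norm of the tangent space, which is needed to pass
  to a limit of directions: the image of the segment from v' to v has speed at most C L |v -
  v'|.\<close>

lemma rdist_rexp_local:
  obtains \<delta> C where "\<delta> > 0" "\<And>v'. norm (v' - v) < \<delta> \<Longrightarrow> rdist M (rexp M q v') (rexp M q v) \<le> C * norm (v' - v)"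
proof -
  define f where "f = rexp M q"
  have f: "C1_map f"
    unfolding f_def by (rule rexp_C1_map)
  define d where "d = chart_at M (f v)"
  have d: "d \<in> atlas M" "f v \<in> fst d"
    using chart_at by (auto simp: d_def)
  let ?F = "\<lambda>b. snd d (f b)"
  have F: "C1_on {b. f b \<in> fst d} ?F"
    using f d by (simp add: C1_map_def)
  obtain r where r: "r > 0" "cball v r \<subseteq> {b. f b \<in> fst d}"
    using C1_on_open[OF F] d(2) unfolding open_contains_cball by auto
  have cp: "compact (?F ` cball v r)"
    by (intro compact_continuous_image continuous_on_subset[OF C1_on_cont[OF F] r(2)] compact_cball)
  have img: "?F ` cball v r \<subseteq> chart_image d"
    using r(2) by auto
  obtain C where C: "C > 0" "\<And>a u. a \<in> ?F ` cball v r \<Longrightarrow> sqrt (gm d a u u) \<le> C * norm u"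
    by (rule gm_upper[OF d(1) cp img]) blast
  obtain L where L: "L \<ge> 0" "\<And>x. x \<in> cball v r \<Longrightarrow> norm (Blinfun (dd ?F x)) \<le> L"
    by (rule C1_on_compact_lipschitz[OF F compact_cball convex_cball r(2)]) (rule that)
  have "rdist M (f v') (f v) \<le> (C * L) * norm (v' - v)" if v': "norm (v' - v) < r" for v'
  proof -
    let ?\<gamma> = "\<lambda>t. f (v' + t *\<^sub>R (v - v'))"
    have p: "piecewise_C1_curve M ?\<gamma>"
      by (rule segment_curve(1)[OF f])
    have "rdist M (f v') (f v) \<le> curve_length M ?\<gamma>"
      by (rule rdist_le[OF p]) simp_all
    also have "\<dots> \<le> integral {0..1} (\<lambda>t::real. (C * L) * norm (v - v'))"
      unfolding curve_length_speed
    proof (rule integral_le[OF piecewise_C1_integrable[OF p]])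
      fix t :: real assume t: "t \<in> {0..1}"
      let ?x = "v' + t *\<^sub>R (v - v')"
      have "?x - v = (1 - t) *\<^sub>R (v' - v)"
        by (simp add: algebra_simps)
      then have "norm (?x - v) \<le> 1 * norm (v' - v)"
        using t by (simp add: mult_left_le_one_le)
      then have x: "?x \<in> cball v r"
        using v' by (simp add: dist_norm norm_minus_commute)
      have "speed ?\<gamma> t = sqrt (gm d (?F ?x) (dd ?F ?x (v - v')) (dd ?F ?x (v - v')))"
        using segment_curve(2)[OF f, of v' "v - v'" t] C1_map_dmap(1)[OF f d(1), of ?x] x r(2) by (auto simp: tnorm_def)
      also have "\<dots> \<le> C * norm (dd ?F ?x (v - v'))"
        by (rule C(2)) (use x in blast)
      also have "norm (dd ?F ?x (v - v')) \<le> L * norm (v - v')"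
      proof -
        have "norm (blinfun_apply (Blinfun (dd ?F ?x)) (v - v')) \<le> L * norm (v - v')"
          by (rule order_trans[OF norm_blinfun mult_right_mono[OF L(2)[OF x]]]) simp
        then show ?thesis
          using C1_on_Blinfun[OF F] x r(2) by auto
      qed
      finally show "speed ?\<gamma> t \<le> (C * L) * norm (v - v')"
        using C(1) by (simp add: mult_left_mono)
    qed auto
    also have "\<dots> = (C * L) * norm (v' - v)"
      by (simp add: norm_minus_commute)
    finally show ?thesis .
  qed
  with r(1) show thesis
    by (intro that[of r "C * L"]) (auto simp: f_def)
qed

end

section \<open>Asymptotic rays\<close>

context hadamard_mfd
begin

text \<open>The geodesic from x to q, run backwards, is the geodesic from q to x.\<close>

lemma rexp_segment: "rexp M x (\<tau> *\<^sub>R rexp_inv M x q) = rexp M q ((1 - \<tau>) *\<^sub>R rexp_inv M q x)"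
proof -
  define w where "w = rexp_inv M x q"
  define \<gamma> where "\<gamma> = (\<lambda>s. geo x w (- 1 * s + 1))"
  have \<gamma>: "geodesic_line M \<gamma>"
    unfolding \<gamma>_def by (rule geodesic_affine(1)[OF geo(1)])
  have "\<gamma> 0 = q"
    using rexp_geo[of x w] by (simp add: \<gamma>_def w_def)
  then obtain w' where eq: "\<gamma> = geo q w'"
    using geo_unique[OF \<gamma> _ refl] by blast
  have "rexp M q w' = x"
    using fun_cong[OF eq, of 1] geo(2)[of x w] by (simp add: rexp_geo \<gamma>_def)
  then have w': "w' = rexp_inv M q x"
    by (metis rexp_inv(2))
  have "geo x w \<tau> = geo q w' (1 - \<tau>)"
    using fun_cong[OF eq, of "1 - \<tau>"] by (simp add: \<gamma>_def)
  then show ?thesis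
    by (simp add: rexp_scale w' w_def)
qed

text \<open>Seen from the common end point q, the two points lie at parameter 1 - \<tau> on the
  geodesics to x and to y, so the contraction at q applies.\<close>

lemma geodesics_to_point_comparison:
  assumes "0 \<le> \<tau>" "\<tau> < 1"
  shows "rdist M (rexp M x (\<tau> *\<^sub>R rexp_inv M x q)) (rexp M y (\<tau> *\<^sub>R rexp_inv M y q)) \<le> (1 - \<tau>) * rdist M x y"
  using rdist_rexp_scaled[of "1 - \<tau>" q "rexp_inv M q x" "rexp_inv M q y"] assms
  by (simp add: rexp_segment[of _ \<tau> q])

lemma asymptotic_iff: "asymptotic M \<gamma> \<sigma> \<longleftrightarrow> (\<exists>B. \<forall>t\<ge>0. rdist M (\<gamma> t) (\<sigma> t) \<le> B)"
  by (auto simp: asymptotic_def bounded_iff rdist_nonneg)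

lemma asymptotic_sym: "asymptotic M \<gamma> \<sigma> \<Longrightarrow> asymptotic M \<sigma> \<gamma>"
  by (simp add: asymptotic_def rdist_sym)

lemma asymptotic_trans:
  assumes "asymptotic M \<gamma> \<sigma>" "asymptotic M \<sigma> \<kappa>"
  shows "asymptotic M \<gamma> \<kappa>"
proof -
  obtain B where B: "\<And>t. 0 \<le> t \<Longrightarrow> rdist M (\<gamma> t) (\<sigma> t) \<le> B"
    using assms(1) unfolding asymptotic_iff by blast
  obtain C where C: "\<And>t. 0 \<le> t \<Longrightarrow> rdist M (\<sigma> t) (\<kappa> t) \<le> C"
    using assms(2) unfolding asymptotic_iff by blast
  have "rdist M (\<gamma> t) (\<kappa> t) \<le> B + C" if "0 \<le> t" for t
    using rdist_triangle[of "\<gamma> t" "\<kappa> t" "\<sigma> t"] B[OF that] C[OF that] by linarith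
  then show ?thesis
    unfolding asymptotic_iff by (intro exI allI impI)
qed

lemma asymptotic_ray_unique:
  assumes "asymptotic M (ray M q u) (ray M q v)"
  shows "u = v"
proof (rule ccontr)
  assume "u \<noteq> v"
  then have k: "tnorm M q (v - u) > 0"
    by (intro tnorm_pos) simp
  obtain B where B: "\<And>t. 0 \<le> t \<Longrightarrow> rdist M (ray M q u t) (ray M q v t) \<le> B"
    using assms unfolding asymptotic_iff by blast
  \<comment> \<open>At this time the lower bound t |v - u| for the distance of the two rays exceeds
    B.\<close>
  define t where "t = (\<bar>B\<bar> + 1) / tnorm M q (v - u)"
  have t: "t \<ge> 0"
    using k by (simp add: t_def)
  have "\<bar>B\<bar> + 1 = t * tnorm M q (v - u)"
    using k by (simp add: t_def)
  also have "\<dots> = tnorm M q (t *\<^sub>R v - t *\<^sub>R u)"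
    using t by (simp add: tnorm_scale flip: scaleR_diff_right)
  also have "\<dots> \<le> B"
    using rdist_rexp_ge[of q "t *\<^sub>R v" "t *\<^sub>R u"] B[OF t] by (simp add: ray_def)
  finally show False
    by linarith
qed

lemma compact_unit_vectors: "compact {v. tnorm M x v = 1}"
proof -
  obtain m where m: "m > 0" "\<And>w. m * norm w \<le> tnorm M x w"
    using tnorm_lower[of x] by blast
  have "bounded {v. tnorm M x v = 1}"
    unfolding bounded_iff
  proof (intro exI[of _ "1 / m"] ballI)
    fix v assume "v \<in> {v. tnorm M x v = 1}"
    then show "norm v \<le> 1 / m"
      using m(2)[of v] m(1) by (simp add: pos_le_divide_eq mult.commute)
  qed
  moreover have "continuous_on UNIV (tnorm M x)"
    unfolding tnorm_def
    by (intro continuous_on_real_sqrt bilinear_continuous_on_compose[OF _ _ metric_bilinear] continuous_on_id)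
  then have "closed {v. tnorm M x v = 1}"
    by (intro closed_Collect_eq continuous_on_const)
  ultimately show ?thesis
    by (simp add: compact_eq_bounded_closed)
qed

lemma rdist_ray: "tnorm M q e = 1 \<Longrightarrow> rdist M q (ray M q e t) = \<bar>t\<bar>"
  by (simp add: ray_def rdist_rexp tnorm_scale)

lemma rdist_along_ray: "tnorm M q e = 1 \<Longrightarrow> rdist M (ray M q e s) (ray M q e t) \<le> \<bar>t - s\<bar>"
  using geodesic_rdist_le[OF geo(1), of q e s t] by (simp add: ray_def rexp_scale geo(2,3))

text \<open>For large n the vector v n is the unit vector at x pointing to the point of the ray at
  time n; u is a limit of a subsequence. The bound D + 2 at time t has three parts: 1 for replacing
  u by v n, D for comparing the geodesics from x and from p to the far point, and 1 for their
  different lengths.\<close>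

lemma asymptotic_ray_exists:
  assumes e: "tnorm M p e = 1"
  shows "\<exists>u. tnorm M x u = 1 \<and> asymptotic M (ray M p e) (ray M x u)"
proof -
  define D where "D = rdist M x p"
  define L where "L n = rdist M x (ray M p e (real n))" for n
  define v where "v n = rexp_inv M x (ray M p e (real n)) /\<^sub>R L n" for n
  have L: "\<bar>L n - real n\<bar> \<le> D" for n
    using rdist_triangle[of x "ray M p e (real n)" p] rdist_triangle[of p "ray M p e (real n)" x]
      rdist_ray[OF e, of "real n"] by (simp add: L_def D_def rdist_sym)
  have D: "D \<ge> 0"
    by (simp add: D_def rdist_nonneg)
  \<comment> \<open>From N on the far point differs from x, so that v n is a unit vector; the
    sequence is shifted accordingly.\<close>
  obtain N where N: "real N > D"
    using reals_Archimedean2 by blast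
  have unit: "tnorm M x (v (N + k)) = 1" for k
  proof -
    have "L (N + k) > 0"
      using L[of "N + k"] N by simp
    then show ?thesis
      by (simp add: v_def tnorm_scale rdist_rexp_inv L_def)
  qed
  then have "\<forall>k. v (N + k) \<in> {v. tnorm M x v = 1}"
    by simp
  then obtain u r where u: "u \<in> {v. tnorm M x v = 1}" "strict_mono r" "((\<lambda>k. v (N + k)) \<circ> r) \<longlonglongrightarrow> u"
    using compact_unit_vectors[of x] unfolding compact_eq_seq_compact_metric by (elim seq_compactE)
  have "rdist M (ray M p e t) (ray M x u t) \<le> D + 2" if t: "t \<ge> 0" for t
  proof -
    obtain \<delta> C where \<delta>: "\<delta> > 0"
      "\<And>v'. norm (v' - t *\<^sub>R u) < \<delta> \<Longrightarrow> rdist M (rexp M x v') (rexp M x (t *\<^sub>R u)) \<le> C * norm (v' - t *\<^sub>R u)"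
      by (rule rdist_rexp_local[of "t *\<^sub>R u" x]) (rule that)
    let ?y = "\<lambda>k. norm (t *\<^sub>R v (N + r k) - t *\<^sub>R u)"
    have "?y \<longlonglongrightarrow> norm (t *\<^sub>R u - t *\<^sub>R u)"
      using u(3) unfolding o_def by (intro tendsto_intros)
    then have y: "?y \<longlonglongrightarrow> 0" "(\<lambda>k. C * ?y k) \<longlonglongrightarrow> 0"
      by (auto intro: tendsto_mult_right_zero)
    \<comment> \<open>Since L n differs from n by at most D, this gives t D + t + 1 <= L n. Hence t
      < L n, so that \<tau> < 1, and t D <= L n, so that the error \<tau> D of the parametrisation
      is at most 1.\<close>
    have "\<forall>\<^sub>F k in sequentially. D + (t * D + t + 1) \<le> real k"
      using filterlim_real_sequentially unfolding filterlim_at_top by (rule spec)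
    then have "\<forall>\<^sub>F k in sequentially. ?y k < \<delta> \<and> C * ?y k < 1 \<and> D + (t * D + t + 1) \<le> real k"
      using order_tendstoD(2)[OF y(1) \<delta>(1)] order_tendstoD(2)[OF y(2), of 1]
      by (intro eventually_conj) simp_all
    then obtain k where k: "?y k < \<delta>" "C * ?y k < 1" "D + (t * D + t + 1) \<le> real k"
      using eventually_happens'[OF sequentially_bot] by blast
    define n where "n = N + r k"
    have "real k \<le> real n"
      using seq_suble[OF u(2), of k] by (simp add: n_def)
    with L[of n] k(3) have Ln: "t * D + t + 1 \<le> L n"
      by linarith
    have "t * D \<ge> 0"
      using t D by simp
    then have Lt: "L n > 0" "t < L n" "t * D \<le> L n"
      using Ln t by linarith+
    \<comment> \<open>The geodesic from x to the far point has length L n, the one from p has length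
      n. At the common fraction \<tau> they have reached the arc lengths t and \<tau> n.\<close>
    define \<tau> where "\<tau> = t / L n"
    have \<tau>: "0 \<le> \<tau>" "\<tau> < 1"
      using Lt t by (simp_all add: \<tau>_def)
    have 1: "rdist M (rexp M x (t *\<^sub>R v n)) (ray M x u t) \<le> 1"
      using \<delta>(2)[of "t *\<^sub>R v n"] k(1,2) by (simp add: n_def ray_def)
    have "\<tau> *\<^sub>R rexp_inv M x (ray M p e (real n)) = t *\<^sub>R v n"
      by (simp add: \<tau>_def v_def divide_inverse)
    moreover have "rexp M p (\<tau> *\<^sub>R rexp_inv M p (ray M p e (real n))) = ray M p e (\<tau> * real n)"
      by (simp add: ray_def)
    ultimately have "rdist M (rexp M x (t *\<^sub>R v n)) (ray M p e (\<tau> * real n)) \<le> (1 - \<tau>) * D"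
      using geodesics_to_point_comparison[OF \<tau>, of x "ray M p e (real n)" p] by (simp add: D_def)
    also have "\<dots> \<le> D"
      using \<tau> D by (simp add: mult_left_le_one_le)
    finally have 2: "rdist M (rexp M x (t *\<^sub>R v n)) (ray M p e (\<tau> * real n)) \<le> D" .
    have "\<bar>\<tau> * real n - t\<bar> = \<tau> * \<bar>L n - real n\<bar>"
    proof -
      have "\<tau> * real n - t = \<tau> * (real n - L n)"
        using Lt by (simp add: \<tau>_def field_simps)
      then show ?thesis
        using \<tau> by (simp add: abs_mult abs_minus_commute)
    qed
    also have "\<dots> \<le> \<tau> * D"
      by (rule mult_left_mono[OF L \<tau>(1)])
    also have "\<dots> \<le> 1"
      using Lt by (simp add: \<tau>_def)
    finally have 3: "rdist M (ray M p e t) (ray M p e (\<tau> * real n)) \<le> 1"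
      using rdist_along_ray[OF e, of t "\<tau> * real n"] by linarith
    show ?thesis
      using 1 2 3 rdist_triangle[of "ray M p e t" "ray M x u t" "ray M p e (\<tau> * real n)"]
        rdist_triangle[of "ray M p e (\<tau> * real n)" "ray M x u t" "rexp M x (t *\<^sub>R v n)"]
        rdist_sym[of "rexp M x (t *\<^sub>R v n)" "ray M p e (\<tau> * real n)"] by linarith
  qed
  then have "asymptotic M (ray M p e) (ray M x u)"
    unfolding asymptotic_iff by (intro exI allI impI)
  then show ?thesis
    using u(1) by (intro exI[of _ u] conjI) simp_all
qed

section \<open>The maps Y and V\<close>

lemma eta_dir_eq:
  assumes "tnorm M p e = 1" "asymptotic M (ray M p e) (ray M x (- (v /\<^sub>R tnorm M x v)))"
  shows "eta_dir M p x v = e"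
  unfolding eta_dir_def
proof (rule the_equality)
  fix e' assume "tnorm M p e' = 1 \<and> asymptotic M (ray M p e') (ray M x (- (v /\<^sub>R tnorm M x v)))"
  then have "asymptotic M (ray M p e') (ray M x (- (v /\<^sub>R tnorm M x v)))"
    by (rule conjunct2)
  then show "e' = e"
    by (rule asymptotic_ray_unique[OF asymptotic_trans[OF _ asymptotic_sym[OF assms(2)]]])
qed (use assms in simp)

lemma eta_dir:
  assumes "v \<noteq> 0"
  shows "tnorm M p (eta_dir M p x v) = 1"
    "asymptotic M (ray M p (eta_dir M p x v)) (ray M x (- (v /\<^sub>R tnorm M x v)))"
proof -
  have "tnorm M x (- (v /\<^sub>R tnorm M x v)) = 1"
    using tnorm_pos[OF assms, of x] by (simp add: tnorm_minus tnorm_scale)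
  from asymptotic_ray_exists[OF this, of p] obtain e
    where e: "tnorm M p e = 1" "asymptotic M (ray M x (- (v /\<^sub>R tnorm M x v))) (ray M p e)"
    by (elim exE conjE)
  note e = e(1) asymptotic_sym[OF e(2)]
  with eta_dir_eq[OF e] show "tnorm M p (eta_dir M p x v) = 1"
    "asymptotic M (ray M p (eta_dir M p x v)) (ray M x (- (v /\<^sub>R tnorm M x v)))"
    by simp_all
qed

lemma u_dir_eq:
  assumes "tnorm M x u = 1" "asymptotic M (ray M p (eta_pt M p y)) (ray M x (- u))"
  shows "u_dir M p x y = u"
  unfolding u_dir_def
proof (rule the_equality)
  fix u' assume "tnorm M x u' = 1 \<and> asymptotic M (ray M p (eta_pt M p y)) (ray M x (- u'))"
  then have "asymptotic M (ray M p (eta_pt M p y)) (ray M x (- u'))"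
    by (rule conjunct2)
  from asymptotic_trans[OF asymptotic_sym[OF this] assms(2)] have "- u' = - u"
    by (rule asymptotic_ray_unique)
  then show "u' = u"
    by simp
qed (use assms in simp)

lemma rdist_pos: "y \<noteq> p \<Longrightarrow> rdist M p y > 0"
  using tnorm_pos[of "rexp_inv M p y" p] rexp_inv(1)[of p y] by (fastforce simp: rdist_rexp_inv)

lemma eta_pt_unit: "y \<noteq> p \<Longrightarrow> tnorm M p (eta_pt M p y) = 1"
  using rdist_pos[of y p] by (simp add: eta_pt_def tnorm_minus tnorm_scale rdist_rexp_inv)

lemma u_dir:
  assumes "y \<noteq> p"
  shows "tnorm M x (u_dir M p x y) = 1" "asymptotic M (ray M p (eta_pt M p y)) (ray M x (- u_dir M p x y))"
proof -
  from asymptotic_ray_exists[OF eta_pt_unit[OF assms], of x] obtain w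
    where w: "tnorm M x w = 1" "asymptotic M (ray M p (eta_pt M p y)) (ray M x w)"
    by (elim exE conjE)
  have "u_dir M p x y = - w"
    by (rule u_dir_eq) (use w in \<open>simp_all add: tnorm_minus\<close>)
  with w show "tnorm M x (u_dir M p x y) = 1" "asymptotic M (ray M p (eta_pt M p y)) (ray M x (- u_dir M p x y))"
    by (simp_all add: tnorm_minus)
qed

text \<open>y lies at distance |v| from p in direction -e, so \<open>eta_pt\<close> of y is e again.
  The relation that defines e from v then identifies \<open>u_dir\<close> as v/|v|.\<close>

lemma V_map_Y_map: "V_map M p x (Y_map M p x v) = v"
proof (cases "v = 0")
  case False
  define e where "e = eta_dir M p x v"
  define y where "y = rexp M p (- tnorm M x v *\<^sub>R e)"
  note e = eta_dir[OF False, of p x, folded e_def]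
  have k: "tnorm M x v > 0"
    using False by (rule tnorm_pos)
  have d: "rdist M p y = tnorm M x v"
    using e(1) k by (simp add: y_def rdist_rexp tnorm_scale tnorm_minus)
  have "y \<noteq> p"
    using d k rdist_rexp[of p 0] by (auto simp: tnorm_0)
  moreover have "eta_pt M p y = e"
    unfolding eta_pt_def d using k by (simp add: y_def)
  then have "u_dir M p x y = v /\<^sub>R tnorm M x v"
    using e(2) k by (intro u_dir_eq) (simp_all add: tnorm_scale)
  moreover have "Y_map M p x v = y"
    using False by (simp add: Y_map_def y_def e_def)
  ultimately show ?thesis
    using k d by (simp add: V_map_def)
qed (simp add: V_map_def Y_map_def)

text \<open>Here |v| = d(p, y), and \<open>eta_pt M p y\<close> satisfies the relation defining
  \<open>eta_dir\<close> for v, so Y recovers y from its distance and its direction.\<close>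

lemma Y_map_V_map: "Y_map M p x (V_map M p x y) = y"
proof (cases "y = p")
  case False
  define v where "v = V_map M p x y"
  have k: "rdist M p y > 0"
    using False by (rule rdist_pos)
  have v: "v = rdist M p y *\<^sub>R u_dir M p x y"
    using False by (simp add: v_def V_map_def)
  have n: "tnorm M x v = rdist M p y"
    using k u_dir(1)[OF False, of x] by (simp add: v tnorm_scale)
  have "eta_dir M p x v = eta_pt M p y"
    by (rule eta_dir_eq[OF eta_pt_unit[OF False]]) (use u_dir(2)[OF False, of x] k in \<open>simp add: n, simp add: v\<close>)
  moreover have "v \<noteq> 0"
    using n k by (auto simp: tnorm_0)
  ultimately have "Y_map M p x v = y"
    using k by (simp add: Y_map_def n eta_pt_def)
  then show ?thesis
    by (simp add: v_def)
qed (simp add: V_map_def Y_map_def)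

end

theorem lemma5:
  fixes M :: "('m::{t2_space,second_countable_topology}, 'e::euclidean_space) riemannian"
    and p :: 'm
  assumes "hadamard_manifold M"
  shows "(\<forall>x v. V_map M p x (Y_map M p x v) = v) \<and>
    (\<forall>x y. Y_map M p x (V_map M p x y) = y) \<and>
    (\<forall>x y. V_map M p x y \<in> B_subdifferential M p (\<lambda>z. busemann_coupling M p z y) x) \<and>
    (\<forall>x y z. busemann_coupling M p z y =
       busemann_coupling M p x y
       + busemann_coupling M p z (Y_map M p x (V_map M p x y))
       - busemann_coupling M p x (Y_map M p x (V_map M p x y)))"
proof -
  interpret hadamard_mfd M
    by unfold_locales (use assms in \<open>auto simp: hadamard_manifold_def\<close>)
  show ?thesis
    by (simp add: V_map_Y_map Y_map_V_map B_subdifferential_def)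
qed

end
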